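(* Let $X$ be a metrizable space. Then: (1) The following are equivalent: (i) $F_n(X)$ is Fréchet-Urysohn for each $n\in\mathbb N$; (ii) $F_5(X)$ is Fréchet-Urysohn; (iii) $X$ is compact or discrete. (2) The following are equivalent: (i) $A_n(X)$ is Fréchet-Urysohn for each $n\in\mathbb N$; (ii) $A_3(X)$ is Fréchet-Urysohn; (iii) $F_4(X)$ is Fréchet-Urysohn; (iv) $F_3(X)$ is Fréchet-Urysohn; (v) the set of all non-isolated points of $X$ is compact. (3) Both $A_2(X)$ and $F_2(X)$ are Fréchet-Urysohn.
   Context: For a Tychonoff space $X$, $F(X)$ (resp. $A(X)$) denotes the (Markov) free topological group (resp. free abelian topological group) on $X$: as an abstract group it is the free group (resp. free abelian group) on the set $X$, it carries a group topology inducing the original topology on $X$, and every continuous map from $X$ to an arbitrary topological group (resp. abelian topological group) extends uniquely to a continuous homomorphism from $F(X)$ (resp. $A(X)$). For $n\in\mathbb N=\{1,2,\ldots\}$, $F_n(X)\subseteq F(X)$ and $A_n(X)\subseteq A(X)$ are the subsets consisting of all words of reduced length at most $n$ (with respect to the free basis $X$), equipped with the subspace topologies. A topological space $Y$ is Fréchet-Urysohn if for every $A\subseteq Y$ and every $y\in\overline{A}$ there is a sequence of points of $A$ converging to $y$. *)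

theory Defs
  imports "HOL-Analysis.Analysis" "HOL-Algebra.Free_Abelian_Groups"
begin

section \<open>Frechet-Urysohn spaces\<close>

definition frechet_urysohn_space :: "'a topology \<Rightarrow> bool" where
  "frechet_urysohn_space Y \<longleftrightarrow>
     (\<forall>A y. A \<subseteq> topspace Y \<and> y \<in> Abstract_Topology.closure_of Y A \<longrightarrow>
        (\<exists>s :: nat \<Rightarrow> 'a. range s \<subseteq> A \<and> limitin Y s y sequentially))"

definition nonisolated_points :: "'a topology \<Rightarrow> 'a set" where
  "nonisolated_points X = {x \<in> topspace X. \<not> openin X {x}}"


section \<open>The free group on a set\<close>

text \<open>The letter \<open>(x, True)\<close> is the generator \<open>x\<close>, and \<open>(x, False)\<close> is its formal inverse.\<close>

type_synonym 'a word = "('a \<times> bool) list"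

definition inv_letter :: "'a \<times> bool \<Rightarrow> 'a \<times> bool" where
  "inv_letter a = (fst a, \<not> snd a)"

definition reduced_word :: "'a word \<Rightarrow> bool" where
  "reduced_word w \<longleftrightarrow> successively (\<lambda>a b. b \<noteq> inv_letter a) w"

fun push_letter :: "'a \<times> bool \<Rightarrow> 'a word \<Rightarrow> 'a word" where
  "push_letter a [] = [a]"
| "push_letter a (b # w) = (if b = inv_letter a then w else a # b # w)"

definition free_group :: "'a set \<Rightarrow> 'a word monoid" where
  "free_group S =
     \<lparr>carrier = {w. reduced_word w \<and> fst ` set w \<subseteq> S},
      monoid.mult = (\<lambda>u v. foldr push_letter u v), one = []\<rparr>"

abbreviation free_gen :: "'a \<Rightarrow> 'a word" where
  "free_gen x \<equiv> [(x, True)]"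

lemma inv_letter_simps [simp]:
  "inv_letter (inv_letter a) = a" "inv_letter a \<noteq> a" "a \<noteq> inv_letter a"
  "fst (inv_letter a) = fst a"
  by (auto simp: inv_letter_def prod_eq_iff)

lemma inv_letter_eq_iff: "a = inv_letter b \<longleftrightarrow> b = inv_letter a"
  by auto

lemma reduced_word_Nil [simp]: "reduced_word []"
  by (simp add: reduced_word_def)

lemma reduced_word_Cons:
  "reduced_word (a # w) \<longleftrightarrow> (w = [] \<or> hd w \<noteq> inv_letter a) \<and> reduced_word w"
  by (auto simp: reduced_word_def successively_Cons)

lemma reduced_push: "reduced_word w \<Longrightarrow> reduced_word (push_letter a w)"
  by (cases w) (auto simp: reduced_word_Cons)

lemma set_push: "fst ` set (push_letter a w) \<subseteq> insert (fst a) (fst ` set w)"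
  by (cases w) auto

lemma push_inv: "reduced_word w \<Longrightarrow> push_letter a (push_letter (inv_letter a) w) = w"
proof (cases w)
  case (Cons b v)
  assume "reduced_word w"
  then show ?thesis
    using Cons by (cases v) (auto simp: reduced_word_Cons)
qed auto

lemma push_inv': "reduced_word w \<Longrightarrow> push_letter (inv_letter a) (push_letter a w) = w"
  using push_inv[of w "inv_letter a"] by simp

lemma reduced_foldr: "reduced_word v \<Longrightarrow> reduced_word (foldr push_letter u v)"
  by (induction u) (auto intro: reduced_push)

lemma set_foldr: "fst ` set (foldr push_letter u v) \<subseteq> fst ` set u \<union> fst ` set v"
proof (induction u)
  case (Cons a u)
  then show ?case using set_push[of a "foldr push_letter u v"] by (simp, blast)
qed auto

lemma foldr_push:
  assumes "reduced_word w"
  shows "foldr push_letter (push_letter a v) w = push_letter a (foldr push_letter v w)"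
proof (cases v)
  case (Cons b u)
  then show ?thesis
    using push_inv[OF reduced_foldr[OF assms], of a u] by auto
qed auto

lemma foldr_push_assoc:
  assumes "reduced_word w"
  shows "foldr push_letter (foldr push_letter u v) w = foldr push_letter u (foldr push_letter v w)"
  by (induction u) (auto simp: foldr_push[OF assms])

lemma foldr_push_Nil: "reduced_word w \<Longrightarrow> foldr push_letter w [] = w"
proof (induction w)
  case (Cons a w)
  then show ?case by (cases w) (auto simp: reduced_word_Cons)
qed auto

lemma foldr_push_inverse:
  "reduced_word w \<Longrightarrow> foldr push_letter (rev (map inv_letter w)) (foldr push_letter w v) = v"
  if "reduced_word v"
proof (induction w)
  case (Cons a w)
  then show ?case
    by (simp add: reduced_word_Cons push_inv'[OF reduced_foldr[OF that]])
qed auto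

lemma reduced_inverse:
  assumes "reduced_word w"
  shows "reduced_word (rev (map inv_letter w))"
  using assms unfolding reduced_word_def successively_rev successively_map
  by (rule successively_mono) auto

lemma carrier_free_group: "carrier (free_group S) = {w. reduced_word w \<and> fst ` set w \<subseteq> S}"
  and mult_free_group: "mult (free_group S) u v = foldr push_letter u v"
  and one_free_group: "one (free_group S) = []"
  by (simp_all add: free_group_def)

lemma group_free_group: "group (free_group S)"
proof (rule groupI)
  fix x y assume "x \<in> carrier (free_group S)" "y \<in> carrier (free_group S)"
  then show "x \<otimes>\<^bsub>free_group S\<^esub> y \<in> carrier (free_group S)"
    using order_trans[OF set_foldr[of x y], of S]
    by (simp add: carrier_free_group mult_free_group reduced_foldr)
next
  fix x assume x: "x \<in> carrier (free_group S)"
  let ?y = "rev (map inv_letter x)"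
  have "?y \<in> carrier (free_group S)"
    using x by (auto simp: carrier_free_group reduced_inverse)
  moreover have "foldr push_letter ?y x = []"
    using x foldr_push_inverse[of "[]" x] by (simp add: carrier_free_group foldr_push_Nil)
  ultimately show "\<exists>y\<in>carrier (free_group S). y \<otimes>\<^bsub>free_group S\<^esub> x = \<one>\<^bsub>free_group S\<^esub>"
    by (auto simp: mult_free_group one_free_group)
qed (auto simp: carrier_free_group mult_free_group one_free_group foldr_push_assoc)

lemma free_gen_in_free_group: "x \<in> S \<Longrightarrow> free_gen x \<in> carrier (free_group S)"
  by (simp add: carrier_free_group reduced_word_Cons)

lemma free_group_hom_unique:
  assumes H: "group H" and h: "h \<in> hom (free_group S) H" and k: "k \<in> hom (free_group S) H"
    and eq: "\<And>x. x \<in> S \<Longrightarrow> h (free_gen x) = k (free_gen x)"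
    and w: "w \<in> carrier (free_group S)"
  shows "h w = k w"
proof -
  interpret h: group_hom "free_group S" H h
    using H h by (simp add: group_hom_def group_hom_axioms_def group_free_group)
  interpret k: group_hom "free_group S" H k
    using H k by (simp add: group_hom_def group_hom_axioms_def group_free_group)
  have letter: "h [a] = k [a]" if "fst a \<in> S" for a
  proof (cases a)
    case (Pair x b)
    with that have x: "x \<in> S" by simp
    have inv: "inv\<^bsub>free_group S\<^esub> (free_gen x) = [(x, False)]"
      using x by (intro h.G.inv_equality)
        (auto simp: carrier_free_group mult_free_group one_free_group reduced_word_Cons inv_letter_def)
    show ?thesis
    proof (cases b)
      case True then show ?thesis using Pair x eq by simp
    next
      case False
      then show ?thesis
        using Pair x eq[OF x] inv h.hom_inv[OF free_gen_in_free_group[OF x]]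
          k.hom_inv[OF free_gen_in_free_group[OF x]] by simp
    qed
  qed
  show ?thesis
    using w
  proof (induction w)
    case Nil
    then show ?case using h.hom_one k.hom_one by (simp add: one_free_group)
  next
    case (Cons a w)
    then have w: "w \<in> carrier (free_group S)" and a: "[a] \<in> carrier (free_group S)" "fst a \<in> S"
      by (auto simp: carrier_free_group reduced_word_Cons)
    have "[a] \<otimes>\<^bsub>free_group S\<^esub> w = a # w"
      using Cons.prems by (cases w) (auto simp: mult_free_group carrier_free_group reduced_word_Cons)
    then show ?case
      using h.hom_mult[OF a(1) w] k.hom_mult[OF a(1) w] Cons.IH[OF w] letter[OF a(2)] by simp
  qed
qed

lemma free_group_hom_exists:
  assumes H: "group H" and f: "\<And>x. x \<in> S \<Longrightarrow> f x \<in> carrier H"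
  shows "\<exists>h \<in> hom (free_group S) H. \<forall>x\<in>S. h (free_gen x) = f x"
proof -
  interpret H: group H by (rule H)
  define l where "l a = (if snd a then f (fst a) else inv\<^bsub>H\<^esub> (f (fst a)))" for a
  define h where "h w = foldr (\<lambda>a z. l a \<otimes>\<^bsub>H\<^esub> z) w \<one>\<^bsub>H\<^esub>" for w
  have l: "l a \<in> carrier H" if "fst a \<in> S" for a
    using f[OF that] by (simp add: l_def)
  have l_inv: "l a \<otimes>\<^bsub>H\<^esub> l (inv_letter a) = \<one>\<^bsub>H\<^esub>" if "fst a \<in> S" for a
    using f[OF that] by (simp add: l_def inv_letter_def)
  have h_carr: "h w \<in> carrier H" if "fst ` set w \<subseteq> S" for w
    using that by (induction w) (auto simp: h_def l)
  have h_Cons: "h (a # w) = l a \<otimes>\<^bsub>H\<^esub> h w" for a w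
    by (simp add: h_def)
  have h_push: "h (push_letter a w) = l a \<otimes>\<^bsub>H\<^esub> h w" if "fst a \<in> S" "fst ` set w \<subseteq> S" for a w
  proof (cases "w \<noteq> [] \<and> hd w = inv_letter a")
    case True
    then obtain v where w: "w = inv_letter a # v" by (cases w) auto
    with that have v: "fst ` set v \<subseteq> S" by simp
    have "l a \<otimes>\<^bsub>H\<^esub> h w = (l a \<otimes>\<^bsub>H\<^esub> l (inv_letter a)) \<otimes>\<^bsub>H\<^esub> h v"
      using that l h_carr[OF v] by (simp add: w h_Cons H.m_assoc)
    then show ?thesis using l_inv[OF that(1)] h_carr[OF v] w by simp
  next
    case False
    then have "push_letter a w = a # w" by (cases w) auto
    then show ?thesis by (simp add: h_Cons)
  qed
  have h_mult: "h (foldr push_letter u v) = h u \<otimes>\<^bsub>H\<^esub> h v"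
    if "fst ` set u \<subseteq> S" "fst ` set v \<subseteq> S" for u v
    using that
  proof (induction u)
    case Nil
    then show ?case using h_carr by (simp add: h_def)
  next
    case (Cons a u)
    then have "fst ` set (foldr push_letter u v) \<subseteq> S"
      by (intro order_trans[OF set_foldr[of u v]]) auto
    then have "h (foldr push_letter (a # u) v) = l a \<otimes>\<^bsub>H\<^esub> (h u \<otimes>\<^bsub>H\<^esub> h v)"
      using Cons by (simp add: h_push)
    also have "\<dots> = h (a # u) \<otimes>\<^bsub>H\<^esub> h v"
      using Cons.prems l h_carr by (simp add: h_Cons H.m_assoc)
    finally show ?case .
  qed
  show ?thesis
  proof (intro bexI ballI)
    show "h \<in> hom (free_group S) H"
      by (auto simp: hom_def carrier_free_group mult_free_group h_carr h_mult)
    show "h (free_gen x) = f x" if "x \<in> S" for x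
      using f[OF that] by (simp add: h_def l_def)
  qed
qed


section \<open>Topological groups\<close>

definition topological_group :: "('g, 'm) monoid_scheme \<Rightarrow> 'g topology \<Rightarrow> bool" where
  "topological_group G T \<longleftrightarrow>
     group G \<and> topspace T = carrier G \<and>
     continuous_map (prod_topology T T) T (\<lambda>(x, y). x \<otimes>\<^bsub>G\<^esub> y) \<and>
     continuous_map T T (\<lambda>x. inv\<^bsub>G\<^esub> x)"

text \<open>
  \<open>T\<close> is the free group topology on \<open>G\<close> over the space \<open>X\<close>, embedded in \<open>G\<close> by \<open>e\<close>, relative to the
  class \<open>P\<close> of groups.  HOL cannot quantify over all types inside a definition, so the target
  groups range over those whose elements have the same type as the elements of \<open>G\<close>.  This is no
  restriction: the lemmas \<open>free_topology_universal\<close> and \<open>free_abelian_topology_universal\<close> give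
  the universal property for target groups over an arbitrary type.
\<close>

definition is_free_group_topology ::
  "('g monoid \<Rightarrow> bool) \<Rightarrow> 'g monoid \<Rightarrow> ('a \<Rightarrow> 'g) \<Rightarrow> 'a topology \<Rightarrow> 'g topology \<Rightarrow> bool" where
  "is_free_group_topology P G e X T \<longleftrightarrow>
     topological_group G T \<and> embedding_map X T e \<and>
     (\<forall>H U f. P H \<and> topological_group H U \<and> continuous_map X U f \<longrightarrow>
        (\<exists>!h. h \<in> extensional (carrier G) \<and> h \<in> hom G H \<and> continuous_map T U h \<and>
              (\<forall>x\<in>topspace X. h (e x) = f x)))"

lemma topological_group_pullback:
  assumes G: "group G" and U: "topological_group H U" and h: "h \<in> hom G H"
  shows "topological_group G (pullback_topology (carrier G) h U)"
proof -
  let ?T = "pullback_topology (carrier G) h U"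
  have H: "group H" and tsU: "topspace U = carrier H"
    and m: "continuous_map (prod_topology U U) U (\<lambda>(x, y). x \<otimes>\<^bsub>H\<^esub> y)"
    and i: "continuous_map U U (\<lambda>x. inv\<^bsub>H\<^esub> x)"
    using U by (auto simp: topological_group_def)
  interpret group_hom G H h using G H h by (simp add: group_hom_def group_hom_axioms_def)
  have ts: "topspace ?T = carrier G"
    using hom_closed by (auto simp: topspace_pullback_topology tsU)
  have ch: "continuous_map ?T U h"
    using continuous_map_pullback[of U U id "carrier G" h] by simp
  have "continuous_map (prod_topology ?T ?T) (prod_topology U U) (\<lambda>z. (h (fst z), h (snd z)))"
    by (intro continuous_map_pairedI continuous_map_compose[OF continuous_map_fst ch, unfolded o_def]
        continuous_map_compose[OF continuous_map_snd ch, unfolded o_def])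
  from continuous_map_compose[OF this m]
  have "continuous_map (prod_topology ?T ?T) U (h \<circ> (\<lambda>(x, y). x \<otimes>\<^bsub>G\<^esub> y))"
    by (rule continuous_map_eq) (auto simp: ts)
  then have 1: "continuous_map (prod_topology ?T ?T) ?T (\<lambda>(x, y). x \<otimes>\<^bsub>G\<^esub> y)"
    by (rule continuous_map_pullback') (auto simp: ts)
  have "continuous_map ?T U (h \<circ> (\<lambda>x. inv\<^bsub>G\<^esub> x))"
    by (rule continuous_map_eq[OF continuous_map_compose[OF ch i]]) (auto simp: ts)
  then have 2: "continuous_map ?T ?T (\<lambda>x. inv\<^bsub>G\<^esub> x)"
    by (rule continuous_map_pullback') (auto simp: ts)
  show ?thesis using 1 2 G ts by (simp add: topological_group_def)
qed

lemma topological_group_Sup: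
  assumes ne: "\<T> \<noteq> {}" and tg: "\<And>T. T \<in> \<T> \<Longrightarrow> topological_group G T"
  shows "topological_group G (topology_generated_by {W. \<exists>T\<in>\<T>. openin T W})"
    (is "topological_group G ?S")
proof -
  have G: "group G" using ne tg by (auto simp: topological_group_def)
  have tsT: "topspace T = carrier G" if "T \<in> \<T>" for T
    using tg[OF that] by (simp add: topological_group_def)
  have ts: "topspace ?S = carrier G"
  proof
    show "topspace ?S \<subseteq> carrier G"
      using tsT openin_subset by (fastforce simp: topology_generated_by_topspace)
    obtain T where T: "T \<in> \<T>" using ne by blast
    have "openin T (carrier G)" using tsT[OF T] openin_topspace[of T] by simp
    with T show "carrier G \<subseteq> topspace ?S" by (auto simp: topology_generated_by_topspace)
  qed
  have id: "continuous_map ?S T id" if T: "T \<in> \<T>" for T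
    unfolding continuous_map_alt
  proof (intro conjI allI impI)
    fix W assume W: "openin T W"
    have "openin ?S W" by (rule topology_generated_by_Basis) (use T W in blast)
    moreover have "W \<subseteq> topspace ?S" using openin_subset[OF W] tsT[OF T] ts by simp
    ultimately show "openin ?S (id -` W \<inter> topspace ?S)" by (simp add: inf.absorb1)
  qed (use ts tsT[OF T] in auto)
  have into: "continuous_map Y ?S g" if "\<And>T. T \<in> \<T> \<Longrightarrow> continuous_map Y T g" for Y :: "'c topology" and g
  proof (rule continuous_on_generated_topo)
    fix W assume "W \<in> {W. \<exists>T\<in>\<T>. openin T W}"
    then obtain T where "T \<in> \<T>" "openin T W" by blast
    then show "openin Y (g -` W \<inter> topspace Y)"
      using that continuous_map_alt by blast
  next
    obtain T where T: "T \<in> \<T>" using ne by blast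
    then have "g \<in> topspace Y \<rightarrow> carrier G" using that[OF T] tsT[OF T] by (auto simp: continuous_map_def)
    then show "g ` topspace Y \<subseteq> \<Union> {W. \<exists>T\<in>\<T>. openin T W}"
      using ts by (auto simp: topology_generated_by_topspace)
  qed
  have m: "continuous_map (prod_topology ?S ?S) ?S (\<lambda>(x, y). x \<otimes>\<^bsub>G\<^esub> y)"
  proof (rule into)
    fix T assume T: "T \<in> \<T>"
    have mT: "continuous_map (prod_topology T T) T (\<lambda>(x, y). x \<otimes>\<^bsub>G\<^esub> y)"
      using tg[OF T] by (simp add: topological_group_def)
    have "continuous_map (prod_topology ?S ?S) (prod_topology T T) id"
      using continuous_map_pairedI[OF continuous_map_compose[OF continuous_map_fst id[OF T]]
          continuous_map_compose[OF continuous_map_snd id[OF T]]]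
      by (simp add: id_def o_def)
    from continuous_map_compose[OF this mT]
    show "continuous_map (prod_topology ?S ?S) T (\<lambda>(x, y). x \<otimes>\<^bsub>G\<^esub> y)"
      by simp
  qed
  have i: "continuous_map ?S ?S (\<lambda>x. inv\<^bsub>G\<^esub> x)"
  proof (rule into)
    fix T assume T: "T \<in> \<T>"
    have "continuous_map T T (\<lambda>x. inv\<^bsub>G\<^esub> x)"
      using tg[OF T] by (simp add: topological_group_def)
    from continuous_map_compose[OF id[OF T] this]
    show "continuous_map ?S T (\<lambda>x. inv\<^bsub>G\<^esub> x)"
      by simp
  qed
  show ?thesis using G ts m i by (simp add: topological_group_def)
qed

lemma restrict_hom:
  assumes "group G" "h \<in> hom G H"
  shows "restrict h (carrier G) \<in> hom G H"
  using assms monoid.m_closed[OF group.is_monoid[OF assms(1)]] by (auto simp: hom_def)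

lemma topological_group_topology_eq:
  assumes P: "P G" and T: "is_free_group_topology P G e X T" and T': "topological_group G T'"
    and e: "continuous_map X T' e"
    and uniq: "\<And>k. k \<in> hom G G \<Longrightarrow> (\<And>x. x \<in> topspace X \<Longrightarrow> k (e x) = e x) \<Longrightarrow>
                 \<forall>g\<in>carrier G. k g = g"
  shows "continuous_map T T' id"
proof -
  obtain k where k: "k \<in> hom G G" "continuous_map T T' k" "\<forall>x\<in>topspace X. k (e x) = e x"
    using T P T' e unfolding is_free_group_topology_def by blast
  have "\<forall>g\<in>carrier G. k g = g"
    using uniq k by blast
  moreover have "topspace T = carrier G"
    using T by (simp add: is_free_group_topology_def topological_group_def)
  ultimately show ?thesis
    using k(2) by (auto elim!: continuous_map_eq)
qed

lemma is_free_group_topology_universal: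
  assumes P: "P G" and T: "is_free_group_topology P G e X T"
    and uniq: "\<And>k. k \<in> hom G G \<Longrightarrow> (\<And>x. x \<in> topspace X \<Longrightarrow> k (e x) = e x) \<Longrightarrow>
                 \<forall>g\<in>carrier G. k g = g"
    and U: "topological_group H U" and f: "continuous_map X U f"
    and h: "h \<in> hom G H" "\<And>x. x \<in> topspace X \<Longrightarrow> h (e x) = f x"
  shows "continuous_map T U h"
proof -
  let ?T' = "pullback_topology (carrier G) h U"
  have G: "group G" and tsT: "topspace T = carrier G" and emb: "embedding_map X T e"
    using T by (auto simp: is_free_group_topology_def topological_group_def)
  have "continuous_map X U (h \<circ> e)"
    by (rule continuous_map_eq[OF f]) (simp add: h)
  moreover have "e ` topspace X \<subseteq> carrier G"
    using emb tsT by (auto simp: embedding_map_def dest!: homeomorphic_imp_surjective_map)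
  ultimately have "continuous_map X ?T' e"
    by (intro continuous_map_pullback') auto
  then have "continuous_map T ?T' id"
    using topological_group_topology_eq[OF P T topological_group_pullback[OF G U h(1)] _ uniq]
    by blast
  moreover have "continuous_map ?T' U h"
    using continuous_map_pullback[of U U id "carrier G" h] by simp
  ultimately show ?thesis
    using continuous_map_compose by fastforce
qed

lemma ex1_is_free_group_topology:
  fixes X :: "'a topology" and G :: "'g monoid"
  assumes cr: "completely_regular_space X" and haus: "Hausdorff_space X"
    and PG: "P G" and P_group: "\<And>H. P H \<Longrightarrow> group H"
    and e: "e ` topspace X \<subseteq> carrier G"
    and hom_ex: "\<And>H f. P H \<Longrightarrow> f ` topspace X \<subseteq> carrier H \<Longrightarrow>
                   \<exists>h \<in> hom G H. \<forall>x\<in>topspace X. h (e x) = f x"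
    and hom_real: "\<And>f :: 'a \<Rightarrow> real.
                   \<exists>h \<in> hom G \<lparr>carrier = UNIV, monoid.mult = (+), one = 0\<rparr>.
                     \<forall>x\<in>topspace X. h (e x) = f x"
    and hom_uniq: "\<And>H h k g. P H \<Longrightarrow> h \<in> hom G H \<Longrightarrow> k \<in> hom G H \<Longrightarrow>
                   (\<And>x. x \<in> topspace X \<Longrightarrow> h (e x) = k (e x)) \<Longrightarrow>
                   g \<in> carrier G \<Longrightarrow> h g = k g"
  shows "\<exists>!T. is_free_group_topology P G e X T"
proof -
  define R :: "real monoid" where "R = \<lparr>carrier = UNIV, monoid.mult = (+), one = 0\<rparr>"
  define \<T> where "\<T> = {T. topological_group G T \<and> continuous_map X T e}"
  define S where "S = topology_generated_by {W. \<exists>T\<in>\<T>. openin T W}"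
  have G: "group G" using PG by (rule P_group)
  have R: "group R"
    unfolding R_def by (rule groupI) (auto intro: exI[of _ "- x" for x])
  have inv_R: "inv\<^bsub>R\<^esub> x = - x" for x
    by (rule group.inv_equality[OF R]) (auto simp: R_def)
  have tgR: "topological_group R euclidean"
  proof -
    have "continuous_map (prod_topology euclidean euclidean) euclidean (\<lambda>(x::real, y). x + y)"
      by (simp add: case_prod_unfold continuous_intros flip: euclidean_product_topology)
    moreover have "continuous_map euclidean euclidean (\<lambda>x::real. inv\<^bsub>R\<^esub> x)"
      by (simp add: inv_R continuous_intros)
    ultimately show ?thesis
      using R by (simp add: topological_group_def) (simp add: R_def)
  qed
  have in_T: "pullback_topology (carrier G) h U \<in> \<T>"
    if "topological_group H U" "h \<in> hom G H" "continuous_map X U (h \<circ> e)" for H :: "'h monoid" and U h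
    unfolding \<T>_def using that e topological_group_pullback[OF G]
    by (auto intro!: continuous_map_pullback')
  have real_T: "\<exists>h. pullback_topology (carrier G) h euclidean \<in> \<T> \<and>
                     (\<forall>x\<in>topspace X. h (e x) = f x)"
    if "continuous_map X euclidean f" for f :: "'a \<Rightarrow> real"
  proof -
    obtain h where h: "h \<in> hom G R" "\<forall>x\<in>topspace X. h (e x) = f x"
      using hom_real[of f] R_def by blast
    have "continuous_map X euclidean (h \<circ> e)"
      by (rule continuous_map_eq[OF that]) (simp add: h)
    then show ?thesis using in_T[OF tgR h(1)] h(2) by blast
  qed
  have "continuous_map X euclidean (\<lambda>x. 0::real)" by simp
  then have ne: "\<T> \<noteq> {}" using real_T by blast
  have tgS: "topological_group G S"
    unfolding S_def by (rule topological_group_Sup[OF ne]) (simp add: \<T>_def)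
  then have tsS: "topspace S = carrier G" by (simp add: topological_group_def)
  have S_open: "openin S W" if "T \<in> \<T>" "openin T W" for T W
    unfolding S_def by (rule topology_generated_by_Basis) (use that in blast)
  have S_id: "continuous_map S T id" if T: "T \<in> \<T>" for T
    unfolding continuous_map_alt
  proof (intro conjI allI impI)
    have tsT: "topspace T = carrier G" using T by (simp add: \<T>_def topological_group_def)
    then show "id \<in> topspace S \<rightarrow> topspace T" using tsS by simp
    fix W assume W: "openin T W"
    have "W \<subseteq> topspace S" using openin_subset[OF W] tsT tsS by simp
    then show "openin S (id -` W \<inter> topspace S)" using S_open[OF T W] by (simp add: inf.absorb1)
  qed
  have e_cont: "continuous_map X S e"
    unfolding S_def
  proof (rule continuous_on_generated_topo)
    fix W assume "W \<in> {W. \<exists>T\<in>\<T>. openin T W}"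
    then show "openin X (e -` W \<inter> topspace X)"
      by (auto simp: \<T>_def continuous_map_alt)
  next
    show "e ` topspace X \<subseteq> \<Union> {W. \<exists>T\<in>\<T>. openin T W}"
      using e tsS by (simp add: S_def topology_generated_by_topspace)
  qed
  have sep: "\<exists>W. openin S W \<and> e x \<in> W \<and> e -` W \<inter> topspace X \<subseteq> V"
    if V: "openin X V" and x: "x \<in> V" for V x
  proof -
    have "closedin X (topspace X - V)" using V by blast
    moreover have "x \<in> topspace X - (topspace X - V)" using x openin_subset[OF V] by blast
    ultimately obtain f :: "'a \<Rightarrow> real" where f: "continuous_map X (top_of_set {0..1}) f" "f x = 0"
        "f ` (topspace X - V) \<subseteq> {1}"
      using cr unfolding completely_regular_space_def by blast
    then have "continuous_map X euclidean f" by (simp add: continuous_map_in_subtopology)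
    then obtain h where h: "pullback_topology (carrier G) h euclidean \<in> \<T>"
        "\<forall>x\<in>topspace X. h (e x) = f x"
      using real_T by blast
    let ?W = "h -` {..<1} \<inter> carrier G"
    have "openin (pullback_topology (carrier G) h euclidean) ?W"
      unfolding openin_pullback_topology by (rule exI[of _ "{..<1::real}"]) simp
    then have "openin S ?W" by (rule S_open[OF h(1)])
    moreover have "e x \<in> ?W" using h(2) f(2) x openin_subset[OF V] e by auto
    moreover have "e -` ?W \<inter> topspace X \<subseteq> V"
    proof
      fix y assume y: "y \<in> e -` ?W \<inter> topspace X"
      then have "f y < 1" using h(2) by auto
      with y f(3) show "y \<in> V" by force
    qed
    ultimately show ?thesis by blast
  qed
  have inj: "inj_on e (topspace X)"
  proof
    fix x y assume xy: "x \<in> topspace X" "y \<in> topspace X" "e x = e y"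
    show "x = y"
    proof (rule ccontr)
      assume "x \<noteq> y"
      then obtain V where "openin X V" "x \<in> V" "y \<notin> V"
        using haus xy unfolding Hausdorff_space_def disjnt_iff by metis
      then show False using sep[of V x] xy by auto
    qed
  qed
  have emb: "embedding_map X S e"
    unfolding embedding_map_def
  proof (rule bijective_open_imp_homeomorphic_map)
    show "continuous_map X (subtopology S (e ` topspace X)) e"
      using e_cont by (simp add: continuous_map_in_subtopology)
    show "e ` topspace X = topspace (subtopology S (e ` topspace X))"
      using e tsS by auto
    show "open_map X (subtopology S (e ` topspace X)) e"
      unfolding open_map_def
    proof (intro allI impI)
      fix V assume V: "openin X V"
      let ?W = "\<Union> {W. openin S W \<and> e -` W \<inter> topspace X \<subseteq> V}"
      have "openin S ?W" by (rule openin_Union) blast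
      moreover have "e ` V = ?W \<inter> e ` topspace X"
      proof
        show "e ` V \<subseteq> ?W \<inter> e ` topspace X"
        proof
          fix g assume "g \<in> e ` V"
          then obtain x where x: "x \<in> V" "g = e x" by blast
          then show "g \<in> ?W \<inter> e ` topspace X"
            using sep[OF V x(1)] openin_subset[OF V] by blast
        qed
        show "?W \<inter> e ` topspace X \<subseteq> e ` V" by blast
      qed
      ultimately show "openin (subtopology S (e ` topspace X)) (e ` V)"
        by (auto simp: openin_subtopology)
    qed
  qed (rule inj)
  have ex: "is_free_group_topology P G e X S"
    unfolding is_free_group_topology_def
  proof (intro conjI allI impI tgS emb)
    fix H :: "'g monoid" and U f
    assume *: "P H \<and> topological_group H U \<and> continuous_map X U f"
    then have P: "P H" and U: "topological_group H U" and f: "continuous_map X U f" by auto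
    have "f ` topspace X \<subseteq> carrier H"
      using U f by (auto simp: topological_group_def continuous_map_def)
    then obtain h where h: "h \<in> hom G H" "\<forall>x\<in>topspace X. h (e x) = f x"
      using hom_ex P by blast
    have "continuous_map X U (h \<circ> e)"
      by (rule continuous_map_eq[OF f]) (simp add: h)
    then have "continuous_map S (pullback_topology (carrier G) h U) id"
      using S_id in_T U h(1) by blast
    moreover have "continuous_map (pullback_topology (carrier G) h U) U h"
      using continuous_map_pullback[of U U id "carrier G" h] by simp
    ultimately have h_cont: "continuous_map S U h"
      using continuous_map_compose by fastforce
    let ?h = "restrict h (carrier G)"
    show "\<exists>!h. h \<in> extensional (carrier G) \<and> h \<in> hom G H \<and> continuous_map S U h \<and>
              (\<forall>x\<in>topspace X. h (e x) = f x)"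
    proof (rule ex1I[of _ ?h])
      have "?h \<in> hom G H"
        by (rule restrict_hom[OF G h(1)])
      moreover have "continuous_map S U ?h"
        by (rule continuous_map_eq[OF h_cont]) (simp add: tsS)
      moreover have "\<forall>x\<in>topspace X. ?h (e x) = f x"
        using h(2) e by auto
      ultimately show "?h \<in> extensional (carrier G) \<and> ?h \<in> hom G H \<and> continuous_map S U ?h \<and>
              (\<forall>x\<in>topspace X. ?h (e x) = f x)" by simp
    next
      fix k assume k: "k \<in> extensional (carrier G) \<and> k \<in> hom G H \<and> continuous_map S U k \<and>
              (\<forall>x\<in>topspace X. k (e x) = f x)"
      show "k = ?h"
      proof (rule extensionalityI[where A = "carrier G"])
        fix g assume "g \<in> carrier G"
        then show "k g = ?h g"
          using hom_uniq[OF P, of k h g] k h by simp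
      qed (use k in auto)
    qed
  qed
  have uniq: "\<forall>g\<in>carrier G. k g = g"
    if "k \<in> hom G G" "\<And>x. x \<in> topspace X \<Longrightarrow> k (e x) = e x" for k
    using hom_uniq[OF PG that(1), of "\<lambda>x. x"] that(2) by (auto simp: hom_def)
  show ?thesis
  proof (rule ex1I)
    show "is_free_group_topology P G e X S" by (rule ex)
  next
    fix T assume T: "is_free_group_topology P G e X T"
    then have e_contT: "continuous_map X T e" and tgT: "topological_group G T"
      by (auto simp: is_free_group_topology_def embedding_map_def continuous_map_in_subtopology
          dest!: homeomorphic_imp_continuous_map)
    have "continuous_map T S id"
      using topological_group_topology_eq[OF PG T tgS e_cont uniq] by blast
    moreover have "continuous_map S T id"
      using topological_group_topology_eq[OF PG ex tgT e_contT uniq] by blast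
    ultimately have "homeomorphic_map S T id"
      by (auto simp: homeomorphic_map_maps homeomorphic_maps_def)
    moreover have "topspace T = topspace S"
      using tgT tsS by (simp add: topological_group_def)
    ultimately show "T = S"
      by (simp add: homeomorphic_map_id)
  qed
qed


section \<open>Free topological groups and free abelian topological groups\<close>

definition free_topology :: "'a topology \<Rightarrow> 'a word topology" where
  "free_topology X =
     (THE T. is_free_group_topology group (free_group (topspace X)) free_gen X T)"

definition free_abelian_topology :: "'a topology \<Rightarrow> ('a \<Rightarrow>\<^sub>0 int) topology" where
  "free_abelian_topology X =
     (THE T. is_free_group_topology comm_group (free_Abelian_group (topspace X)) frag_of X T)"

definition frag_length :: "('a \<Rightarrow>\<^sub>0 int) \<Rightarrow> nat" where
  "frag_length c = (\<Sum>x\<in>Poly_Mapping.keys c. nat \<bar>Poly_Mapping.lookup c x\<bar>)"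

definition free_words :: "nat \<Rightarrow> 'a topology \<Rightarrow> 'a word topology" where
  "free_words n X =
     subtopology (free_topology X) {w \<in> carrier (free_group (topspace X)). length w \<le> n}"

definition free_abelian_words :: "nat \<Rightarrow> 'a topology \<Rightarrow> ('a \<Rightarrow>\<^sub>0 int) topology" where
  "free_abelian_words n X =
     subtopology (free_abelian_topology X)
       {c \<in> carrier (free_Abelian_group (topspace X)). frag_length c \<le> n}"

text \<open>
  The descriptions are proper over a Tychonoff space \<open>X\<close>: by \<open>is_free_group_topology_free_topology\<close>
  and \<open>is_free_group_topology_free_abelian_topology\<close> below, the two topologies exist and are unique.
\<close>

lemma comm_group_real_add: "comm_group \<lparr>carrier = UNIV :: real set, monoid.mult = (+), one = 0\<rparr>"
proof (rule comm_groupI)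
  fix x :: real
  show "\<exists>y\<in>carrier \<lparr>carrier = UNIV, monoid.mult = (+), one = 0\<rparr>.
      y \<otimes>\<^bsub>\<lparr>carrier = UNIV, monoid.mult = (+), one = 0\<rparr>\<^esub> x =
      \<one>\<^bsub>\<lparr>carrier = UNIV, monoid.mult = (+), one = 0\<rparr>\<^esub>"
    by (rule bexI[of _ "- x"]) simp_all
qed simp_all

lemma free_Abelian_group_hom_unique:
  assumes H: "group H" and h: "h \<in> hom (free_Abelian_group S) H"
    and k: "k \<in> hom (free_Abelian_group S) H"
    and eq: "\<And>x. x \<in> S \<Longrightarrow> h (frag_of x) = k (frag_of x)"
    and c: "c \<in> carrier (free_Abelian_group S)"
  shows "h c = k c"
proof -
  interpret h: group_hom "free_Abelian_group S" H h
    using H h by (simp add: group_hom_def group_hom_axioms_def)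
  interpret k: group_hom "free_Abelian_group S" H k
    using H k by (simp add: group_hom_def group_hom_axioms_def)
  have diff: "a - b = a \<otimes>\<^bsub>free_Abelian_group S\<^esub> inv\<^bsub>free_Abelian_group S\<^esub> b"
    if "b \<in> carrier (free_Abelian_group S)" for a b
    using that by simp
  have "c \<in> carrier (free_Abelian_group S) \<and> h c = k c"
  proof (rule free_Abelian_group_induct[of c S "\<lambda>c. c \<in> carrier (free_Abelian_group S) \<and> h c = k c"])
    show "Poly_Mapping.keys c \<subseteq> S" using c by simp
    show "0 \<in> carrier (free_Abelian_group S) \<and> h 0 = k 0"
      using h.hom_one k.hom_one by simp
    fix a b
    assume *: "a \<in> carrier (free_Abelian_group S) \<and> h a = k a"
      "b \<in> carrier (free_Abelian_group S) \<and> h b = k b"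
    then have "a - b \<in> carrier (free_Abelian_group S)"
      using diff[of b a] h.G.m_closed h.G.inv_closed by metis
    moreover have "h (a - b) = k (a - b)"
      using * diff[of b a] h.hom_mult[of a "inv\<^bsub>free_Abelian_group S\<^esub> b"]
        k.hom_mult[of a "inv\<^bsub>free_Abelian_group S\<^esub> b"] h.hom_inv[of b] k.hom_inv[of b]
        h.G.inv_closed[of b] by metis
    ultimately show "a - b \<in> carrier (free_Abelian_group S) \<and> h (a - b) = k (a - b)" by simp
  qed (use eq in simp)
  then show ?thesis by simp
qed

lemma is_free_group_topology_free_topology:
  fixes X :: "'a topology"
  assumes X: "completely_regular_space X" "Hausdorff_space X"
  shows "is_free_group_topology group (free_group (topspace X)) free_gen X (free_topology X)"
proof -
  have 1: "free_gen ` topspace X \<subseteq> carrier (free_group (topspace X))"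
    by (auto intro: free_gen_in_free_group)
  have 2: "\<exists>h\<in>hom (free_group (topspace X)) H. \<forall>x\<in>topspace X. h (free_gen x) = f x"
    if "group H" "f ` topspace X \<subseteq> carrier H" for H :: "'a word monoid" and f
    by (rule free_group_hom_exists) (use that in auto)
  have 3: "\<exists>h\<in>hom (free_group (topspace X)) \<lparr>carrier = UNIV, monoid.mult = (+), one = 0\<rparr>.
          \<forall>x\<in>topspace X. h (free_gen x) = f x" for f :: "'a \<Rightarrow> real"
    by (rule free_group_hom_exists[OF comm_group.axioms(2)[OF comm_group_real_add]]) simp
  have 4: "h g = k g"
    if "group H" "h \<in> hom (free_group (topspace X)) H" "k \<in> hom (free_group (topspace X)) H"
      "\<And>x. x \<in> topspace X \<Longrightarrow> h (free_gen x) = k (free_gen x)"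
      "g \<in> carrier (free_group (topspace X))"
    for H :: "'a word monoid" and h k g
    using that by (rule free_group_hom_unique)
  note ex1 = ex1_is_free_group_topology[where P = group and G = "free_group (topspace X)"
      and e = free_gen and X = X]
  have "\<exists>!T. is_free_group_topology group (free_group (topspace X)) free_gen X T"
    by (rule ex1) (fact X group_free_group 1 2 3 4 | assumption)+
  then show ?thesis
    unfolding free_topology_def
    by (rule theI'[where P = "is_free_group_topology group (free_group (topspace X)) free_gen X"])
qed

lemma is_free_group_topology_free_abelian_topology:
  fixes X :: "'a topology"
  assumes X: "completely_regular_space X" "Hausdorff_space X"
  shows "is_free_group_topology comm_group (free_Abelian_group (topspace X)) frag_of X
           (free_abelian_topology X)"
proof -
  have 1: "frag_of ` topspace X \<subseteq> carrier (free_Abelian_group (topspace X))"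
    by auto
  have 2: "\<exists>h\<in>hom (free_Abelian_group (topspace X)) H. \<forall>x\<in>topspace X. h (frag_of x) = f x"
    if "comm_group H" "f ` topspace X \<subseteq> carrier H" for H :: "('a \<Rightarrow>\<^sub>0 int) monoid" and f
    using comm_group.free_Abelian_group_universal[OF that] by metis
  have 3: "\<exists>h\<in>hom (free_Abelian_group (topspace X)) \<lparr>carrier = UNIV, monoid.mult = (+), one = 0\<rparr>.
          \<forall>x\<in>topspace X. h (frag_of x) = f x" for f :: "'a \<Rightarrow> real"
    using comm_group.free_Abelian_group_universal[OF comm_group_real_add, of f "topspace X"]
    by (metis partial_object.select_convs(1) subset_UNIV)
  have 4: "h g = k g"
    if "comm_group H" "h \<in> hom (free_Abelian_group (topspace X)) H"
      "k \<in> hom (free_Abelian_group (topspace X)) H"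
      "\<And>x. x \<in> topspace X \<Longrightarrow> h (frag_of x) = k (frag_of x)"
      "g \<in> carrier (free_Abelian_group (topspace X))"
    for H :: "('a \<Rightarrow>\<^sub>0 int) monoid" and h k g
    using comm_group.axioms(2)[OF that(1)] that(2-5) by (rule free_Abelian_group_hom_unique)
  note ex1 = ex1_is_free_group_topology[where P = comm_group
      and G = "free_Abelian_group (topspace X)" and e = frag_of and X = X]
  have "\<exists>!T. is_free_group_topology comm_group (free_Abelian_group (topspace X)) frag_of X T"
    by (rule ex1) (fact X abelian_free_Abelian_group comm_group.axioms(2) 1 2 3 4)+
  then show ?thesis
    unfolding free_abelian_topology_def
    by (rule theI'[where P = "is_free_group_topology comm_group (free_Abelian_group (topspace X)) frag_of X"])
qed

lemma free_topology_universal: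
  fixes H :: "'h monoid"
  assumes X: "completely_regular_space X" "Hausdorff_space X"
    and U: "topological_group H U" and f: "continuous_map X U f"
  shows "\<exists>!h. h \<in> extensional (carrier (free_group (topspace X))) \<and>
              h \<in> hom (free_group (topspace X)) H \<and> continuous_map (free_topology X) U h \<and>
              (\<forall>x\<in>topspace X. h (free_gen x) = f x)"
proof -
  let ?G = "free_group (topspace X)"
  have H: "group H" using U by (simp add: topological_group_def)
  have "f x \<in> carrier H" if "x \<in> topspace X" for x
    using U f that by (auto simp: topological_group_def continuous_map_def)
  then obtain h' where h': "h' \<in> hom ?G H" "\<forall>x\<in>topspace X. h' (free_gen x) = f x"
    using free_group_hom_exists[OF H, of "topspace X" f] by blast
  define h where "h = restrict h' (carrier ?G)"
  have h: "h \<in> hom ?G H" "\<forall>x\<in>topspace X. h (free_gen x) = f x"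
    using h' restrict_hom[OF group_free_group h'(1)] free_gen_in_free_group[of _ "topspace X"]
    by (simp_all add: h_def)
  have uniq: "\<forall>g\<in>carrier ?G. k g = g"
    if k: "k \<in> hom ?G ?G" "\<And>x. x \<in> topspace X \<Longrightarrow> k (free_gen x) = free_gen x" for k
  proof
    fix g assume g: "g \<in> carrier ?G"
    have id: "(\<lambda>g. g) \<in> hom ?G ?G" by (simp add: hom_def)
    show "k g = g" by (rule free_group_hom_unique[OF group_free_group k(1) id k(2) g])
  qed
  have cont: "continuous_map (free_topology X) U h"
    by (rule is_free_group_topology_universal[where P = group and e = free_gen,
          OF group_free_group is_free_group_topology_free_topology[OF X] uniq U f h(1)])
      (use h(2) in \<open>assumption | blast\<close>)+
  show ?thesis
  proof (rule ex1I)
    show "h \<in> extensional (carrier ?G) \<and> h \<in> hom ?G H \<and>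
      continuous_map (free_topology X) U h \<and> (\<forall>x\<in>topspace X. h (free_gen x) = f x)"
      using h cont by (simp add: h_def)
  next
    fix k assume k: "k \<in> extensional (carrier ?G) \<and> k \<in> hom ?G H \<and>
      continuous_map (free_topology X) U k \<and> (\<forall>x\<in>topspace X. k (free_gen x) = f x)"
    then have k1: "k \<in> hom ?G H" by blast
    have eq: "k (free_gen x) = h (free_gen x)" if "x \<in> topspace X" for x
      using k h(2) that by (metis (no_types))
    have "k g = h g" if "g \<in> carrier ?G" for g
      by (rule free_group_hom_unique[OF H k1 h(1) eq that])
    with k have "k \<in> extensional (carrier ?G)" "\<And>g. g \<in> carrier ?G \<Longrightarrow> k g = h g"
      by blast+
    moreover have "h \<in> extensional (carrier ?G)" by (simp add: h_def)
    ultimately show "k = h"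
      using extensionalityI by metis
  qed
qed

lemma free_abelian_topology_universal:
  fixes H :: "'h monoid"
  assumes X: "completely_regular_space X" "Hausdorff_space X"
    and cH: "comm_group H" and U: "topological_group H U" and f: "continuous_map X U f"
  shows "\<exists>!h. h \<in> extensional (carrier (free_Abelian_group (topspace X))) \<and>
              h \<in> hom (free_Abelian_group (topspace X)) H \<and>
              continuous_map (free_abelian_topology X) U h \<and>
              (\<forall>x\<in>topspace X. h (frag_of x) = f x)"
proof -
  let ?G = "free_Abelian_group (topspace X)"
  have H: "group H" using U by (simp add: topological_group_def)
  have "f ` topspace X \<subseteq> carrier H"
    using U f by (auto simp: topological_group_def continuous_map_def)
  then obtain h' where h': "h' \<in> hom ?G H" "\<forall>x\<in>topspace X. h' (frag_of x) = f x"
    using comm_group.free_Abelian_group_universal[OF cH, of f "topspace X"] by metis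
  define h where "h = restrict h' (carrier ?G)"
  have h: "h \<in> hom ?G H" "\<forall>x\<in>topspace X. h (frag_of x) = f x"
    using h' restrict_hom[OF group_free_Abelian_group h'(1)] by (simp_all add: h_def)
  have uniq: "\<forall>g\<in>carrier ?G. k g = g"
    if k: "k \<in> hom ?G ?G" "\<And>x. x \<in> topspace X \<Longrightarrow> k (frag_of x) = frag_of x" for k
  proof
    fix g assume g: "g \<in> carrier ?G"
    have id: "(\<lambda>g. g) \<in> hom ?G ?G" by (simp add: hom_def)
    show "k g = g" by (rule free_Abelian_group_hom_unique[OF group_free_Abelian_group k(1) id k(2) g])
  qed
  have cont: "continuous_map (free_abelian_topology X) U h"
    by (rule is_free_group_topology_universal[where P = comm_group and e = frag_of,
          OF abelian_free_Abelian_group is_free_group_topology_free_abelian_topology[OF X] uniq U f h(1)])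
      (use h(2) in \<open>assumption | blast\<close>)+
  show ?thesis
  proof (rule ex1I)
    show "h \<in> extensional (carrier ?G) \<and> h \<in> hom ?G H \<and>
      continuous_map (free_abelian_topology X) U h \<and> (\<forall>x\<in>topspace X. h (frag_of x) = f x)"
      using h cont by (simp add: h_def)
  next
    fix k assume k: "k \<in> extensional (carrier ?G) \<and> k \<in> hom ?G H \<and>
      continuous_map (free_abelian_topology X) U k \<and> (\<forall>x\<in>topspace X. k (frag_of x) = f x)"
    then have k1: "k \<in> hom ?G H" by blast
    have eq: "k (frag_of x) = h (frag_of x)" if "x \<in> topspace X" for x
      using k h(2) that by (metis (no_types))
    have "k g = h g" if "g \<in> carrier ?G" for g
      by (rule free_Abelian_group_hom_unique[OF H k1 h(1) eq that])
    with k have "k \<in> extensional (carrier ?G)" "\<And>g. g \<in> carrier ?G \<Longrightarrow> k g = h g"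
      by blast+
    moreover have "h \<in> extensional (carrier ?G)" by (simp add: h_def)
    ultimately show "k = h"
      using extensionalityI by metis
  qed
qed

end

theory Submission
  imports Defs
begin

text \<open>
  Fix a metric \<open>d\<close> on \<open>X\<close>.  For each \<open>\<epsilon> > 0\<close>, every element \<open>g\<close> of \<open>F(X)\<close> or \<open>A(X)\<close> has a
  neighbourhood all of whose elements \<open>h\<close> are identified with \<open>g\<close> by the endomorphism that is induced
  by some, not necessarily continuous, self-map \<open>s\<close> of \<open>X\<close> that moves points by less than \<open>\<epsilon>\<close>: this
  comes from Graev's invariant group topology, where \<open>s\<close> collapses the finitely many short pairs whose
  quotients have \<open>g\<^sup>-\<^sup>1h\<close> in their normal closure.  Hence, if
  \<open>g\<close> is in the closure of a set \<open>A\<close> of words of bounded length, there are words in \<open>A\<close> each of whose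
  letters is close to a letter of \<open>g\<close>, or close to another letter of the same word, or is cancelled
  against a copy of itself; and if all letters converge along a subsequence, so do the words.
  When the set of nonisolated points is compact, the metric can be chosen such that letters of the
  first two kinds always have convergent subsequences.  Letters of the third kind do not occur in
  \<open>A(X)\<close>, and words of length at most four contain them only in the form \<open>x y z\<^sup>-\<^sup>1 x\<^sup>-\<^sup>1\<close>; these are
  controlled by homomorphisms into a group of affine maps that dilate by arbitrary factors at the
  isolated letters \<open>x\<close>.

  For the converse directions, let \<open>y\<^sub>n \<rightarrow> p\<close>.  If \<open>x\<^sub>n\<close> is a sequence of nonisolated points without
  convergent subsequences and \<open>x\<^sub>n\<^sub>k \<rightarrow> x\<^sub>n\<close>, the words \<open>y\<^sub>n x\<^sub>n\<^sub>k x\<^sub>n\<^sup>-\<^sup>1\<close> accumulate at \<open>p\<close> without containing a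
  sequence that converges to \<open>p\<close>; if \<open>D\<^sub>n\<close> is a discrete sequence of isolated points, the same holds for
  \<open>y\<^sub>n D\<^sub>n y\<^sub>k p\<^sup>-\<^sup>1 D\<^sub>n\<^sup>-\<^sup>1\<close>.
\<close>

section \<open>Group topologies and free topological groups\<close>

text \<open>The free topology is given by a universal property only, and its neighbourhoods are
  never described. What is available is maximality: every group topology on the same group that
  makes the embedding of X continuous is coarser, so its neighbourhoods are neighbourhoods in the
  free topology. Points are kept apart by such auxiliary topologies; convergence is obtained only
  from continuity of the group operations, letter by letter.

  Since the free topology depends on the topology of X alone, the metric behind Graev's construction
  may be picked after the words that it has to exclude. But Graev's neighbourhoods are invariant
  under conjugation: \<open>x y z^-1 x^-1\<close> is as close to the identity as
  \<open>y z^-1\<close>, whatever \<open>x\<close> is. This obstacle separates lengths four and five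
  from length three, and it is overcome by a topology that is not invariant: in a group of affine
  maps, conjugation by \<open>x\<close> rescales the translation part. The scale has to be constant
  around each point, so it is free only at letters that keep a fixed distance from all other
  points.\<close>

lemma group_topology_of_neighbourhoods:
  fixes G :: "'g monoid" and V :: "nat \<Rightarrow> 'g set"
  assumes G: "group G" and V_sub: "\<And>k. V k \<subseteq> carrier G"
    and one: "\<And>k. \<one>\<^bsub>G\<^esub> \<in> V k"
    and mult: "\<And>k u v. u \<in> V (Suc k) \<Longrightarrow> v \<in> V (Suc k) \<Longrightarrow> u \<otimes>\<^bsub>G\<^esub> v \<in> V k"
    and inv: "\<And>k u. u \<in> V k \<Longrightarrow> inv\<^bsub>G\<^esub> u \<in> V k"
    and conj: "\<And>g k. g \<in> carrier G \<Longrightarrow> \<exists>k'. \<forall>u\<in>V k'. g \<otimes>\<^bsub>G\<^esub> u \<otimes>\<^bsub>G\<^esub> inv\<^bsub>G\<^esub> g \<in> V k"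
  obtains T where "topological_group G T"
    "\<And>U g. openin T U \<Longrightarrow> g \<in> U \<Longrightarrow> \<exists>k. \<forall>u\<in>V k. g \<otimes>\<^bsub>G\<^esub> u \<in> U"
    "\<And>g k. g \<in> carrier G \<Longrightarrow> \<exists>U. openin T U \<and> g \<in> U \<and> (\<forall>h\<in>U. \<exists>u\<in>V k. h = g \<otimes>\<^bsub>G\<^esub> u)"
proof -
  interpret group G by (rule G)
  define op where "op U \<longleftrightarrow> U \<subseteq> carrier G \<and> (\<forall>g\<in>U. \<exists>k. \<forall>u\<in>V k. g \<otimes>\<^bsub>G\<^esub> u \<in> U)" for U
  define T where "T = topology op"
  have Suc_sub: "V (Suc k) \<subseteq> V k" for k
    using mult[OF _ one, of _ k] V_sub[of "Suc k"] by fastforce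
  then have anti: "V l \<subseteq> V k" if "k \<le> l" for k l
    using lift_Suc_antimono_le[of V k l] that by blast
  have "istopology op"
    unfolding istopology_def
  proof (intro conjI allI impI)
    fix S S' assume S: "op S" "op S'"
    show "op (S \<inter> S')"
      unfolding op_def
    proof (intro conjI ballI)
      fix g assume g: "g \<in> S \<inter> S'"
      obtain k where k: "\<forall>u\<in>V k. g \<otimes>\<^bsub>G\<^esub> u \<in> S" using S(1) g unfolding op_def by blast
      obtain l where l: "\<forall>u\<in>V l. g \<otimes>\<^bsub>G\<^esub> u \<in> S'" using S(2) g unfolding op_def by blast
      have "\<forall>u\<in>V (max k l). g \<otimes>\<^bsub>G\<^esub> u \<in> S \<inter> S'"
        using k l anti[of k "max k l"] anti[of l "max k l"] by auto
      then show "\<exists>k. \<forall>u\<in>V k. g \<otimes>\<^bsub>G\<^esub> u \<in> S \<inter> S'" by blast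
    next
      show "S \<inter> S' \<subseteq> carrier G" using S(1) unfolding op_def by blast
    qed
  next
    fix K assume "\<forall>S\<in>K. op S"
    then have K: "S \<subseteq> carrier G" "g \<in> S \<Longrightarrow> \<exists>k. \<forall>u\<in>V k. g \<otimes>\<^bsub>G\<^esub> u \<in> S" if "S \<in> K" for S g
      using that unfolding op_def by blast+
    show "op (\<Union>K)"
      unfolding op_def
    proof (intro conjI ballI)
      fix g assume "g \<in> \<Union>K"
      then obtain S where S: "S \<in> K" "g \<in> S" by blast
      then show "\<exists>k. \<forall>u\<in>V k. g \<otimes>\<^bsub>G\<^esub> u \<in> \<Union>K" using K(2)[OF S] by blast
    qed (use K(1) in blast)
  qed
  then have openT: "openin T U \<longleftrightarrow> op U" for U
    by (simp add: T_def)
  have "op (carrier G)" using V_sub by (auto simp: op_def)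
  then have ts: "topspace T = carrier G"
    unfolding topspace_def openT by (auto simp: op_def)
  have nbhd: "\<exists>U. openin T U \<and> g \<in> U \<and> (\<forall>h\<in>U. \<exists>u\<in>V k. h = g \<otimes>\<^bsub>G\<^esub> u)"
    if g: "g \<in> carrier G" for g k
  proof -
    \<comment> \<open>The interior of \<open>g V_k\<close>: the points \<open>h\<close> for which
      some translate \<open>h V_j\<close> stays in \<open>g V_k\<close>. Halving by
      \<open>mult\<close> shows that it is open.\<close>
    define I where "I = {h \<in> carrier G. \<exists>j. \<forall>u\<in>V j. \<exists>v\<in>V k. h \<otimes>\<^bsub>G\<^esub> u = g \<otimes>\<^bsub>G\<^esub> v}"
    have "op I"
      unfolding op_def
    proof (intro conjI ballI)
      fix h assume h: "h \<in> I"
      then have hc: "h \<in> carrier G" by (simp add: I_def)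
      obtain j where j: "\<forall>u\<in>V j. \<exists>v\<in>V k. h \<otimes>\<^bsub>G\<^esub> u = g \<otimes>\<^bsub>G\<^esub> v" using h by (auto simp: I_def)
      have "\<forall>u\<in>V (Suc j). h \<otimes>\<^bsub>G\<^esub> u \<in> I"
      proof
        fix u assume u: "u \<in> V (Suc j)"
        have uc: "u \<in> carrier G" using u V_sub by blast
        have "\<exists>v\<in>V k. h \<otimes>\<^bsub>G\<^esub> u \<otimes>\<^bsub>G\<^esub> u' = g \<otimes>\<^bsub>G\<^esub> v" if u': "u' \<in> V (Suc j)" for u'
        proof -
          have "u' \<in> carrier G" using u' V_sub by blast
          then show ?thesis using bspec[OF j mult[OF u u']] hc uc by (simp add: m_assoc)
        qed
        then show "h \<otimes>\<^bsub>G\<^esub> u \<in> I" using uc hc by (auto simp: I_def)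
      qed
      then show "\<exists>k. \<forall>u\<in>V k. h \<otimes>\<^bsub>G\<^esub> u \<in> I" by blast
    qed (auto simp: I_def)
    moreover have "g \<in> I" using g by (auto simp: I_def)
    moreover have "\<exists>u\<in>V k. h = g \<otimes>\<^bsub>G\<^esub> u" if h: "h \<in> I" for h
    proof -
      have hc: "h \<in> carrier G" using h by (simp add: I_def)
      obtain j where j: "\<forall>u\<in>V j. \<exists>v\<in>V k. h \<otimes>\<^bsub>G\<^esub> u = g \<otimes>\<^bsub>G\<^esub> v" using h by (auto simp: I_def)
      show ?thesis using bspec[OF j one] hc by simp
    qed
    ultimately show ?thesis unfolding openT by blast
  qed
  have m: "continuous_map (prod_topology T T) T (\<lambda>(x, y). x \<otimes>\<^bsub>G\<^esub> y)"
    unfolding continuous_map_def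
  proof (intro conjI allI impI)
    show "(\<lambda>(x, y). x \<otimes>\<^bsub>G\<^esub> y) \<in> topspace (prod_topology T T) \<rightarrow> topspace T"
      by (auto simp: ts)
    fix U assume U: "openin T U"
    show "openin (prod_topology T T) {z \<in> topspace (prod_topology T T). (case z of (x, y) \<Rightarrow> x \<otimes>\<^bsub>G\<^esub> y) \<in> U}"
      unfolding openin_prod_topology_alt
    proof (intro allI impI)
      fix g h assume "(g, h) \<in> {z \<in> topspace (prod_topology T T). (case z of (x, y) \<Rightarrow> x \<otimes>\<^bsub>G\<^esub> y) \<in> U}"
      then have gh: "g \<in> carrier G" "h \<in> carrier G" "g \<otimes>\<^bsub>G\<^esub> h \<in> U" by (auto simp: ts)
      obtain k where k: "\<forall>u\<in>V k. g \<otimes>\<^bsub>G\<^esub> h \<otimes>\<^bsub>G\<^esub> u \<in> U"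
        using U gh(3) unfolding openT op_def by blast
      obtain k' where k': "\<forall>u\<in>V k'. inv\<^bsub>G\<^esub> h \<otimes>\<^bsub>G\<^esub> u \<otimes>\<^bsub>G\<^esub> inv\<^bsub>G\<^esub> (inv\<^bsub>G\<^esub> h) \<in> V (Suc k)"
        using conj[of "inv\<^bsub>G\<^esub> h" "Suc k"] gh by auto
      obtain A where A: "openin T A" "g \<in> A" "\<forall>a\<in>A. \<exists>u\<in>V k'. a = g \<otimes>\<^bsub>G\<^esub> u"
        using nbhd[OF gh(1)] by blast
      obtain B where B: "openin T B" "h \<in> B" "\<forall>b\<in>B. \<exists>u\<in>V (Suc k). b = h \<otimes>\<^bsub>G\<^esub> u"
        using nbhd[OF gh(2)] by blast
      have "a \<otimes>\<^bsub>G\<^esub> b \<in> U" if ab: "a \<in> A" "b \<in> B" for a b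
      proof -
        obtain u v where u: "u \<in> V k'" "a = g \<otimes>\<^bsub>G\<^esub> u" and v: "v \<in> V (Suc k)" "b = h \<otimes>\<^bsub>G\<^esub> v"
          using A(3) B(3) ab by blast
        have uv: "u \<in> carrier G" "v \<in> carrier G" using u v V_sub by auto
        \<comment> \<open>\<open>g u h v = g h (h^-1 u h) v\<close>, and \<open>k'\<close> was
          chosen to put the conjugate into \<open>V (Suc k)\<close>, one halving away from
          \<open>V k\<close>.\<close>
        let ?w = "(inv\<^bsub>G\<^esub> h \<otimes>\<^bsub>G\<^esub> u \<otimes>\<^bsub>G\<^esub> inv\<^bsub>G\<^esub> (inv\<^bsub>G\<^esub> h)) \<otimes>\<^bsub>G\<^esub> v"
        have "?w \<in> V k" using mult k' u v by blast
        moreover have "a \<otimes>\<^bsub>G\<^esub> b = g \<otimes>\<^bsub>G\<^esub> h \<otimes>\<^bsub>G\<^esub> ?w"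
        proof -
          have "g \<otimes>\<^bsub>G\<^esub> h \<otimes>\<^bsub>G\<^esub> ?w = g \<otimes>\<^bsub>G\<^esub> (h \<otimes>\<^bsub>G\<^esub> inv\<^bsub>G\<^esub> h) \<otimes>\<^bsub>G\<^esub> u \<otimes>\<^bsub>G\<^esub> (h \<otimes>\<^bsub>G\<^esub> v)"
            using gh uv by (simp only: m_assoc m_closed inv_closed inv_inv)
          then show ?thesis using gh uv u v by simp
        qed
        ultimately show ?thesis using k by simp
      qed
      then have "A \<times> B \<subseteq> {z \<in> topspace (prod_topology T T). (case z of (x, y) \<Rightarrow> x \<otimes>\<^bsub>G\<^esub> y) \<in> U}"
        using openin_subset[OF A(1)] openin_subset[OF B(1)] by auto
      then show "\<exists>A B. openin T A \<and> openin T B \<and> g \<in> A \<and> h \<in> B \<and>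
           A \<times> B \<subseteq> {z \<in> topspace (prod_topology T T). (case z of (x, y) \<Rightarrow> x \<otimes>\<^bsub>G\<^esub> y) \<in> U}"
        using A B by blast
    qed
  qed
  have i: "continuous_map T T (\<lambda>x. inv\<^bsub>G\<^esub> x)"
    unfolding continuous_map_def
  proof (intro conjI allI impI)
    show "(\<lambda>x. inv\<^bsub>G\<^esub> x) \<in> topspace T \<rightarrow> topspace T" by (auto simp: ts)
    fix U assume U: "openin T U"
    have "\<exists>k. \<forall>u\<in>V k. inv\<^bsub>G\<^esub> (g \<otimes>\<^bsub>G\<^esub> u) \<in> U" if g: "g \<in> carrier G" "inv\<^bsub>G\<^esub> g \<in> U" for g
    proof -
      obtain k where k: "\<forall>u\<in>V k. inv\<^bsub>G\<^esub> g \<otimes>\<^bsub>G\<^esub> u \<in> U"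
        using U g unfolding openT op_def by blast
      obtain k' where k': "\<forall>u\<in>V k'. g \<otimes>\<^bsub>G\<^esub> u \<otimes>\<^bsub>G\<^esub> inv\<^bsub>G\<^esub> g \<in> V k"
        using conj[OF g(1)] by blast
      have "inv\<^bsub>G\<^esub> (g \<otimes>\<^bsub>G\<^esub> u) \<in> U" if u: "u \<in> V k'" for u
      proof -
        have uc: "u \<in> carrier G" using u V_sub by auto
        have "inv\<^bsub>G\<^esub> (g \<otimes>\<^bsub>G\<^esub> u) = inv\<^bsub>G\<^esub> g \<otimes>\<^bsub>G\<^esub> (g \<otimes>\<^bsub>G\<^esub> inv\<^bsub>G\<^esub> u \<otimes>\<^bsub>G\<^esub> inv\<^bsub>G\<^esub> g)"
          using g uc by (simp add: inv_mult_group m_assoc[symmetric])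
        then show ?thesis using k k' inv[OF u] by simp
      qed
      then show ?thesis by blast
    qed
    then have "\<exists>k. \<forall>u\<in>V k. g \<otimes>\<^bsub>G\<^esub> u \<in> {x \<in> carrier G. inv\<^bsub>G\<^esub> x \<in> U}"
      if "g \<in> {x \<in> carrier G. inv\<^bsub>G\<^esub> x \<in> U}" for g
      using that V_sub by (auto simp: subset_iff)
    then show "openin T {x \<in> topspace T. inv\<^bsub>G\<^esub> x \<in> U}"
      by (simp add: openT op_def ts)
  qed
  show thesis
  proof (rule that)
    show "topological_group G T" using G ts m i by (simp add: topological_group_def)
    show "\<exists>k. \<forall>u\<in>V k. g \<otimes>\<^bsub>G\<^esub> u \<in> U" if "openin T U" "g \<in> U" for U g
      using that unfolding openT op_def by blast
  qed (rule nbhd)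
qed

text \<open>Words need not be reduced here, so a map of letters turns words into words whatever
  cancellation it causes.\<close>

primrec letters_prod :: "('g, 'm) monoid_scheme \<Rightarrow> ('a \<Rightarrow> 'g) \<Rightarrow> 'a word \<Rightarrow> 'g" where
  "letters_prod G e [] = \<one>\<^bsub>G\<^esub>"
| "letters_prod G e (a # w) = (if snd a then e (fst a) else inv\<^bsub>G\<^esub> (e (fst a))) \<otimes>\<^bsub>G\<^esub> letters_prod G e w"

abbreviation letters :: "'a word \<Rightarrow> 'a set" where
  "letters w \<equiv> fst ` set w"

lemma letters_prod_closed:
  assumes "group G" "e ` letters w \<subseteq> carrier G"
  shows "letters_prod G e w \<in> carrier G"
  using assms by (induction w) (auto simp: group.is_monoid intro!: monoid.m_closed group.inv_closed)

lemma hom_letters_prod: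
  assumes G: "group G" and H: "group H" and h: "h \<in> hom G H" and e: "e ` letters w \<subseteq> carrier G"
  shows "h (letters_prod G e w) = letters_prod H (h \<circ> e) w"
proof -
  interpret group_hom G H h using G H h by (simp add: group_hom_def group_hom_axioms_def)
  show ?thesis
    using e
  proof (induction w)
    case (Cons a w)
    then show ?case using letters_prod_closed[OF G, of e w] by auto
  qed auto
qed

lemma letters_prod_cong:
  "(\<And>x. x \<in> letters w \<Longrightarrow> e x = e' x) \<Longrightarrow> letters_prod G e w = letters_prod G e' w"
  by (induction w) auto

lemma letters_prod_comp: "letters_prod G (e \<circ> s) w = letters_prod G e (map (apfst s) w)"
  by (induction w) auto

text \<open>Common ground of F(X) and A(X), so that most arguments are given once for both.
  \<open>induced_ex\<close> admits discontinuous \<open>s\<close>, since maps that merge letters are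
  discontinuous in general; \<open>abelianization_ex\<close> makes exponent sums available in both
  groups.\<close>

locale free_topological_group =
  fixes P :: "'g monoid \<Rightarrow> bool" and G :: "'g monoid" (structure) and e :: "'a \<Rightarrow> 'g"
    and X :: "'a topology" and T :: "'g topology"
  assumes P: "P G" and free: "is_free_group_topology P G e X T"
    and generated: "\<And>g. g \<in> carrier G \<Longrightarrow> \<exists>w. letters w \<subseteq> topspace X \<and> g = letters_prod G e w"
    and induced_ex: "\<And>s. s \<in> topspace X \<rightarrow> topspace X \<Longrightarrow> \<exists>h\<in>hom G G. \<forall>x\<in>topspace X. h (e x) = e (s x)"
    and abelianization_ex: "\<exists>h\<in>hom G (free_Abelian_group (topspace X)). \<forall>x\<in>topspace X. h (e x) = frag_of x"
begin

abbreviation "M \<equiv> topspace X"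

abbreviation "val \<equiv> letters_prod G e"

definition induced :: "('a \<Rightarrow> 'a) \<Rightarrow> 'g \<Rightarrow> 'g" where
  "induced s = (SOME h. h \<in> hom G G \<and> (\<forall>x\<in>M. h (e x) = e (s x)))"

definition ab :: "'g \<Rightarrow> ('a \<Rightarrow>\<^sub>0 int)" where
  "ab = (SOME h. h \<in> hom G (free_Abelian_group M) \<and> (\<forall>x\<in>M. h (e x) = frag_of x))"

lemma topological_group: "topological_group G T"
  using free by (simp add: is_free_group_topology_def)

lemma topspace_T: "topspace T = carrier G"
  using topological_group by (simp add: topological_group_def)

sublocale group G
  using topological_group by (simp add: topological_group_def)

lemma continuous_e: "continuous_map X T e"
  using free by (auto simp: is_free_group_topology_def embedding_map_def continuous_map_in_subtopology
      dest!: homeomorphic_imp_continuous_map)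

lemma e_closed: "x \<in> M \<Longrightarrow> e x \<in> carrier G"
  using continuous_e topspace_T by (auto simp: continuous_map_def)

lemma val_closed: "letters w \<subseteq> M \<Longrightarrow> val w \<in> carrier G"
  using e_closed by (intro letters_prod_closed is_group) auto

lemma induced:
  assumes "s \<in> M \<rightarrow> M"
  shows induced_hom: "induced s \<in> hom G G" and induced_e: "x \<in> M \<Longrightarrow> induced s (e x) = e (s x)"
  using someI_ex[of "\<lambda>h. h \<in> hom G G \<and> (\<forall>x\<in>M. h (e x) = e (s x))"] induced_ex[OF assms]
  unfolding induced_def by blast+

lemma ab_hom: "ab \<in> hom G (free_Abelian_group M)" and ab_e: "x \<in> M \<Longrightarrow> ab (e x) = frag_of x"
  using someI_ex[of "\<lambda>h. h \<in> hom G (free_Abelian_group M) \<and> (\<forall>x\<in>M. h (e x) = frag_of x)"]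
    abelianization_ex unfolding ab_def by blast+

lemma induced_val:
  assumes "s \<in> M \<rightarrow> M" "letters w \<subseteq> M"
  shows "induced s (val w) = val (map (apfst s) w)"
proof -
  have "induced s (val w) = letters_prod G (induced s \<circ> e) w"
    using assms e_closed by (intro hom_letters_prod is_group induced_hom) auto
  also have "\<dots> = letters_prod G (e \<circ> s) w"
    using assms induced_e by (intro letters_prod_cong) auto
  finally show ?thesis by (simp add: letters_prod_comp)
qed

lemma hom_eqI:
  assumes "group H" "h \<in> hom G H" "k \<in> hom G H" "\<And>x. x \<in> M \<Longrightarrow> h (e x) = k (e x)" "g \<in> carrier G"
  shows "h g = k g"
proof -
  obtain w where w: "letters w \<subseteq> M" "g = val w" using generated assms(5) by blast
  have "letters_prod H (h \<circ> e) w = letters_prod H (k \<circ> e) w"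
    using w assms by (intro letters_prod_cong) auto
  moreover have "e ` letters w \<subseteq> carrier G" using w e_closed by auto
  ultimately show ?thesis
    using w assms hom_letters_prod[OF is_group] by metis
qed

text \<open>The topology \<open>T'\<close> generated by the sets \<open>V k\<close> is a group
  topology with \<open>e\<close> continuous, hence coarser than the free one. All explicit
  neighbourhoods in \<open>T\<close> originate here.\<close>

lemma neighbourhood:
  fixes V :: "nat \<Rightarrow> 'g set"
  assumes "\<And>k. V k \<subseteq> carrier G" "\<And>k. \<one> \<in> V k"
    and "\<And>k u v. u \<in> V (Suc k) \<Longrightarrow> v \<in> V (Suc k) \<Longrightarrow> u \<otimes> v \<in> V k"
    and "\<And>k u. u \<in> V k \<Longrightarrow> inv u \<in> V k"
    and "\<And>g k. g \<in> carrier G \<Longrightarrow> \<exists>k'. \<forall>u\<in>V k'. g \<otimes> u \<otimes> inv g \<in> V k"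
    and cont: "\<And>x k. x \<in> M \<Longrightarrow> \<exists>U. openin X U \<and> x \<in> U \<and> (\<forall>y\<in>U. inv (e x) \<otimes> e y \<in> V k)"
    and g: "g \<in> carrier G"
  shows "\<exists>U. openin T U \<and> g \<in> U \<and> (\<forall>h\<in>U. \<exists>u\<in>V k. h = g \<otimes> u)"
proof -
  obtain T' where tg: "topological_group G T'"
    and T'1: "\<And>U g. openin T' U \<Longrightarrow> g \<in> U \<Longrightarrow> \<exists>k. \<forall>u\<in>V k. g \<otimes> u \<in> U"
    and T'3: "\<And>g k. g \<in> carrier G \<Longrightarrow> \<exists>U. openin T' U \<and> g \<in> U \<and> (\<forall>h\<in>U. \<exists>u\<in>V k. h = g \<otimes> u)"
    using group_topology_of_neighbourhoods[OF is_group assms(1-5)] by metis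
  have ts': "topspace T' = carrier G" using tg by (simp add: topological_group_def)
  have "continuous_map X T' e"
    unfolding continuous_map_def
  proof (intro conjI allI impI)
    show "e \<in> M \<rightarrow> topspace T'" using e_closed by (simp add: ts')
    fix U assume U: "openin T' U"
    show "openin X {x \<in> M. e x \<in> U}"
    proof (subst openin_subopen, intro ballI)
      fix x assume x: "x \<in> {x \<in> M. e x \<in> U}"
      then obtain k where k: "\<forall>u\<in>V k. e x \<otimes> u \<in> U" using T'1[OF U] by blast
      obtain W where W: "openin X W" "x \<in> W" "\<forall>y\<in>W. inv (e x) \<otimes> e y \<in> V k"
        using cont x by blast
      have "e y \<in> U" if "y \<in> W" for y
      proof -
        have "y \<in> M" using W that openin_subset by blast
        then have "e x \<otimes> (inv (e x) \<otimes> e y) = e y"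
          using x e_closed by (simp add: m_assoc[symmetric])
        then show ?thesis using k W that by metis
      qed
      then show "\<exists>W. openin X W \<and> x \<in> W \<and> W \<subseteq> {x \<in> M. e x \<in> U}"
        using W openin_subset by blast
    qed
  qed
  then have "continuous_map T T' id"
    by (rule topological_group_topology_eq[OF P free tg])
      (use hom_eqI[OF is_group, of _ id] in \<open>auto simp: hom_def\<close>)
  moreover obtain U where U: "openin T' U" "g \<in> U" "\<forall>h\<in>U. \<exists>u\<in>V k. h = g \<otimes> u"
    using T'3[OF g] by blast
  ultimately have "openin T {x \<in> topspace T. id x \<in> U}"
    unfolding continuous_map_def by blast
  then show ?thesis using U g topspace_T by (intro exI[of _ "{x \<in> topspace T. id x \<in> U}"]) auto
qed

end

section \<open>Metrics\<close>

lemma mtopology_eqI: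
  assumes "Metric_space M d" "Metric_space M \<rho>"
    and 1: "\<And>x \<epsilon>. x \<in> M \<Longrightarrow> \<epsilon> > 0 \<Longrightarrow> \<exists>\<delta>>0. \<forall>y\<in>M. d x y < \<delta> \<longrightarrow> \<rho> x y < \<epsilon>"
    and 2: "\<And>x \<epsilon>. x \<in> M \<Longrightarrow> \<epsilon> > 0 \<Longrightarrow> \<exists>\<delta>>0. \<forall>y\<in>M. \<rho> x y < \<delta> \<longrightarrow> d x y < \<epsilon>"
  shows "Metric_space.mtopology M \<rho> = Metric_space.mtopology M d"
proof -
  interpret d: Metric_space M d by fact
  interpret \<rho>: Metric_space M \<rho> by fact
  have "openin \<rho>.mtopology U \<longleftrightarrow> openin d.mtopology U" for U
  proof
    assume U: "openin \<rho>.mtopology U"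
    have "\<exists>r>0. d.mball x r \<subseteq> U" if x: "x \<in> U" for x
    proof -
      obtain \<epsilon> where \<epsilon>: "\<epsilon> > 0" "\<rho>.mball x \<epsilon> \<subseteq> U" using U x unfolding \<rho>.openin_mtopology by blast
      have xM: "x \<in> M" using U x unfolding \<rho>.openin_mtopology by blast
      obtain \<delta> where "\<delta> > 0" "\<forall>y\<in>M. d x y < \<delta> \<longrightarrow> \<rho> x y < \<epsilon>" using 1[OF xM \<epsilon>(1)] by blast
      then show ?thesis using \<epsilon>(2) by (intro exI[of _ \<delta>]) auto
    qed
    then show "openin d.mtopology U" using U unfolding d.openin_mtopology \<rho>.openin_mtopology by blast
  next
    assume U: "openin d.mtopology U"
    have "\<exists>r>0. \<rho>.mball x r \<subseteq> U" if x: "x \<in> U" for x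
    proof -
      obtain \<epsilon> where \<epsilon>: "\<epsilon> > 0" "d.mball x \<epsilon> \<subseteq> U" using U x unfolding d.openin_mtopology by blast
      have xM: "x \<in> M" using U x unfolding d.openin_mtopology by blast
      obtain \<delta> where "\<delta> > 0" "\<forall>y\<in>M. \<rho> x y < \<delta> \<longrightarrow> d x y < \<epsilon>" using 2[OF xM \<epsilon>(1)] by blast
      then show ?thesis using \<epsilon>(2) by (intro exI[of _ \<delta>]) auto
    qed
    then show "openin \<rho>.mtopology U" using U unfolding d.openin_mtopology \<rho>.openin_mtopology by blast
  qed
  then show ?thesis by (simp add: topology_eq)
qed

text \<open>The extra 1 gives the infimum a meaning when \<open>S\<close> is empty, which may happen
  in both uses below, and caps it.\<close>

lemma Inf_insert_one_props:
  fixes S :: "real set"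
  assumes "S \<subseteq> {0..}"
  shows "0 \<le> Inf (insert 1 S)" "Inf (insert 1 S) \<le> 1" "a \<in> S \<Longrightarrow> Inf (insert 1 S) \<le> a"
    "Inf (insert 1 S) < c \<Longrightarrow> c \<le> 1 \<Longrightarrow> \<exists>a\<in>S. a < c"
    "b \<le> 1 \<Longrightarrow> (\<And>a. a \<in> S \<Longrightarrow> b \<le> a) \<Longrightarrow> b \<le> Inf (insert 1 S)"
proof -
  have bdd: "bdd_below (insert 1 S)" using assms by (intro bdd_belowI[of _ 0]) auto
  show "0 \<le> Inf (insert 1 S)" using assms by (intro cInf_greatest) auto
  show "Inf (insert 1 S) \<le> 1" using bdd by (intro cInf_lower) auto
  show "Inf (insert 1 S) \<le> a" if "a \<in> S" using that bdd by (intro cInf_lower) auto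
  show "\<exists>a\<in>S. a < c" if "Inf (insert 1 S) < c" "c \<le> 1"
    using cInf_lessD[OF _ that(1)] that(2) by force
  show "b \<le> Inf (insert 1 S)" if "b \<le> 1" "\<And>a. a \<in> S \<Longrightarrow> b \<le> a"
    using that by (intro cInf_greatest) auto
qed

text \<open>This is the triangle inequality of \<open>min (u x) (u y) * d x y + |u x - u y|\<close>
  for a metric \<open>d\<close> capped at 1. If the middle weight \<open>b\<close> is below the
  other two, the products lose at most \<open>min a c - b\<close>, because
  \<open>\<gamma> \<le> 1\<close>, while \<open>|a - b| + |b - c|\<close> exceeds
  \<open>|a - c|\<close> by twice that amount.\<close>

lemma weighted_triangle:
  fixes a b c \<alpha> \<beta> \<gamma> :: real
  assumes "0 \<le> a" "0 \<le> b" "0 \<le> c" "0 \<le> \<alpha>" "0 \<le> \<beta>" "0 \<le> \<gamma>" "\<gamma> \<le> \<alpha> + \<beta>" "\<gamma> \<le> 1"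
  shows "min a c * \<gamma> + \<bar>a - c\<bar> \<le> (min a b * \<alpha> + \<bar>a - b\<bar>) + (min b c * \<beta> + \<bar>b - c\<bar>)"
proof (cases "min a c \<le> b")
  case True
  have "min a c * \<gamma> \<le> min a c * \<alpha> + min a c * \<beta>"
    using mult_left_mono[OF assms(7), of "min a c"] assms by (simp add: algebra_simps)
  also have "\<dots> \<le> min a b * \<alpha> + min b c * \<beta>"
    using True assms by (intro add_mono mult_right_mono) auto
  finally show ?thesis by linarith
next
  case False
  then have b: "min a b = b" "min b c = b" by auto
  have "(min a c - b) * \<gamma> \<le> (min a c - b) * 1"
    using assms False by (intro mult_left_mono) auto
  moreover have "b * \<gamma> \<le> b * \<alpha> + b * \<beta>"
    using mult_left_mono[OF assms(7), of b] assms by (simp add: algebra_simps)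
  ultimately have "min a c * \<gamma> \<le> b * \<alpha> + b * \<beta> + (min a c - b)"
    unfolding left_diff_distrib by linarith
  then show ?thesis using False b by (auto simp: abs_if min_def split: if_splits)
qed

text \<open>The hypothesis says that no point is approached by both members of pairs from
  \<open>P\<close>. In the new metric, maps that move points by less than 1/2 merge no pair of
  \<open>P\<close>; words that could collapse only by such a merging are thereby excluded from a
  neighbourhood.\<close>

lemma metric_separating_pairs:
  fixes X :: "'a topology"
  assumes X: "metrizable_space X" and PM: "P \<subseteq> topspace X \<times> topspace X"
    and P: "\<And>p. p \<in> topspace X \<Longrightarrow> \<exists>U. openin X U \<and> p \<in> U \<and> P \<inter> U \<times> U = {}"
  obtains \<rho> where "Metric_space (topspace X) \<rho>" "Metric_space.mtopology (topspace X) \<rho> = X"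
    "\<And>a b. (a, b) \<in> P \<Longrightarrow> 1 \<le> \<rho> a b"
proof -
  obtain M d0 where d0: "Metric_space M d0" "X = Metric_space.mtopology M d0"
    using X unfolding metrizable_space_def by blast
  interpret d0: Metric_space M d0 by fact
  define d where "d = d0.capped_dist 1"
  interpret d: Metric_space M d unfolding d_def by (rule d0.capped_dist)
  have Xd: "X = d.mtopology" using d0(2) d0.mtopology_capped_metric unfolding d_def by simp
  have M: "topspace X = M" by (simp add: Xd)
  have d_le: "d x y \<le> 1" for x y by (simp add: d_def d0.capped_dist_def)
  \<comment> \<open>The radius that a closed ball around \<open>x\<close> needs in order to contain
    both members of the pair.\<close>
  define S where "S x = (\<lambda>(a, b). max (d x a) (d x b)) ` P" for x
  define r where "r x = Inf (insert 1 (S x))" for x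
  have "S x \<subseteq> {0..}" for x by (auto simp: S_def le_max_iff_disj)
  note r_props = Inf_insert_one_props[OF this, folded r_def]
  have r_pos: "r x > 0" if x: "x \<in> M" for x
  proof -
    obtain U where U: "openin X U" "x \<in> U" "P \<inter> U \<times> U = {}" using P x M by blast
    then obtain \<epsilon> where \<epsilon>: "\<epsilon> > 0" "d.mball x \<epsilon> \<subseteq> U" unfolding Xd d.openin_mtopology by blast
    have "min 1 \<epsilon> \<le> r x"
    proof (rule r_props(5))
      fix s assume "s \<in> S x"
      then obtain a b where ab: "(a, b) \<in> P" "s = max (d x a) (d x b)" by (auto simp: S_def)
      then have "a \<in> M" "b \<in> M" "a \<notin> U \<or> b \<notin> U" using PM M U(3) by auto
      then have "\<epsilon> \<le> d x a \<or> \<epsilon> \<le> d x b" using \<epsilon>(2) x by (auto simp: subset_iff not_less)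
      then show "min 1 \<epsilon> \<le> s" using ab by auto
    qed simp
    then show ?thesis using \<epsilon>(1) by linarith
  qed
  have r_lip: "r x \<le> r y + d x y" if xy: "x \<in> M" "y \<in> M" for x y
  proof -
    have "r x - d x y \<le> r y"
    proof (rule r_props(5))
      show "r x - d x y \<le> 1" using r_props(2)[of x] d.nonneg[of x y] by linarith
      fix s assume "s \<in> S y"
      then obtain a b where ab: "(a, b) \<in> P" "s = max (d y a) (d y b)" by (auto simp: S_def)
      then have abM: "a \<in> M" "b \<in> M" using PM M by auto
      have "r x \<le> max (d x a) (d x b)" using ab(1) by (intro r_props(3)) (auto simp: S_def)
      moreover have "d x a \<le> d x y + d y a" "d x b \<le> d x y + d y b"
        using d.triangle xy abM by auto
      ultimately show "r x - d x y \<le> s" using ab(2) by linarith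
    qed
    then show ?thesis by linarith
  qed
  txt \<open>Here \<open>r x\<close> bounds from below the distance between the members of a pair in \<open>P\<close> that contains
    \<open>x\<close>; the new metric is essentially \<open>d / r\<close>.\<close>
  define u where "u x = 1 / r x" for x
  have u0: "u x \<ge> 0" for x using r_props(1)[of x] by (simp add: u_def)
  have u1: "u x \<ge> 1" if "x \<in> M" for x using r_props(2)[of x] r_pos[OF that] by (simp add: u_def)
  define \<rho> where "\<rho> x y = min (u x) (u y) * d x y + \<bar>u x - u y\<bar>" for x y
  have \<rho>_ge: "d x y \<le> \<rho> x y" if "x \<in> M" "y \<in> M" for x y
  proof -
    have "1 * d x y \<le> min (u x) (u y) * d x y"
      using u1 that by (intro mult_right_mono) auto
    then show ?thesis by (simp add: \<rho>_def)
  qed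
  have \<rho>: "Metric_space M \<rho>"
  proof
    show "0 \<le> \<rho> x y" for x y using u0[of x] u0[of y] by (simp add: \<rho>_def)
    show "\<rho> x y = \<rho> y x" for x y by (simp add: \<rho>_def d.commute min.commute abs_minus_commute)
    show "\<rho> x y = 0 \<longleftrightarrow> x = y" if "x \<in> M" "y \<in> M" for x y
    proof (cases "x = y")
      case True
      then show ?thesis using that by (simp add: \<rho>_def)
    next
      case False
      then have "0 < d x y" using that by simp
      then show ?thesis using \<rho>_ge[OF that] False by linarith
    qed
    show "\<rho> x z \<le> \<rho> x y + \<rho> y z" if "x \<in> M" "y \<in> M" "z \<in> M" for x y z
      unfolding \<rho>_def using d.triangle[OF that] by (intro weighted_triangle u0 d.nonneg d_le)
  qed
  have "Metric_space.mtopology M \<rho> = d.mtopology"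
  proof (rule mtopology_eqI[OF d.Metric_space_axioms \<rho>])
    fix x and \<epsilon> :: real assume x: "x \<in> M" and \<epsilon>: "\<epsilon> > 0"
    show "\<exists>\<delta>>0. \<forall>y\<in>M. \<rho> x y < \<delta> \<longrightarrow> d x y < \<epsilon>"
      using \<epsilon> \<rho>_ge[OF x] by (intro exI[of _ \<epsilon>]) (auto intro: le_less_trans)
    \<comment> \<open>A Lipschitz constant of \<open>\<rho>\<close> at \<open>x\<close>:
      \<open>u x\<close> bounds the weight of the first summand, and
      \<open>|1 / r x - 1 / r y|\<close> is at most \<open>d x y * 2 / (r x)^2\<close> as soon as
      \<open>r y\<close> is at least \<open>r x / 2\<close>.\<close>
    define C where "C = u x + 2 / (r x)\<^sup>2"
    have rx: "r x > 0" by (rule r_pos[OF x])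
    have C: "C > 0" using rx u1[OF x] by (simp add: C_def add_pos_pos)
    have "\<rho> x y < \<epsilon>" if y: "y \<in> M" and dxy: "d x y < min (r x / 2) (\<epsilon> / C)" for y
    proof -
      have ry: "r y \<ge> r x / 2" using r_lip[OF x y] dxy by linarith
      have ry0: "r y > 0" by (rule r_pos[OF y])
      have "\<bar>u x - u y\<bar> = \<bar>r y - r x\<bar> / (r x * r y)"
        using rx ry0 by (simp add: u_def field_simps abs_divide[symmetric] abs_mult)
      also have "\<dots> \<le> d x y / (r x * (r x / 2))"
        using r_lip[OF x y] r_lip[OF y x] rx ry ry0 by (intro frac_le mult_left_mono) (auto simp: d.commute)
      also have "\<dots> = d x y * (2 / (r x)\<^sup>2)" by (simp add: power2_eq_square)
      finally have "\<bar>u x - u y\<bar> \<le> d x y * (2 / (r x)\<^sup>2)" .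
      moreover have "min (u x) (u y) * d x y \<le> u x * d x y" by (intro mult_right_mono) auto
      ultimately have "\<rho> x y \<le> d x y * C" by (simp add: \<rho>_def C_def algebra_simps)
      also have "\<dots> < \<epsilon>" using dxy C by (simp add: pos_less_divide_eq)
      finally show ?thesis .
    qed
    then show "\<exists>\<delta>>0. \<forall>y\<in>M. d x y < \<delta> \<longrightarrow> \<rho> x y < \<epsilon>"
      using rx C \<epsilon> by (intro exI[of _ "min (r x / 2) (\<epsilon> / C)"]) auto
  qed
  moreover have "1 \<le> \<rho> a b" if ab: "(a, b) \<in> P" for a b
  proof -
    have abM: "a \<in> M" "b \<in> M" using PM M ab by auto
    have "r a \<le> d a b" using r_props(3)[of "max (d a a) (d a b)" a] ab abM by (force simp: S_def)
    moreover have "r b \<le> d a b" using r_props(3)[of "max (d b a) (d b b)" b] ab abM by (force simp: S_def d.commute)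
    ultimately have "1 / d a b \<le> min (u a) (u b)"
      using r_pos abM by (simp add: u_def frac_le)
    then have "1 / d a b * d a b \<le> min (u a) (u b) * d a b" by (intro mult_right_mono) auto
    moreover have "d a b > 0" using r_pos[OF abM(1)] \<open>r a \<le> d a b\<close> by linarith
    ultimately show ?thesis by (simp add: \<rho>_def)
  qed
  ultimately show thesis using that \<rho> Xd M by metis
qed

lemma metric_compact_nonisolated:
  fixes X :: "'a topology"
  assumes X: "metrizable_space X" and K: "compactin X (nonisolated_points X)"
  obtains \<rho> where "Metric_space (topspace X) \<rho>" "Metric_space.mtopology (topspace X) \<rho> = X"
    "\<And>f g. (\<And>k. f k \<in> topspace X) \<Longrightarrow> (\<And>k. g k \<in> topspace X) \<Longrightarrow> (\<And>k. f k \<noteq> g k) \<Longrightarrow>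
       (\<lambda>k. \<rho> (f k) (g k)) \<longlonglongrightarrow> 0 \<Longrightarrow>
       \<exists>r p. strict_mono (r :: nat \<Rightarrow> nat) \<and> limitin X (f \<circ> r) p sequentially"
proof -
  obtain M d where d: "Metric_space M d" "X = Metric_space.mtopology M d"
    using X unfolding metrizable_space_def by blast
  interpret Metric_space M d by fact
  have M: "topspace X = M" by (simp add: d)
  let ?K = "nonisolated_points X"
  have KM: "?K \<subseteq> M" using M by (auto simp: nonisolated_points_def)
  define \<kappa> where "\<kappa> x = Inf (insert 1 (d x ` ?K))" for x
  have "d x ` ?K \<subseteq> {0..}" for x by auto
  note \<kappa> = Inf_insert_one_props[OF this, folded \<kappa>_def]
  txt \<open>Adding the distances to the nonisolated points forces distinct points that are close to each
    other to be close to this compact set.\<close>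
  define \<rho> where "\<rho> x y = (if x = y then 0 else d x y + \<kappa> x + \<kappa> y)" for x y
  have \<rho>_ge: "d x y \<le> \<rho> x y" if "x \<in> M" for x y
    using that \<kappa>(1)[of x] \<kappa>(1)[of y] by (auto simp: \<rho>_def)
  have \<rho>: "Metric_space M \<rho>"
  proof
    show "0 \<le> \<rho> x y" for x y using \<kappa>(1)[of x] \<kappa>(1)[of y] by (simp add: \<rho>_def)
    show "\<rho> x y = \<rho> y x" for x y by (simp add: \<rho>_def commute)
    show "\<rho> x y = 0 \<longleftrightarrow> x = y" if "x \<in> M" "y \<in> M" for x y
    proof (cases "x = y")
      case False
      then have "0 < d x y" using that by simp
      then show ?thesis using \<rho>_ge[OF that(1), of y] False by linarith
    qed (simp add: \<rho>_def)
    show "\<rho> x z \<le> \<rho> x y + \<rho> y z" if "x \<in> M" "y \<in> M" "z \<in> M" for x y z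
      using triangle[OF that] \<kappa>(1)[of x] \<kappa>(1)[of y] \<kappa>(1)[of z] by (auto simp: \<rho>_def)
  qed
  have top: "Metric_space.mtopology M \<rho> = mtopology"
  proof (rule mtopology_eqI[OF Metric_space_axioms \<rho>])
    fix x and \<epsilon> :: real assume x: "x \<in> M" and \<epsilon>: "\<epsilon> > 0"
    show "\<exists>\<delta>>0. \<forall>y\<in>M. \<rho> x y < \<delta> \<longrightarrow> d x y < \<epsilon>"
      using \<epsilon> \<rho>_ge[OF x] by (intro exI[of _ \<epsilon>]) (auto intro: le_less_trans)
    \<comment> \<open>At a nonisolated \<open>x\<close> the summand \<open>\<kappa> x\<close>
      vanishes and \<open>\<kappa> y\<close> is at most \<open>d x y\<close>; at an isolated
      \<open>x\<close> small balls are singletons, where \<open>\<rho>\<close> is 0.\<close>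
    show "\<exists>\<delta>>0. \<forall>y\<in>M. d x y < \<delta> \<longrightarrow> \<rho> x y < \<epsilon>"
    proof (cases "x \<in> ?K")
      case True
      then have "\<kappa> x \<le> 0" using \<kappa>(3)[of "d x x" x] imageI[OF True, of "d x"] x by simp
      moreover have "\<kappa> y \<le> d x y" for y using True \<kappa>(3)[of "d y x" y] by (auto simp: commute)
      ultimately have le: "\<rho> x y \<le> 2 * d x y" for y
        using nonneg[of x y] by (auto simp: \<rho>_def) (smt (verit))
      have "\<rho> x y < \<epsilon>" if "d x y < \<epsilon> / 2" for y using le[of y] that by linarith
      then show ?thesis using \<epsilon> by (intro exI[of _ "\<epsilon> / 2"]) auto
    next
      case False
      then have "openin mtopology {x}" using x d M by (auto simp: nonisolated_points_def)
      then obtain \<delta> where "\<delta> > 0" "mball x \<delta> \<subseteq> {x}" unfolding openin_mtopology by blast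
      then show ?thesis using \<epsilon> x by (intro exI[of _ \<delta>]) (auto simp: \<rho>_def)
    qed
  qed
  have "\<exists>r p. strict_mono (r :: nat \<Rightarrow> nat) \<and> limitin X (f \<circ> r) p sequentially"
    if f: "\<And>k. f k \<in> M" and g: "\<And>k. g k \<in> M" and fg: "\<And>k. f k \<noteq> g k" and lim: "(\<lambda>k. \<rho> (f k) (g k)) \<longlonglongrightarrow> 0"
    for f g
  proof -
    have "\<kappa> (f k) \<le> \<rho> (f k) (g k)" for k
      using fg[of k] \<kappa>(1)[of "g k"] nonneg[of "f k" "g k"] by (simp add: \<rho>_def)
    then have \<kappa>0: "(\<lambda>k. \<kappa> (f k)) \<longlonglongrightarrow> 0"
      using \<kappa>(1) by (intro tendsto_sandwich[OF _ _ tendsto_const lim]) auto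
    \<comment> \<open>Below the cap 1, \<open>\<kappa>\<close> is an infimum of genuine distances to
      nonisolated points; in particular such points exist.\<close>
    have "eventually (\<lambda>k. \<kappa> (f k) < 1) sequentially" using \<kappa>0 by (intro order_tendstoD) auto
    then obtain N where N: "\<And>k. k \<ge> N \<Longrightarrow> \<kappa> (f k) < 1" by (auto simp: eventually_sequentially)
    have "\<exists>z\<in>?K. d (f (k + N)) z < \<kappa> (f (k + N)) + 1 / real (Suc k)" for k
    proof -
      have "\<kappa> (f (k + N)) < min 1 (\<kappa> (f (k + N)) + 1 / real (Suc k))"
        using N[of "k + N"] by auto
      from \<kappa>(4)[OF this] show ?thesis by auto
    qed
    then obtain z where z: "\<And>k. z k \<in> ?K" "\<And>k. d (f (k + N)) (z k) < \<kappa> (f (k + N)) + 1 / real (Suc k)"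
      by metis
    have "compactin mtopology ?K" using K d by simp
    moreover have "range z \<subseteq> ?K" using z by blast
    ultimately obtain p r where r: "strict_mono (r :: nat \<Rightarrow> nat)" "limitin mtopology (z \<circ> r) p sequentially"
      unfolding compactin_sequentially by blast
    have "(\<lambda>k. \<kappa> (f (k + N)) + 1 / real (Suc k)) \<longlonglongrightarrow> 0 + 0"
      by (intro tendsto_add LIMSEQ_ignore_initial_segment \<kappa>0 LIMSEQ_Suc lim_1_over_n)
    moreover have "norm (d (f (k + N)) (z k)) \<le> \<kappa> (f (k + N)) + 1 / real (Suc k)" for k
      using z(2)[of k] by simp
    ultimately have dz: "(\<lambda>k. d (f (k + N)) (z k)) \<longlonglongrightarrow> 0"
      using Lim_null_comparison[OF always_eventually] by (metis (no_types, lifting) add_0)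
    have "limitin mtopology (\<lambda>k. f (r k + N)) p sequentially"
      unfolding limitin_metric
    proof (intro conjI allI impI)
      show p: "p \<in> M" using r(2) limitin_mspace by blast
      fix \<epsilon> :: real assume "\<epsilon> > 0"
      have "eventually (\<lambda>k. d (f (r k + N)) (z (r k)) < \<epsilon> / 2) sequentially"
        using LIMSEQ_subseq_LIMSEQ[OF dz r(1)] \<open>\<epsilon> > 0\<close> by (intro order_tendstoD(2)[of _ 0]) (auto simp: o_def)
      moreover have "eventually (\<lambda>k. z (r k) \<in> M \<and> d (z (r k)) p < \<epsilon> / 2) sequentially"
        using r(2) half_gt_zero[OF \<open>\<epsilon> > 0\<close>] unfolding limitin_metric o_def by blast
      ultimately show "eventually (\<lambda>k. f (r k + N) \<in> M \<and> d (f (r k + N)) p < \<epsilon>) sequentially"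
      proof eventually_elim
        case (elim k)
        then show ?case using triangle[OF f[of "r k + N"], of "z (r k)" p] f p by auto
      qed
    qed
    moreover have "strict_mono (\<lambda>k. r k + N)" using r(1) by (simp add: strict_mono_def)
    ultimately show ?thesis using d(2) by (intro exI[of _ "\<lambda>k. r k + N"] exI[of _ p]) (simp add: o_def)
  qed
  then show thesis using that \<rho> top M d(2) by metis
qed

section \<open>Approximation by merging letters\<close>

lemma (in Metric_space) merge_pairs:
  assumes "set ps \<subseteq> M \<times> M"
  obtains s where "s \<in> M \<rightarrow> M" "\<And>p. p \<in> set ps \<Longrightarrow> s (fst p) = s (snd p)"
    "\<And>x. x \<in> M \<Longrightarrow> d x (s x) \<le> (\<Sum>p\<leftarrow>ps. d (fst p) (snd p))"
proof -
  \<comment> \<open>The induction needs a budget for each fibre: points with the same image are no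
    farther apart than the cost of the pairs inside their fibre. With only the total cost as a
    bound, joining two fibres would count earlier pairs twice. Idempotence puts \<open>x\<close> and
    \<open>s x\<close> into one fibre, which yields the bound on the displacement.\<close>
  have "\<exists>s\<in>M \<rightarrow> M. (\<forall>p\<in>set ps. s (fst p) = s (snd p)) \<and> (\<forall>x\<in>M. s (s x) = s x) \<and>
     (\<forall>x\<in>M. \<forall>y\<in>M. s x = s y \<longrightarrow> d x y \<le> (\<Sum>p\<leftarrow>ps. if s (fst p) = s x then d (fst p) (snd p) else 0))"
    using assms
  proof (induction ps)
    case Nil
    show ?case by (rule bexI[of _ "\<lambda>x. x"]) auto
  next
    case (Cons p ps)
    obtain a b where p: "p = (a, b)" by (cases p)
    have ab: "a \<in> M" "b \<in> M" using Cons.prems p by auto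
    have "set ps \<subseteq> M \<times> M" using Cons.prems by simp
    from Cons.IH[OF this]
    obtain s where s: "s \<in> M \<rightarrow> M" "\<forall>p\<in>set ps. s (fst p) = s (snd p)" "\<forall>x\<in>M. s (s x) = s x"
      and bound': "\<forall>x\<in>M. \<forall>y\<in>M. s x = s y \<longrightarrow>
        d x y \<le> (\<Sum>p\<leftarrow>ps. if s (fst p) = s x then d (fst p) (snd p) else 0)"
      by (elim bexE conjE)
    have bound: "d x y \<le> (\<Sum>p\<leftarrow>ps. if s (fst p) = s x then d (fst p) (snd p) else 0)"
      if "x \<in> M" "y \<in> M" "s x = s y" for x y
      using bound' that by blast
    define S where "S c = (\<Sum>p\<leftarrow>ps. if s (fst p) = c then d (fst p) (snd p) else 0)" for c
    show ?case
    proof (cases "s a = s b")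
      case True
      have "d x y \<le> (\<Sum>p\<leftarrow>p # ps. if s (fst p) = s x then d (fst p) (snd p) else 0)"
        if "x \<in> M" "y \<in> M" "s x = s y" for x y
        using bound[OF that] by (auto simp: p intro: add_increasing)
      then show ?thesis using s True p by (intro bexI[of _ s]) auto
    next
      case False
      define t where "t x = (if s x = s a then s b else s x)" for x
      define S' where "S' c = (\<Sum>p\<leftarrow>ps. if t (fst p) = c then d (fst p) (snd p) else 0)" for c
      have S_le: "S (s x) \<le> S' (t x)" for x
        unfolding S_def S'_def by (rule sum_list_mono) (auto simp: t_def)
      have S_sum: "S (s a) + S (s b) \<le> S' (s b)"
        unfolding S_def S'_def sum_list_addf[symmetric]
        by (rule sum_list_mono) (use False in \<open>auto simp: t_def\<close>)
      have tM: "t \<in> M \<rightarrow> M" using s(1) ab by (auto simp: t_def)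
      \<comment> \<open>The path from \<open>x\<close> through \<open>a\<close> and \<open>b\<close>
        to \<open>y\<close> spends the budgets of the two old fibres, both now owned by the joined
        fibre, and the cost of the new pair.\<close>
      have far: "d x y \<le> S' (s b) + d a b" if "x \<in> M" "y \<in> M" "s x = s a" "s y = s b" for x y
      proof -
        have "d x y \<le> d x a + (d a b + d b y)"
          using triangle[of x a y] triangle[of a b y] that ab by auto
        moreover have "d x a \<le> S (s a)" "d b y \<le> S (s b)"
          using bound[of x a] bound[of b y] that ab by (auto simp: S_def)
        ultimately show ?thesis using S_sum by linarith
      qed
      have "d x y \<le> (\<Sum>p\<leftarrow>p # ps. if t (fst p) = t x then d (fst p) (snd p) else 0)"
        if xy: "x \<in> M" "y \<in> M" "t x = t y" for x y
      proof -
        have eq: "(\<Sum>p\<leftarrow>p # ps. if t (fst p) = t x then d (fst p) (snd p) else 0)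
            = (if s b = t x then d a b else 0) + S' (t x)"
          by (simp add: p S'_def t_def)
        consider "s x = s y" | "s x = s a" "s y = s b" | "s x = s b" "s y = s a"
          using xy(3) by (auto simp: t_def split: if_splits)
        then show ?thesis
        proof cases
          case 1
          then have "d x y \<le> S (s x)" using bound xy by (simp add: S_def)
          then have "d x y \<le> 0 + S' (t x)" using S_le[of x] by linarith
          then show ?thesis using nonneg[of a b] unfolding eq by (auto intro: order_trans)
        next
          case 2
          then have "t x = s b" by (simp add: t_def)
          then show ?thesis using far[OF xy(1,2) 2] unfolding eq by (simp add: add.commute)
        next
          case 3
          then have "t x = s b" using False by (simp add: t_def)
          moreover have "d x y \<le> S' (s b) + d a b"
            using far[OF xy(2,1) 3(2,1)] by (subst commute)
          ultimately show ?thesis unfolding eq by (simp add: add.commute)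
        qed
      qed
      moreover have "t (t x) = t x" if "x \<in> M" for x
        using that s(3) ab False by (auto simp: t_def)
      moreover have "t (fst q) = t (snd q)" if "q \<in> set (p # ps)" for q
        using that s(2) by (auto simp: t_def p)
      ultimately show ?thesis using tM by blast
    qed
  qed
  then obtain s where s: "s \<in> M \<rightarrow> M" "\<forall>p\<in>set ps. s (fst p) = s (snd p)" "\<forall>x\<in>M. s (s x) = s x"
    and bound: "\<And>x y. x \<in> M \<Longrightarrow> y \<in> M \<Longrightarrow> s x = s y \<Longrightarrow>
        d x y \<le> (\<Sum>p\<leftarrow>ps. if s (fst p) = s x then d (fst p) (snd p) else 0)"
    by blast
  have "d x (s x) \<le> (\<Sum>p\<leftarrow>ps. d (fst p) (snd p))" if "x \<in> M" for x
  proof -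
    have "d x (s x) \<le> (\<Sum>p\<leftarrow>ps. if s (fst p) = s x then d (fst p) (snd p) else 0)"
      using that s by (intro bound) auto
    also have "\<dots> \<le> (\<Sum>p\<leftarrow>ps. d (fst p) (snd p))" by (rule sum_list_mono) simp
    finally show ?thesis .
  qed
  then show thesis using that s by blast
qed

lemma constant_subsequence:
  assumes "finite (range f)"
  obtains r c where "strict_mono (r :: nat \<Rightarrow> nat)" "\<And>k. f (r k) = c"
proof -
  obtain k where "infinite {a. f a = f k}"
    using pigeonhole_infinite[OF infinite_UNIV_nat assms] by auto
  from infinite_enumerate[OF this] show thesis using that by blast
qed

lemma (in Metric_space) finite_separated:
  assumes "finite L" "L \<subseteq> M"
  obtains \<delta> where "\<delta> > 0" "\<And>x y. x \<in> L \<Longrightarrow> y \<in> L \<Longrightarrow> d x y < \<delta> \<Longrightarrow> x = y"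
proof -
  let ?D = "insert 1 ((\<lambda>(x, y). d x y) ` {p \<in> L \<times> L. fst p \<noteq> snd p})"
  have fin: "finite ?D" using assms by simp
  show thesis
  proof (rule that[of "Min ?D"])
    show "Min ?D > 0" using fin assms by (subst Min_gr_iff) (auto simp: subset_iff)
    fix x y assume "x \<in> L" "y \<in> L" "d x y < Min ?D"
    then show "x = y" using Min_le[OF fin, of "d x y"] by force
  qed
qed

section \<open>Graev's neighbourhoods and limits of words\<close>

locale metric_free_topological_group = free_topological_group P G e X T
  for P :: "'g monoid \<Rightarrow> bool" and G (structure) and e :: "'a \<Rightarrow> 'g" and X and T +
  fixes d :: "'a \<Rightarrow> 'a \<Rightarrow> real"
  assumes Metric_space_d: "Metric_space M d" and mtopology_d: "Metric_space.mtopology M d = X"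
begin

sublocale metric: Metric_space M d by (rule Metric_space_d)

lemma limitin_X: "limitin X f l sequentially \<longleftrightarrow>
     l \<in> M \<and> (\<forall>\<epsilon>>0. \<exists>N. \<forall>n\<ge>N. f n \<in> M \<and> d (f n) l < \<epsilon>)"
  using metric.limit_metric_sequentially[of f l] by (simp add: mtopology_d)

lemma ball_neighbourhood: "x \<in> M \<Longrightarrow> \<epsilon> > 0 \<Longrightarrow> \<exists>U. openin X U \<and> x \<in> U \<and> (\<forall>y\<in>U. d x y < \<epsilon>)"
  using metric.openin_mball[of x \<epsilon>] by (intro exI[of _ "metric.mball x \<epsilon>"]) (auto simp: mtopology_d)

lemma induced_neighbourhood:
  assumes g: "g \<in> carrier G" and \<epsilon>: "\<epsilon> > 0"
  shows "\<exists>U. openin T U \<and> g \<in> U \<and>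
    (\<forall>h\<in>U. \<exists>s\<in>M \<rightarrow> M. (\<forall>x\<in>M. d x (s x) < \<epsilon>) \<and> induced s h = induced s g)"
proof -
  txt \<open>The neighbourhoods of Graev: \<open>kills ps h\<close> says that \<open>h\<close> lies in the normal closure of the
    quotients of the pairs \<open>ps\<close>.\<close>
  define cost where "cost ps = (\<Sum>p\<leftarrow>ps. d (fst p) (snd p))" for ps :: "('a \<times> 'a) list"
  define kills where "kills ps h \<longleftrightarrow> set ps \<subseteq> M \<times> M \<and>
      (\<forall>s\<in>M \<rightarrow> M. (\<forall>p\<in>set ps. s (fst p) = s (snd p)) \<longrightarrow> induced s h = \<one>)" for ps h
  define V where "V k = {h \<in> carrier G. \<exists>ps. kills ps h \<and> cost ps < (1/2)^k}" for k :: nat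
  have hom: "group_hom G G (induced s)" if "s \<in> M \<rightarrow> M" for s
    using induced_hom[OF that] by (simp add: group_hom_def group_hom_axioms_def)
  obtain k where k: "(1/2::real)^k < \<epsilon>" using real_arch_pow_inv[OF \<epsilon>, of "1/2"] by auto
  have "\<exists>U. openin T U \<and> g \<in> U \<and> (\<forall>h\<in>U. \<exists>u\<in>V k. h = g \<otimes> u)"
  proof (rule neighbourhood[OF _ _ _ _ _ _ g])
    show "V k \<subseteq> carrier G" for k by (auto simp: V_def)
    show "\<one> \<in> V k" for k
      using hom by (auto simp: V_def kills_def cost_def group_hom.hom_one intro!: exI[of _ "[]"])
    show "u \<otimes> v \<in> V k" if "u \<in> V (Suc k)" "v \<in> V (Suc k)" for u v k
    proof -
      obtain ps where ps: "kills ps u" "cost ps < (1/2)^Suc k" using \<open>u \<in> V (Suc k)\<close> by (auto simp: V_def)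
      obtain qs where qs: "kills qs v" "cost qs < (1/2)^Suc k" using \<open>v \<in> V (Suc k)\<close> by (auto simp: V_def)
      have uv: "u \<in> carrier G" "v \<in> carrier G" using that by (auto simp: V_def)
      have "kills (ps @ qs) (u \<otimes> v)"
        using ps(1) qs(1) group_hom.hom_mult[OF hom uv] unfolding kills_def by auto
      moreover have "cost (ps @ qs) < (1/2)^k" using ps(2) qs(2) by (simp add: cost_def)
      ultimately show ?thesis using uv unfolding V_def by blast
    qed
    show "inv u \<in> V k" if u: "u \<in> V k" for u k
    proof -
      obtain ps where ps: "kills ps u" "cost ps < (1/2)^k" "u \<in> carrier G" using u by (auto simp: V_def)
      then have "kills ps (inv u)"
        using group_hom.hom_inv[OF hom] unfolding kills_def by auto
      then show ?thesis using ps by (auto simp: V_def)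
    qed
    \<comment> \<open>Conjugates are killed by the same pairs at the same cost, so
      \<open>k' = k\<close> works.\<close>
    show "\<exists>k'. \<forall>u\<in>V k'. g \<otimes> u \<otimes> inv g \<in> V k" if g: "g \<in> carrier G" for g k
    proof (intro exI ballI)
      fix u assume "u \<in> V k"
      then obtain ps where ps: "kills ps u" "cost ps < (1/2)^k" "u \<in> carrier G" by (auto simp: V_def)
      have "induced s (g \<otimes> u \<otimes> inv g) = \<one>" if s: "s \<in> M \<rightarrow> M" "induced s u = \<one>" for s
      proof -
        interpret group_hom G G "induced s" by (rule hom[OF s(1)])
        show ?thesis using s(2) g ps(3) by simp
      qed
      then have "kills ps (g \<otimes> u \<otimes> inv g)" using ps(1) unfolding kills_def by blast
      then show "g \<otimes> u \<otimes> inv g \<in> V k" using ps g unfolding V_def by blast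
    qed
    show "\<exists>U. openin X U \<and> x \<in> U \<and> (\<forall>y\<in>U. inv (e x) \<otimes> e y \<in> V k)" if x: "x \<in> M" for x k
    proof -
      obtain U where U: "openin X U" "x \<in> U" "\<forall>y\<in>U. d x y < (1/2)^k"
        using ball_neighbourhood[OF x, of "(1/2)^k"] by auto
      have "inv (e x) \<otimes> e y \<in> V k" if "y \<in> U" for y
      proof -
        have y: "y \<in> M" using U(1) that openin_subset by blast
        have "induced s (inv (e x) \<otimes> e y) = \<one>" if s: "s \<in> M \<rightarrow> M" "s x = s y" for s
        proof -
          interpret group_hom G G "induced s" by (rule hom[OF s(1)])
          show ?thesis using s x y e_closed induced_e[OF s(1)] by (simp add: Pi_iff)
        qed
        then have "kills [(x, y)] (inv (e x) \<otimes> e y)" using x y by (auto simp: kills_def)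
        moreover have "cost [(x, y)] < (1/2)^k" using U(3) \<open>y \<in> U\<close> by (simp add: cost_def)
        ultimately show ?thesis using x y e_closed unfolding V_def by blast
      qed
      then show ?thesis using U by blast
    qed
  qed
  then obtain U where U: "openin T U" "g \<in> U" "\<forall>h\<in>U. \<exists>u\<in>V k. h = g \<otimes> u" by blast
  have "\<exists>s\<in>M \<rightarrow> M. (\<forall>x\<in>M. d x (s x) < \<epsilon>) \<and> induced s h = induced s g" if h: "h \<in> U" for h
  proof -
    obtain u where u: "u \<in> V k" "h = g \<otimes> u" using U(3) h by blast
    then obtain ps where ps: "kills ps u" "cost ps < (1/2)^k" "u \<in> carrier G" by (auto simp: V_def)
    have "set ps \<subseteq> M \<times> M" using ps(1) by (simp add: kills_def)
    from metric.merge_pairs[OF this, folded cost_def]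
    obtain s where s: "s \<in> M \<rightarrow> M" "\<And>p. p \<in> set ps \<Longrightarrow> s (fst p) = s (snd p)"
      "\<And>x. x \<in> M \<Longrightarrow> d x (s x) \<le> cost ps"
      by blast
    have "induced s u = \<one>" using ps(1) s unfolding kills_def by blast
    then have "induced s h = induced s g"
      using u(2) group_hom.hom_mult[OF hom[OF s(1)] g ps(3)] group_hom.hom_closed[OF hom[OF s(1)] g] by simp
    moreover have "\<forall>x\<in>M. d x (s x) < \<epsilon>" using s(3) ps(2) k by fastforce
    ultimately show ?thesis using s(1) by blast
  qed
  then show ?thesis using U by blast
qed

text \<open>A map that moves points by less than half the least distance between the finitely many
  letters of \<open>g\<close> and \<open>h\<close> is injective on these letters, and a map
  \<open>t\<close> of letters undoes it there.\<close>

lemma induced_inj: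
  assumes "g \<in> carrier G" "h \<in> carrier G"
  obtains \<epsilon> where "\<epsilon> > 0"
    "\<And>s. s \<in> M \<rightarrow> M \<Longrightarrow> (\<And>x. x \<in> M \<Longrightarrow> d x (s x) < \<epsilon>) \<Longrightarrow> induced s g = induced s h \<Longrightarrow> g = h"
proof -
  obtain u v where u: "letters u \<subseteq> M" "g = val u" and v: "letters v \<subseteq> M" "h = val v"
    using generated assms by metis
  let ?L = "letters u \<union> letters v"
  obtain \<delta> where \<delta>: "\<delta> > 0" "\<And>x y. x \<in> ?L \<Longrightarrow> y \<in> ?L \<Longrightarrow> d x y < \<delta> \<Longrightarrow> x = y"
    using metric.finite_separated[of ?L] u v by auto
  show thesis
  proof (rule that[of "\<delta> / 2"])
    fix s assume s: "s \<in> M \<rightarrow> M" "\<And>x. x \<in> M \<Longrightarrow> d x (s x) < \<delta> / 2" "induced s g = induced s h"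
    have "inj_on s ?L"
    proof
      fix x y assume xy: "x \<in> ?L" "y \<in> ?L" "s x = s y"
      then have M: "x \<in> M" "y \<in> M" using u v by auto
      have "d x y \<le> d x (s x) + d y (s x)"
        using metric.triangle'[of x "s x" y] M s(1) by auto
      also have "\<dots> < \<delta>" using s(2)[OF M(1)] s(2)[OF M(2)] xy(3) by simp
      finally show "x = y" using \<delta>(2) xy by blast
    qed
    define t where "t y = (if y \<in> s ` ?L then inv_into ?L s y else y)" for y
    have ts: "t (s x) = x" if "x \<in> ?L" for x
      using inv_into_f_f[OF \<open>inj_on s ?L\<close> that] that by (auto simp: t_def)
    have LM: "?L \<subseteq> M" using u v by auto
    have tM: "t \<in> M \<rightarrow> M"
    proof
      fix y assume "y \<in> M"
      then show "t y \<in> M" using inv_into_into[of y s ?L] LM by (auto simp only: t_def split: if_splits)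
    qed
    have undo: "induced t (induced s (val w)) = val w" if w: "letters w \<subseteq> ?L" for w
    proof -
      have "map (apfst t) (map (apfst s) w) = w"
        unfolding map_map
      proof (rule map_idI)
        fix a assume "a \<in> set w"
        then have "t (s (fst a)) = fst a" using w by (intro ts) blast
        then show "(apfst t \<circ> apfst s) a = a" by (cases a) simp
      qed
      moreover have "letters w \<subseteq> M" using w LM by blast
      moreover from this have "letters (map (apfst s) w) \<subseteq> M" using s(1) by (auto simp: image_subset_iff Pi_iff)
      ultimately show ?thesis using induced_val[OF s(1)] induced_val[OF tM] by metis
    qed
    have "induced t (induced s g) = g" "induced t (induced s h) = h"
      using undo[of u] undo[of v] u v by simp_all
    then show "g = h" using s(3) by metis
  qed (use \<delta> in simp)
qed

lemma Hausdorff_T: "Hausdorff_space T"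
  unfolding Hausdorff_space_def
proof (intro allI impI)
  fix g h assume "g \<in> topspace T \<and> h \<in> topspace T \<and> g \<noteq> h"
  then have gh: "g \<in> carrier G" "h \<in> carrier G" "g \<noteq> h" by (auto simp: topspace_T)
  let ?z = "inv g \<otimes> h"
  have z: "?z \<in> carrier G" "?z \<noteq> \<one>"
    using gh inv_equality[of "inv g" h] inv_inj[THEN inj_onD, of g h] by auto
  obtain \<epsilon> where \<epsilon>: "\<epsilon> > 0"
    "\<And>s. s \<in> M \<rightarrow> M \<Longrightarrow> (\<And>x. x \<in> M \<Longrightarrow> d x (s x) < \<epsilon>) \<Longrightarrow> induced s \<one> = induced s ?z \<Longrightarrow> \<one> = ?z"
    using induced_inj[OF one_closed z(1)] by blast
  obtain U where U: "openin T U" "?z \<in> U"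
    "\<forall>h\<in>U. \<exists>s\<in>M \<rightarrow> M. (\<forall>x\<in>M. d x (s x) < \<epsilon>) \<and> induced s h = induced s ?z"
    using induced_neighbourhood[OF z(1) \<epsilon>(1)] by blast
  have oneU: "\<one> \<notin> U" using U(3) \<epsilon>(2) z(2) by metis
  have "continuous_map (prod_topology T T) (prod_topology T T) (\<lambda>p. (inv (fst p), snd p))"
    using topological_group unfolding topological_group_def
    by (intro continuous_map_pairedI continuous_map_compose[OF continuous_map_fst, unfolded o_def]
         continuous_map_snd) auto
  from continuous_map_compose[OF this, of T "\<lambda>(x, y). x \<otimes> y"]
  have "continuous_map (prod_topology T T) T (\<lambda>p. inv (fst p) \<otimes> snd p)"
    using topological_group unfolding topological_group_def by (simp add: o_def)
  then have "openin (prod_topology T T) {p \<in> topspace (prod_topology T T). inv (fst p) \<otimes> snd p \<in> U}"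
    using U(1) unfolding continuous_map_def by blast
  from iffD1[OF openin_prod_topology_alt this, rule_format, of g h]
  obtain A B where AB: "openin T A" "openin T B" "g \<in> A" "h \<in> B"
    "A \<times> B \<subseteq> {p \<in> topspace (prod_topology T T). inv (fst p) \<otimes> snd p \<in> U}"
    using gh U(2) topspace_T by auto
  have "disjnt A B"
    unfolding disjnt_iff
  proof (intro allI notI)
    fix x assume x: "x \<in> A \<and> x \<in> B"
    then have "inv x \<otimes> x \<in> U" "x \<in> carrier G" using AB(5) openin_subset[OF AB(1)] topspace_T by auto
    then show False using oneU by simp
  qed
  then show "\<exists>A B. openin T A \<and> openin T B \<and> g \<in> A \<and> h \<in> B \<and> disjnt A B" using AB by blast
qed

lemma limit_unique: "limitin T f g sequentially \<Longrightarrow> limitin T f h sequentially \<Longrightarrow> g = h"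
  using limitin_Hausdorff_unique[OF _ _ _ Hausdorff_T] by (metis trivial_limit_sequentially)

lemma limitin_mult:
  assumes "limitin T f g F" "limitin T f' g' F"
  shows "limitin T (\<lambda>k. f k \<otimes> f' k) (g \<otimes> g') F"
proof -
  have "limitin (prod_topology T T) (\<lambda>k. (f k, f' k)) (g, g') F"
    using assms by (simp add: limitin_pairwise o_def)
  from continuous_map_limit[OF _ this, of T "\<lambda>(x, y). x \<otimes> y"]
  show ?thesis using topological_group unfolding topological_group_def by (simp add: o_def)
qed

lemma limitin_inv: "limitin T f g F \<Longrightarrow> limitin T (\<lambda>k. inv (f k)) (inv g) F"
  using continuous_map_limit[of T T "\<lambda>x. inv x" f g F] topological_group
  unfolding topological_group_def by (simp add: o_def)

lemma limitin_e: "limitin X f l F \<Longrightarrow> limitin T (\<lambda>k. e (f k)) (e l) F"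
  using continuous_map_limit[OF continuous_e] by (simp add: o_def)

lemma limitin_val:
  assumes "\<And>k. length (w k) = length l" "\<And>i k. i < length l \<Longrightarrow> snd (w k ! i) = snd (l ! i)"
    and "\<And>i. i < length l \<Longrightarrow> limitin X (\<lambda>k. fst (w k ! i)) (fst (l ! i)) F"
  shows "limitin T (\<lambda>k. val (w k)) (val l) F"
  using assms
proof (induction l arbitrary: w)
  case Nil
  then show ?case by (simp add: topspace_T)
next
  case (Cons a l)
  have w: "w k = (w k ! 0) # tl (w k)" for k
    using Cons.prems(1)[of k] by (cases "w k") auto
  have tl: "tl (w k) ! i = w k ! Suc i" for i k
    by (subst (2) w) simp
  have "limitin T (\<lambda>k. val (tl (w k))) (val l) F"
  proof (rule Cons.IH)
    show "length (tl (w k)) = length l" for k using Cons.prems(1)[of k] by simp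
    show "snd (tl (w k) ! i) = snd (l ! i)" if "i < length l" for i k
      using Cons.prems(2)[of "Suc i" k] that by (simp add: tl)
    show "limitin X (\<lambda>k. fst (tl (w k) ! i)) (fst (l ! i)) F" if "i < length l" for i
      using Cons.prems(3)[of "Suc i"] that by (simp add: tl)
  qed
  moreover have "limitin X (\<lambda>k. fst (w k ! 0)) (fst a) F"
    using Cons.prems(3)[of 0] by simp
  from limitin_e[OF this] limitin_inv[OF limitin_e[OF this]]
  have "limitin T (\<lambda>k. if snd a then e (fst (w k ! 0)) else inv (e (fst (w k ! 0))))
      (if snd a then e (fst a) else inv (e (fst a))) F"
    by simp
  ultimately have "limitin T (\<lambda>k. (if snd a then e (fst (w k ! 0)) else inv (e (fst (w k ! 0)))) \<otimes> val (tl (w k)))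
      (val (a # l)) F"
    using limitin_mult by auto
  moreover have "val (w k) = (if snd a then e (fst (w k ! 0)) else inv (e (fst (w k ! 0)))) \<otimes> val (tl (w k))" for k
    using Cons.prems(2)[of 0 k] by (subst w) simp
  ultimately show ?case by simp
qed

text \<open>Sequential relative compactness of the letters. Subsequences \<open>r\<close> are built
  in because \<open>convergent_letters\<close> refines the sequence once for each position in the
  words.\<close>

definition tame :: "(nat \<Rightarrow> 'a word) \<Rightarrow> bool" where
  "tame w \<longleftrightarrow> (\<forall>f r. strict_mono r \<longrightarrow> (\<forall>k. f k \<in> letters (w (r k))) \<longrightarrow>
     (\<exists>r' p. strict_mono (r' :: nat \<Rightarrow> nat) \<and> limitin X (f \<circ> r') p sequentially))"

lemma tame_subsequence: "tame w \<Longrightarrow> strict_mono r \<Longrightarrow> tame (w \<circ> r)"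
  unfolding tame_def by (auto dest: strict_mono_o[of r])

lemma convergent_letters:
  assumes len: "\<And>k. length (w k) = n" and tame: "tame w"
  obtains r l where "strict_mono (r :: nat \<Rightarrow> nat)" "length l = n" "\<And>i k. i < n \<Longrightarrow> snd (w (r k) ! i) = snd (l ! i)"
    "\<And>i. i < n \<Longrightarrow> limitin X (\<lambda>k. fst (w (r k) ! i)) (fst (l ! i)) sequentially"
proof -
  have "\<exists>r l. strict_mono (r :: nat \<Rightarrow> nat) \<and> length l = m \<and> (\<forall>i<m. (\<forall>k. snd (w (r k) ! i) = snd (l ! i)) \<and>
      limitin X (\<lambda>k. fst (w (r k) ! i)) (fst (l ! i)) sequentially)" if "m \<le> n" for m
    using that
  proof (induction m)
    case 0
    show ?case by (rule exI[of _ id]) (auto simp: strict_mono_def)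
  next
    case (Suc m)
    then obtain r l where r: "strict_mono (r :: nat \<Rightarrow> nat)" "length l = m"
      and rl: "\<And>i k. i < m \<Longrightarrow> snd (w (r k) ! i) = snd (l ! i)"
        "\<And>i. i < m \<Longrightarrow> limitin X (\<lambda>k. fst (w (r k) ! i)) (fst (l ! i)) sequentially"
      by auto
    have "fst (w (r k) ! m) \<in> letters (w (r k))" for k
      using len[of "r k"] Suc.prems by simp
    then obtain r' p where r': "strict_mono (r' :: nat \<Rightarrow> nat)"
        "limitin X ((\<lambda>k. fst (w (r k) ! m)) \<circ> r') p sequentially"
      using tame r(1) unfolding tame_def by meson
    have "finite (range (\<lambda>k. snd (w (r (r' k)) ! m)))" by simp
    from constant_subsequence[OF this]
    obtain r'' b where r'': "strict_mono (r'' :: nat \<Rightarrow> nat)" "\<And>k. snd (w (r (r' (r'' k))) ! m) = b" by blast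
    show ?case
    proof (intro exI conjI allI impI)
      show "strict_mono (r \<circ> (r' \<circ> r''))" using r r' r'' by (intro strict_mono_o)
      show "length (l @ [(p, b)]) = Suc m" using r by simp
      fix i assume i: "i < Suc m"
      show "snd (w ((r \<circ> (r' \<circ> r'')) k) ! i) = snd ((l @ [(p, b)]) ! i)" for k
        using i r(2) rl(1)[of i] r''(2)[of k] by (cases "i = m") (simp_all add: nth_append)
      show "limitin X (\<lambda>k. fst (w ((r \<circ> (r' \<circ> r'')) k) ! i)) (fst ((l @ [(p, b)]) ! i)) sequentially"
      proof (cases "i = m")
        case True
        then show ?thesis using limitin_subsequence[OF r''(1) r'(2)] r(2) by (simp add: o_def nth_append)
      next
        case False
        then have "i < m" using i by simp
        then show ?thesis
          using limitin_subsequence[OF strict_mono_o[OF r'(1) r''(1)] rl(2)] r(2)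
          by (simp add: o_def nth_append)
      qed
    qed
  qed
  from this[of n] show thesis using that by auto
qed

lemma limitin_move:
  assumes "limitin X f p sequentially" "\<epsilon> \<longlonglongrightarrow> 0" "\<And>k x. x \<in> M \<Longrightarrow> d x (s k x) < \<epsilon> k" "\<And>k. s k \<in> M \<rightarrow> M"
  shows "limitin X (\<lambda>k. s k (f k)) p sequentially"
  unfolding limitin_X
proof (intro conjI allI impI)
  show p: "p \<in> M" using assms(1) by (simp add: limitin_X)
  fix \<delta> :: real assume "\<delta> > 0"
  then obtain N where N: "\<forall>n\<ge>N. f n \<in> M \<and> d (f n) p < \<delta> / 2"
    using assms(1) unfolding limitin_X by (meson half_gt_zero)
  have "eventually (\<lambda>k. \<epsilon> k < \<delta> / 2) sequentially"
    using assms(2) \<open>\<delta> > 0\<close> by (intro order_tendstoD) auto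
  then obtain N' where N': "\<forall>n\<ge>N'. \<epsilon> n < \<delta> / 2" by (auto simp: eventually_sequentially)
  have "s n (f n) \<in> M \<and> d (s n (f n)) p < \<delta>" if "n \<ge> max N N'" for n
  proof -
    have fn: "f n \<in> M" "d (f n) p < \<delta> / 2" "\<epsilon> n < \<delta> / 2" using N N' that by auto
    moreover have "s n (f n) \<in> M" using assms(4) fn by blast
    ultimately show ?thesis
      using metric.triangle''[of "s n (f n)" "f n" p] assms(3)[OF fn(1), of n] p by auto
  qed
  then show "\<exists>N. \<forall>n\<ge>N. s n (f n) \<in> M \<and> d (s n (f n)) p < \<delta>" by blast
qed

text \<open>By tameness a subsequence of the words converges letter by letter to a word
  \<open>l\<close>, and vanishing displacements do not change that limit. But the displaced words
  have the values \<open>induced (s k) g\<close>, which tend to \<open>g\<close>; as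
  \<open>T\<close> is Hausdorff, \<open>val l = g\<close>.\<close>

lemma convergent_subsequence:
  assumes g: "g \<in> carrier G" and wM: "\<And>k. letters (w k) \<subseteq> M" and len: "\<And>k. length (w k) \<le> n"
    and s: "\<And>k. s k \<in> M \<rightarrow> M" "\<And>k x. x \<in> M \<Longrightarrow> d x (s k x) < \<epsilon> k" "\<epsilon> \<longlonglongrightarrow> 0"
    and eq: "\<And>k. induced (s k) (val (w k)) = induced (s k) g"
    and tame: "tame w"
  obtains r where "strict_mono (r :: nat \<Rightarrow> nat)" "limitin T (\<lambda>k. val (w (r k))) g sequentially"
proof -
  have "finite (range (\<lambda>k. length (w k)))"
    using len by (auto intro!: finite_subset[of "range (\<lambda>k. length (w k))" "{..n}"])
  from constant_subsequence[OF this] obtain r0 m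
    where r0: "strict_mono (r0 :: nat \<Rightarrow> nat)" "\<And>k. length (w (r0 k)) = m" by blast
  obtain r1 l where r1: "strict_mono (r1 :: nat \<Rightarrow> nat)" "length l = m"
    "\<And>i k. i < m \<Longrightarrow> snd ((w \<circ> r0) (r1 k) ! i) = snd (l ! i)"
    "\<And>i. i < m \<Longrightarrow> limitin X (\<lambda>k. fst ((w \<circ> r0) (r1 k) ! i)) (fst (l ! i)) sequentially"
    using convergent_letters[of "w \<circ> r0" m] r0 tame_subsequence[OF tame r0(1)] by auto
  define r where "r = r0 \<circ> r1"
  have r: "strict_mono r" using r0 r1 by (simp add: r_def strict_mono_o)
  have rl: "length (w (r k)) = length l" "i < length l \<Longrightarrow> snd (w (r k) ! i) = snd (l ! i)"
    "i < length l \<Longrightarrow> limitin X (\<lambda>k. fst (w (r k) ! i)) (fst (l ! i)) sequentially" for i k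
    using r0 r1 by (auto simp: r_def)
  have lim: "limitin T (\<lambda>k. val (w (r k))) (val l) sequentially"
    using rl by (intro limitin_val)
  have \<epsilon>: "(\<lambda>k. \<epsilon> (r k)) \<longlonglongrightarrow> 0" using LIMSEQ_subseq_LIMSEQ[OF s(3) r] by (simp add: o_def)
  have "limitin T (\<lambda>k. val (map (apfst (s (r k))) (w (r k)))) (val l) sequentially"
  proof (rule limitin_val)
    fix i assume i: "i < length l"
    show "limitin X (\<lambda>k. fst (map (apfst (s (r k))) (w (r k)) ! i)) (fst (l ! i)) sequentially"
      using limitin_move[OF rl(3)[OF i] \<epsilon>, of "\<lambda>k. s (r k)"] s(1,2) rl(1) i by simp
  qed (use rl in auto)
  then have 1: "limitin T (\<lambda>k. induced (s (r k)) g) (val l) sequentially"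
    using eq induced_val[OF s(1) wM] by simp
  obtain u where u: "letters u \<subseteq> M" "g = val u" using generated[OF g] by blast
  have "limitin T (\<lambda>k. val (map (apfst (s (r k))) u)) (val u) sequentially"
  proof (rule limitin_val)
    fix i assume i: "i < length u"
    have "fst (u ! i) \<in> M" using u i by (metis image_eqI nth_mem subsetD)
    then have "limitin X (\<lambda>k. fst (u ! i)) (fst (u ! i)) sequentially" by simp
    from limitin_move[OF this \<epsilon>, of "\<lambda>k. s (r k)"]
    show "limitin X (\<lambda>k. fst (map (apfst (s (r k))) u ! i)) (fst (u ! i)) sequentially"
      using s(1,2) i by simp
  qed auto
  then have "limitin T (\<lambda>k. induced (s (r k)) g) g sequentially"
    using induced_val[OF s(1) u(1)] u(2) by simp
  then have "val l = g" using limit_unique 1 by blast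
  then show thesis using that[OF r] lim by simp
qed

text \<open>The elements \<open>h k\<close> need not tend to \<open>g\<close>: they merely agree
  with \<open>g\<close> after a small displacement of letters. Convergence of a subsequence has to
  come from tameness.\<close>

lemma closure_approximation:
  assumes g: "g \<in> T closure_of A"
  obtains h s where "\<And>k. h k \<in> A" "\<And>k. s k \<in> M \<rightarrow> M" "\<And>k x. x \<in> M \<Longrightarrow> d x (s k x) < 1 / real (Suc k)"
    "\<And>k. induced (s k) (h k) = induced (s k) g"
proof -
  have gc: "g \<in> carrier G" using g topspace_T by (simp add: in_closure_of)
  have "\<exists>h s. h \<in> A \<and> s \<in> M \<rightarrow> M \<and> (\<forall>x\<in>M. d x (s x) < 1 / real (Suc k)) \<and> induced s h = induced s g" for k
  proof -
    obtain U where U: "openin T U" "g \<in> U"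
      "\<forall>h\<in>U. \<exists>s\<in>M \<rightarrow> M. (\<forall>x\<in>M. d x (s x) < 1 / real (Suc k)) \<and> induced s h = induced s g"
      using induced_neighbourhood[OF gc, of "1 / real (Suc k)"] by auto
    then obtain h where "h \<in> A" "h \<in> U" using g unfolding in_closure_of by blast
    then show ?thesis using U(3) by blast
  qed
  then show thesis using that by metis
qed

end

section \<open>Exponent sums and merged letters\<close>

definition word_frag :: "'a word \<Rightarrow> ('a \<Rightarrow>\<^sub>0 int)" where
  "word_frag w = (\<Sum>a\<leftarrow>w. if snd a then frag_of (fst a) else - frag_of (fst a))"

lemma word_frag_simps [simp]:
  "word_frag [] = 0"
  "word_frag (a # w) = (if snd a then frag_of (fst a) else - frag_of (fst a)) + word_frag w"
  "word_frag (u @ w) = word_frag u + word_frag w"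
  by (simp_all add: word_frag_def)

lemma keys_word_frag: "Poly_Mapping.keys (word_frag w) \<subseteq> letters w"
proof (induction w)
  case (Cons a w)
  have "Poly_Mapping.keys (word_frag (a # w)) \<subseteq>
      Poly_Mapping.keys (if snd a then frag_of (fst a) else - frag_of (fst a)) \<union> Poly_Mapping.keys (word_frag w)"
    using keys_add[of "if snd a then frag_of (fst a) else - frag_of (fst a)" "word_frag w"]
    by (simp only: word_frag_simps)
  then show ?case using Cons by (auto split: if_splits)
qed simp

lemma letters_prod_free_Abelian_group:
  assumes "letters w \<subseteq> S"
  shows "letters_prod (free_Abelian_group S) frag_of w = word_frag w"
  using assms by (induction w) auto

lemma lookup_word_frag_map:
  assumes "\<And>y. y \<in> letters w \<Longrightarrow> s y = s x \<Longrightarrow> y = x"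
  shows "Poly_Mapping.lookup (word_frag (map (apfst s) w)) (s x) = Poly_Mapping.lookup (word_frag w) x"
  using assms
proof (induction w)
  case (Cons a w)
  have "s (fst a) = s x \<longleftrightarrow> fst a = x" using Cons.prems[of "fst a"] by auto
  then show ?case using Cons by (auto simp: lookup_add)
qed simp

lemma frag_word:
  fixes c :: "'a \<Rightarrow>\<^sub>0 int"
  obtains w where "letters w = Poly_Mapping.keys c" "length w = frag_length c" "word_frag w = c"
proof -
  let ?l = "\<lambda>x. replicate (nat \<bar>Poly_Mapping.lookup c x\<bar>) (x, 0 < Poly_Mapping.lookup c x)"
  have repl: "word_frag (replicate n (x, b)) = frag_cmul (if b then int n else - int n) (frag_of x)" for n x b
    by (induction n) (auto intro!: poly_mapping_eqI simp: lookup_add lookup_minus algebra_simps)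
  have l: "word_frag (?l x) = frag_cmul (Poly_Mapping.lookup c x) (frag_of x)" for x
    by (simp add: repl)
  obtain xs where xs: "set xs = Poly_Mapping.keys c" "distinct xs"
    using finite_distinct_list[OF finite_keys[of c]] by blast
  define w where "w = concat (map ?l xs)"
  have "word_frag w = (\<Sum>x\<leftarrow>xs. word_frag (?l x))" unfolding w_def by (induction xs) auto
  also have "\<dots> = (\<Sum>x\<in>Poly_Mapping.keys c. frag_cmul (Poly_Mapping.lookup c x) (frag_of x))"
    using xs by (simp add: l sum_list_distinct_conv_sum_set)
  also have "\<dots> = c" using frag_expansion[of c] by (simp add: frag_extend_def)
  finally have "word_frag w = c" .
  moreover have "length w = (\<Sum>x\<leftarrow>xs. nat \<bar>Poly_Mapping.lookup c x\<bar>)"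
    unfolding w_def by (induction xs) auto
  then have "length w = frag_length c"
    using xs by (simp add: frag_length_def sum_list_distinct_conv_sum_set)
  moreover have "letters w = Poly_Mapping.keys c"
    using xs(1) by (force simp: w_def in_keys_iff)
  ultimately show thesis using that by blast
qed

context metric_free_topological_group
begin

lemma ab_val: "letters w \<subseteq> M \<Longrightarrow> ab (val w) = word_frag w"
proof -
  assume w: "letters w \<subseteq> M"
  have "ab (val w) = letters_prod (free_Abelian_group M) (ab \<circ> e) w"
    using w e_closed by (intro hom_letters_prod is_group ab_hom group_free_Abelian_group) auto
  also have "\<dots> = letters_prod (free_Abelian_group M) frag_of w"
    using w ab_e by (intro letters_prod_cong) auto
  finally show ?thesis by (simp add: letters_prod_free_Abelian_group w)
qed

lemma word_frag_eqI:
  assumes "s \<in> M \<rightarrow> M" "letters w \<subseteq> M" "letters u \<subseteq> M" "induced s (val w) = induced s (val u)"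
  shows "word_frag (map (apfst s) w) = word_frag (map (apfst s) u)"
proof -
  have "letters (map (apfst s) v) \<subseteq> M" if "letters v \<subseteq> M" for v
    using that assms(1) by (auto simp: image_subset_iff Pi_iff)
  then show ?thesis using assms ab_val induced_val by metis
qed

text \<open>If no other letter of \<open>w\<close> is merged with \<open>x\<close>, the nonzero
  exponent sum of \<open>x\<close> in \<open>w\<close> survives at \<open>s x\<close>, and then
  \<open>s x\<close> has to occur in the image of \<open>u\<close>.\<close>

lemma merged_letter:
  assumes "s \<in> M \<rightarrow> M" "letters w \<subseteq> M" "letters u \<subseteq> M" "induced s (val w) = induced s (val u)"
    and x: "x \<in> Poly_Mapping.keys (word_frag w)"
  shows "s x \<in> s ` letters u \<or> (\<exists>y\<in>letters w. y \<noteq> x \<and> s y = s x)"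
proof (rule ccontr)
  assume *: "\<not> ?thesis"
  then have "Poly_Mapping.lookup (word_frag (map (apfst s) w)) (s x) = Poly_Mapping.lookup (word_frag w) x"
    by (intro lookup_word_frag_map) blast
  then have "Poly_Mapping.lookup (word_frag (map (apfst s) w)) (s x) \<noteq> 0"
    using x by (simp add: in_keys_iff)
  then have "s x \<in> letters (map (apfst s) u)"
    using word_frag_eqI[OF assms(1-4)] keys_word_frag[of "map (apfst s) u"] by (auto simp: in_keys_iff)
  then show False using * by (force simp: image_iff)
qed

text \<open>By \<open>metric_compact_nonisolated\<close>, this holds for a suitable metric whenever the set of
  nonisolated points is compact.\<close>

definition clustering :: bool where
  "clustering \<longleftrightarrow> (\<forall>f g. (\<forall>k. f k \<in> M) \<longrightarrow> (\<forall>k. g k \<in> M) \<longrightarrow> (\<forall>k. f k \<noteq> g k) \<longrightarrow>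
     (\<lambda>k. d (f k) (g k)) \<longlonglongrightarrow> 0 \<longrightarrow>
       (\<exists>r p. strict_mono (r :: nat \<Rightarrow> nat) \<and> limitin X (f \<circ> r) p sequentially))"

lemma limitin_dist_zero:
  assumes "p \<in> M" "\<And>k. f k \<in> M" "\<And>k. d (f k) p < \<epsilon> k" "\<epsilon> \<longlonglongrightarrow> 0"
  shows "limitin X f p sequentially"
  unfolding limitin_X
proof (intro conjI allI impI)
  fix \<delta> :: real assume "\<delta> > 0"
  then have "eventually (\<lambda>k. \<epsilon> k < \<delta>) sequentially" using assms(4) by (intro order_tendstoD) auto
  then obtain N where "\<forall>n\<ge>N. \<epsilon> n < \<delta>" by (auto simp: eventually_sequentially)
  then have "f n \<in> M \<and> d (f n) p < \<delta>" if "n \<ge> N" for n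
    using assms(2,3)[of n] that by force
  then show "\<exists>N. \<forall>n\<ge>N. f n \<in> M \<and> d (f n) p < \<delta>" by blast
qed (rule assms)

lemma merged_dist:
  assumes "s \<in> M \<rightarrow> M" "\<And>x. x \<in> M \<Longrightarrow> d x (s x) < \<epsilon>" "x \<in> M" "y \<in> M" "s x = s y"
  shows "d x y < 2 * \<epsilon>"
proof -
  have "s y \<in> M" using assms(1,4) by blast
  then show ?thesis
    using metric.triangle'[of x "s y" y] assms(2)[OF assms(3)] assms(2)[OF assms(4)] assms(3-5) by simp
qed

text \<open>Letters that are close to the finite set \<open>F\<close> infinitely often subconverge
  by the pigeonhole principle; otherwise \<open>clustering\<close> takes over from some index on. It
  stands inside the disjunction so that spaces without it are covered whenever all letters are close
  to \<open>F\<close>, as happens for words of length two.\<close>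

lemma tameI:
  assumes \<epsilon>: "\<epsilon> \<longlonglongrightarrow> 0" and F: "finite F" "F \<subseteq> M" and wM: "\<And>k. letters (w k) \<subseteq> M"
    and near: "\<And>k x. x \<in> letters (w k) \<Longrightarrow>
      (\<exists>y\<in>F. d x y < \<epsilon> k) \<or> clustering \<and> (\<exists>y\<in>M. y \<noteq> x \<and> d x y < \<epsilon> k)"
  shows "tame w"
  unfolding tame_def
proof (intro allI impI)
  fix f and r :: "nat \<Rightarrow> nat" assume r: "strict_mono r" and f: "\<forall>k. f k \<in> letters (w (r k))"
  have fM: "f k \<in> M" for k using f wM by blast
  have \<epsilon>r: "(\<lambda>k. \<epsilon> (r (q k))) \<longlonglongrightarrow> 0" if "strict_mono q" for q
    using LIMSEQ_subseq_LIMSEQ[OF \<epsilon> strict_mono_o[OF r that]] by (simp add: o_def)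
  let ?A = "{k. \<exists>y\<in>F. d (f k) y < \<epsilon> (r k)}"
  show "\<exists>r' p. strict_mono (r' :: nat \<Rightarrow> nat) \<and> limitin X (f \<circ> r') p sequentially"
  proof (cases "finite ?A")
    case False
    then obtain q where q: "strict_mono (q :: nat \<Rightarrow> nat)" "\<And>k. q k \<in> ?A"
      using infinite_enumerate by blast
    have "\<forall>k. \<exists>y. y \<in> F \<and> d (f (q k)) y < \<epsilon> (r (q k))" using q(2) by blast
    from choice[OF this]
    obtain y where y: "\<And>k. y k \<in> F" "\<And>k. d (f (q k)) (y k) < \<epsilon> (r (q k))" by blast
    have "finite (range y)" using F y(1) by (auto intro: finite_subset)
    from constant_subsequence[OF this] obtain q' c where q': "strict_mono (q' :: nat \<Rightarrow> nat)" "\<And>k. y (q' k) = c"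
      by blast
    have "limitin X (\<lambda>k. f (q (q' k))) c sequentially"
    proof (rule limitin_dist_zero[OF _ fM _ \<epsilon>r[OF strict_mono_o[OF q(1) q'(1)]]])
      show "c \<in> M" using y(1)[of "q' 0"] q'(2)[of 0] F by auto
      show "d (f (q (q' k))) c < \<epsilon> (r ((q \<circ> q') k))" for k using y(2)[of "q' k"] q'(2)[of k] by simp
    qed
    then show ?thesis using strict_mono_o[OF q(1) q'(1)] by (auto simp: o_def)
  next
    case True
    then obtain N where "\<And>k. k \<ge> N \<Longrightarrow> k \<notin> ?A"
      unfolding finite_nat_set_iff_bounded by (meson leD)
    then have "clustering \<and> (\<exists>y\<in>M. y \<noteq> f (k + N) \<and> d (f (k + N)) y < \<epsilon> (r (k + N)))" for k
      using near[of "f (k + N)" "r (k + N)"] f by auto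
    then have c: clustering and "\<forall>k. \<exists>y. y \<in> M \<and> y \<noteq> f (k + N) \<and> d (f (k + N)) y < \<epsilon> (r (k + N))"
      by blast+
    from choice[OF this(2)]
    obtain y where y: "\<And>k. y k \<in> M" "\<And>k. f (k + N) \<noteq> y k"
        "\<And>k. d (f (k + N)) (y k) < \<epsilon> (r (k + N))" by metis
    have "strict_mono (\<lambda>k. k + N)" by (simp add: strict_mono_def)
    note lim0 = \<epsilon>r[OF this]
    have "norm (d (f (k + N)) (y k)) \<le> \<epsilon> (r (k + N))" for k
      using y(3)[of k] by simp
    then have lim: "(\<lambda>k. d (f (k + N)) (y k)) \<longlonglongrightarrow> 0"
      by (rule Lim_null_comparison[OF always_eventually[OF allI] lim0])
    from c[unfolded clustering_def, rule_format, OF fM y(1,2) lim]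
    obtain q p where q: "strict_mono (q :: nat \<Rightarrow> nat)" "limitin X ((\<lambda>k. f (k + N)) \<circ> q) p sequentially"
      by blast
    then show ?thesis
      by (intro exI[of _ "\<lambda>k. q k + N"] exI[of _ p]) (auto simp: strict_mono_def o_def)
  qed
qed

lemma tame_compact: "compact_space X \<Longrightarrow> (\<And>k. letters (w k) \<subseteq> M) \<Longrightarrow> tame w"
  unfolding tame_def
proof (intro allI impI)
  fix f and r :: "nat \<Rightarrow> nat"
  assume c: "compact_space X" and wM: "\<And>k. letters (w k) \<subseteq> M" and f: "\<forall>k. f k \<in> letters (w (r k))"
  have "range f \<subseteq> M" using f wM by blast
  then show "\<exists>r' p. strict_mono (r' :: nat \<Rightarrow> nat) \<and> limitin X (f \<circ> r') p sequentially"
    using c metric.compact_space_sequentially unfolding mtopology_d by blast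
qed

section \<open>Sequences from points in the closure\<close>

definition sequential_limit :: "'g set \<Rightarrow> 'g \<Rightarrow> bool" where
  "sequential_limit A g \<longleftrightarrow> (\<exists>\<sigma> :: nat \<Rightarrow> 'g. range \<sigma> \<subseteq> A \<and> limitin T \<sigma> g sequentially)"

lemma sequential_limit_mono: "sequential_limit A g \<Longrightarrow> A \<subseteq> B \<Longrightarrow> sequential_limit B g"
  unfolding sequential_limit_def by blast

lemma sequential_limit_self: "g \<in> A \<Longrightarrow> g \<in> carrier G \<Longrightarrow> sequential_limit A g"
  unfolding sequential_limit_def by (intro exI[of _ "\<lambda>_. g"]) (auto simp: topspace_T)

lemma frechet_urysohn_subspace:
  assumes "Y \<subseteq> carrier G"
  shows "frechet_urysohn_space (subtopology T Y) \<longleftrightarrow>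
    (\<forall>A g. A \<subseteq> Y \<longrightarrow> g \<in> Y \<longrightarrow> g \<in> T closure_of A \<longrightarrow> sequential_limit A g)"
proof -
  have "(\<exists>s. range s \<subseteq> A \<and> limitin (subtopology T Y) s g sequentially) \<longleftrightarrow> sequential_limit A g"
    if "A \<subseteq> Y" "g \<in> Y" for A g
    using that unfolding sequential_limit_def limitin_subtopology
    by (auto simp: image_subset_iff intro: always_eventually)
  moreover have "g \<in> subtopology T Y closure_of A \<longleftrightarrow> g \<in> Y \<and> g \<in> T closure_of A" if "A \<subseteq> Y" for A g
    using that by (simp add: closure_of_subtopology inf.absorb2)
  moreover have "topspace (subtopology T Y) = Y" using assms topspace_T by auto
  ultimately show ?thesis unfolding frechet_urysohn_space_def by (metis (no_types, lifting))
qed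

text \<open>\<open>W\<close> fixes one word for each element. Tameness is asked only from an index
  \<open>N\<close> on, because it may set in only when the displacement falls below a threshold that
  depends on \<open>g\<close>.\<close>

lemma sequential_limit_of_tame:
  assumes g: "g \<in> T closure_of A"
    and W: "\<And>h. h \<in> A \<Longrightarrow> letters (W h) \<subseteq> M" "\<And>h. h \<in> A \<Longrightarrow> length (W h) \<le> n"
      "\<And>h. h \<in> A \<Longrightarrow> val (W h) = h"
    and tame: "\<And>h s. (\<And>k. h k \<in> A) \<Longrightarrow> (\<And>k. s k \<in> M \<rightarrow> M) \<Longrightarrow>
       (\<And>k x. x \<in> M \<Longrightarrow> d x (s k x) < 1 / real (Suc k)) \<Longrightarrow>
       (\<And>k. induced (s k) (h k) = induced (s k) g) \<Longrightarrow>
       \<exists>N. tame (\<lambda>k. W (h (k + N)))"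
  shows "sequential_limit A g"
proof -
  have gc: "g \<in> carrier G" using g topspace_T by (simp add: in_closure_of)
  obtain h s where hs: "\<And>k. h k \<in> A" "\<And>k. s k \<in> M \<rightarrow> M"
    "\<And>k x. x \<in> M \<Longrightarrow> d x (s k x) < 1 / real (Suc k)" "\<And>k. induced (s k) (h k) = induced (s k) g"
    using closure_approximation[OF g] by blast
  obtain N where N: "tame (\<lambda>k. W (h (k + N)))" using tame[OF hs] by blast
  have lim: "(\<lambda>k. 1 / real (Suc (k + N))) \<longlonglongrightarrow> 0"
    using LIMSEQ_ignore_initial_segment[OF LIMSEQ_Suc[OF lim_1_over_n], of N] by simp
  show ?thesis
  proof (rule convergent_subsequence[OF gc, of "\<lambda>k. W (h (k + N))" n "\<lambda>k. s (k + N)"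
        "\<lambda>k. 1 / real (Suc (k + N))"])
    fix r assume "limitin T (\<lambda>k. val (W (h (r k + N)))) g sequentially"
    then show ?thesis
      unfolding sequential_limit_def using W(3)[OF hs(1)] hs(1)
      by (intro exI[of _ "\<lambda>k. h (r k + N)"]) auto
  next
    show "induced (s (k + N)) (val (W (h (k + N)))) = induced (s (k + N)) g" for k
      using W(3)[OF hs(1)] hs(4) by simp
  qed (fact | rule W hs)+
qed

lemma inverse_Suc_limit: "(\<lambda>k. c / real (Suc (k + N))) \<longlonglongrightarrow> 0"
  using LIMSEQ_ignore_initial_segment[OF LIMSEQ_Suc[OF lim_const_over_n[of c]], of N] by simp

text \<open>With \<open>clustering\<close>, only combinatorics is left to check: each letter is
  merged with a letter of \<open>g\<close> or with a different letter of its own word.\<close>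

lemma sequential_limit_clustering:
  assumes g: "g \<in> T closure_of A" and clustering: clustering
    and W: "\<And>h. h \<in> A \<Longrightarrow> letters (W h) \<subseteq> M" "\<And>h. h \<in> A \<Longrightarrow> length (W h) \<le> n"
      "\<And>h. h \<in> A \<Longrightarrow> val (W h) = h"
    and u: "letters u \<subseteq> M" "g = val u"
    and \<delta>: "\<delta> > 0"
    and near: "\<And>h s x. h \<in> A \<Longrightarrow> s \<in> M \<rightarrow> M \<Longrightarrow> (\<And>y. y \<in> M \<Longrightarrow> d y (s y) < \<delta>) \<Longrightarrow> induced s h = induced s g \<Longrightarrow>
       x \<in> letters (W h) \<Longrightarrow> s x \<in> s ` letters u \<or> (\<exists>y\<in>letters (W h). y \<noteq> x \<and> s y = s x)"
  shows "sequential_limit A g"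
proof (rule sequential_limit_of_tame[OF g W])
  fix h s assume hA: "\<And>k. h k \<in> A" and s: "\<And>k. s k \<in> M \<rightarrow> M"
    "\<And>k x. x \<in> M \<Longrightarrow> d x (s k x) < 1 / real (Suc k)" "\<And>k. induced (s k) (h k) = induced (s k) g"
  obtain N where N: "1 / real (Suc N) < \<delta>" using \<delta> reals_Archimedean by (auto simp: inverse_eq_divide)
  have "tame (\<lambda>k. W (h (k + N)))"
  proof (rule tameI[OF inverse_Suc_limit, of "letters u" _ 2 N])
    fix k x assume x: "x \<in> letters (W (h (k + N)))"
    let ?s = "s (k + N)" and ?w = "W (h (k + N))"
    have lM: "letters ?w \<subseteq> M" using W(1) hA by blast
    have sd: "d y (?s y) < 1 / real (Suc (k + N))" if "y \<in> M" for y using s(2)[OF that] .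
    have "1 / real (Suc (k + N)) \<le> 1 / real (Suc N)" by (simp add: frac_le)
    then have s\<delta>: "d y (?s y) < \<delta>" if "y \<in> M" for y using sd[OF that] N by linarith
    have mrg: "?s x \<in> ?s ` letters u \<or> (\<exists>y\<in>letters ?w. y \<noteq> x \<and> ?s y = ?s x)"
      using near[OF hA s(1) s\<delta> s(3)] x by simp
    have "d x y < 2 / real (Suc (k + N))" if "y \<in> M" "?s x = ?s y" for y
      using merged_dist[OF s(1) sd, of x y] that x lM by auto
    with mrg show "(\<exists>y\<in>letters u. d x y < 2 / real (Suc (k + N))) \<or>
        clustering \<and> (\<exists>y\<in>M. y \<noteq> x \<and> d x y < 2 / real (Suc (k + N)))"
      using clustering u(1) lM by (auto 4 3 simp: image_iff)
  qed (use u W(1) hA in auto)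
  then show "\<exists>N. tame (\<lambda>k. W (h (k + N)))" by blast
qed

end

section \<open>Words of bounded length\<close>

lemma letters_prod_free_group:
  assumes "letters w \<subseteq> S"
  shows "letters_prod (free_group S) free_gen w = foldr push_letter w []"
  using assms
proof (induction w)
  case Nil
  then show ?case by (simp add: one_free_group)
next
  case (Cons a w)
  obtain x b where a: "a = (x, b)" by (cases a)
  have x: "x \<in> S" using Cons.prems a by simp
  interpret group "free_group S" by (rule group_free_group)
  have "inv\<^bsub>free_group S\<^esub> (free_gen x) = [(x, False)]"
    using x by (intro inv_equality)
      (auto simp: carrier_free_group mult_free_group one_free_group reduced_word_Cons inv_letter_def)
  then show ?case using Cons a by (simp add: mult_free_group)
qed

lemma letters_prod_reduced:
  "reduced_word w \<Longrightarrow> letters w \<subseteq> S \<Longrightarrow> letters_prod (free_group S) free_gen w = w"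
  by (simp add: letters_prod_free_group foldr_push_Nil)

section \<open>F(X) and A(X) as instances\<close>

lemma free_topological_group_free_group:
  assumes "metrizable_space X"
  shows "free_topological_group group (free_group (topspace X)) free_gen X (free_topology X)"
proof (rule free_topological_group.intro)
  show "is_free_group_topology group (free_group (topspace X)) free_gen X (free_topology X)"
    using assms by (intro is_free_group_topology_free_topology metrizable_imp_completely_regular_space
        metrizable_imp_Hausdorff_space)
  show "\<exists>w. letters w \<subseteq> topspace X \<and> g = letters_prod (free_group (topspace X)) free_gen w"
    if "g \<in> carrier (free_group (topspace X))" for g
    using that by (intro exI[of _ g]) (auto simp: carrier_free_group letters_prod_reduced)
  show "\<exists>h\<in>hom (free_group (topspace X)) (free_group (topspace X)). \<forall>x\<in>topspace X. h (free_gen x) = free_gen (s x)"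
    if "s \<in> topspace X \<rightarrow> topspace X" for s
    using that by (intro free_group_hom_exists group_free_group free_gen_in_free_group) auto
  show "\<exists>h\<in>hom (free_group (topspace X)) (free_Abelian_group (topspace X)). \<forall>x\<in>topspace X. h (free_gen x) = frag_of x"
    by (intro free_group_hom_exists) auto
qed (rule group_free_group)

lemma free_topological_group_free_Abelian_group:
  assumes "metrizable_space X"
  shows "free_topological_group comm_group (free_Abelian_group (topspace X)) frag_of X (free_abelian_topology X)"
proof (rule free_topological_group.intro)
  show "is_free_group_topology comm_group (free_Abelian_group (topspace X)) frag_of X (free_abelian_topology X)"
    using assms by (intro is_free_group_topology_free_abelian_topology metrizable_imp_completely_regular_space
        metrizable_imp_Hausdorff_space)
  show "\<exists>w. letters w \<subseteq> topspace X \<and> g = letters_prod (free_Abelian_group (topspace X)) frag_of w"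
    if "g \<in> carrier (free_Abelian_group (topspace X))" for g
  proof -
    obtain w where w: "letters w = Poly_Mapping.keys g" "word_frag w = g" using frag_word by metis
    then show ?thesis using that by (intro exI[of _ w]) (simp add: letters_prod_free_Abelian_group)
  qed
  show "\<exists>h\<in>hom (free_Abelian_group (topspace X)) (free_Abelian_group (topspace X)). \<forall>x\<in>topspace X. h (frag_of x) = frag_of (s x)"
    if "s \<in> topspace X \<rightarrow> topspace X" for s
  proof -
    have "(frag_of \<circ> s) ` topspace X \<subseteq> carrier (free_Abelian_group (topspace X))" using that by auto
    from comm_group.free_Abelian_group_universal[OF abelian_free_Abelian_group this]
    show ?thesis by (metis comp_apply)
  qed
  show "\<exists>h\<in>hom (free_Abelian_group (topspace X)) (free_Abelian_group (topspace X)). \<forall>x\<in>topspace X. h (frag_of x) = frag_of x"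
    by (intro bexI[of _ "\<lambda>x. x"]) (auto simp: hom_def)
qed (rule abelian_free_Abelian_group)

lemma metric_free_topological_groupI:
  assumes "free_topological_group P G e X T" "Metric_space (topspace X) d" "Metric_space.mtopology (topspace X) d = X"
  shows "metric_free_topological_group P G e X T d"
  using assms by (simp add: metric_free_topological_group_def metric_free_topological_group_axioms_def)

lemma (in free_topological_group) metric_locale:
  assumes "metrizable_space X"
  obtains d where "metric_free_topological_group P G e X T d"
proof -
  obtain M' d where "Metric_space M' d" "X = Metric_space.mtopology M' d"
    using assms unfolding metrizable_space_def by blast
  moreover from this have "topspace X = M'" by (simp add: Metric_space.topspace_mtopology)
  ultimately have "Metric_space M d" "Metric_space.mtopology M d = X" by auto
  then show thesis using that metric_free_topological_groupI free_topological_group_axioms by blast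
qed

context free_topological_group
begin

text \<open>Arbitrary words are allowed, so that one definition covers both groups. Evaluation never
  increases the reduced length, hence the sets underlying \<open>free_words\<close> and
  \<open>free_abelian_words\<close> are recovered.\<close>

definition short_elements :: "nat \<Rightarrow> 'g set" where
  "short_elements n = {val w | w. letters w \<subseteq> M \<and> length w \<le> n}"

lemma short_elements_subset: "short_elements n \<subseteq> carrier G"
  unfolding short_elements_def using val_closed by blast

lemma short_elementsI: "letters w \<subseteq> M \<Longrightarrow> length w \<le> n \<Longrightarrow> val w \<in> short_elements n"
  unfolding short_elements_def by blast

definition short_word :: "'g \<Rightarrow> 'a word" where
  "short_word g = arg_min length (\<lambda>w. letters w \<subseteq> M \<and> val w = g)"

lemma short_word:
  assumes "g \<in> carrier G"
  shows "letters (short_word g) \<subseteq> M" "val (short_word g) = g"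
    "letters w \<subseteq> M \<Longrightarrow> val w = g \<Longrightarrow> length (short_word g) \<le> length w"
    "g \<in> short_elements n \<Longrightarrow> length (short_word g) \<le> n"
proof -
  let ?Q = "\<lambda>w. letters w \<subseteq> M \<and> val w = g"
  obtain w0 where "?Q w0" using generated[OF assms] by blast
  then have Q: "?Q (short_word g)"
    unfolding short_word_def by (rule arg_min_natI)
  then show "letters (short_word g) \<subseteq> M" "val (short_word g) = g" by auto
  have least: "length (short_word g) \<le> length w" if "?Q w" for w
    unfolding short_word_def using that by (rule arg_min_nat_le)
  then show "length (short_word g) \<le> length w" if "letters w \<subseteq> M" "val w = g"
    using that by blast
  assume "g \<in> short_elements n"
  then obtain w where "?Q w" "length w \<le> n" unfolding short_elements_def by blast
  then show "length (short_word g) \<le> n" using least[of w] by linarith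
qed

end

lemma short_elements_free_group:
  assumes "metrizable_space X"
  shows "free_topological_group.short_elements (free_group (topspace X)) free_gen X n =
    {w \<in> carrier (free_group (topspace X)). length w \<le> n}"
proof -
  interpret free_topological_group group "free_group (topspace X)" free_gen X "free_topology X"
    by (rule free_topological_group_free_group[OF assms])
  have len: "length (foldr push_letter w []) \<le> length w" for w :: "'a word"
  proof (induction w)
    case (Cons a w)
    have "length (push_letter a v) \<le> Suc (length v)" for v by (cases v) auto
    from le_trans[OF this[of "foldr push_letter w []"]] show ?case using Cons by simp
  qed simp
  show ?thesis
  proof (intro equalityI subsetI)
    fix w assume "w \<in> {w \<in> carrier (free_group (topspace X)). length w \<le> n}"
    then have w: "letters w \<subseteq> topspace X" "length w \<le> n" "val w = w"
      by (auto simp: carrier_free_group letters_prod_reduced)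
    from short_elementsI[OF w(1,2)] show "w \<in> short_elements n" by (simp only: w(3))
  next
    fix g assume g: "g \<in> short_elements n"
    then obtain w where w: "letters w \<subseteq> topspace X" "length w \<le> n" "g = val w"
      unfolding short_elements_def by blast
    then have "length g \<le> n" using len[of w] by (simp add: letters_prod_free_group)
    then show "g \<in> {w \<in> carrier (free_group (topspace X)). length w \<le> n}"
      using g short_elements_subset by blast
  qed
qed

lemma free_words_eq:
  "metrizable_space X \<Longrightarrow> free_words n X = subtopology (free_topology X)
    (free_topological_group.short_elements (free_group (topspace X)) free_gen X n)"
  by (simp add: free_words_def short_elements_free_group)

lemma frag_length_add: "frag_length (a + b) \<le> frag_length a + frag_length b"
proof -
  let ?K = "Poly_Mapping.keys a \<union> Poly_Mapping.keys b"
  have ext: "frag_length c = (\<Sum>x\<in>?K. nat \<bar>Poly_Mapping.lookup c x\<bar>)" if "Poly_Mapping.keys c \<subseteq> ?K" for c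
    unfolding frag_length_def using that
    by (intro sum.mono_neutral_left) (auto simp: in_keys_iff)
  have "frag_length (a + b) = (\<Sum>x\<in>?K. nat \<bar>Poly_Mapping.lookup a x + Poly_Mapping.lookup b x\<bar>)"
    using ext[OF keys_add] by (simp add: lookup_add)
  also have "\<dots> \<le> (\<Sum>x\<in>?K. nat \<bar>Poly_Mapping.lookup a x\<bar> + nat \<bar>Poly_Mapping.lookup b x\<bar>)"
    by (intro sum_mono) linarith
  finally show ?thesis using ext[of a] ext[of b] by (simp add: sum.distrib)
qed

lemma frag_length_word_frag: "frag_length (word_frag w) \<le> length w"
proof (induction w)
  case (Cons a w)
  have "frag_length (frag_of x) = 1" "frag_length (- frag_of x) = 1" for x :: 'a
    by (simp_all add: frag_length_def)
  then show ?case
    using Cons frag_length_add[of "if snd a then frag_of (fst a) else - frag_of (fst a)" "word_frag w"]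
    by (auto split: if_splits)
qed (simp add: frag_length_def)

lemma short_elements_free_Abelian_group:
  assumes "metrizable_space X"
  shows "free_topological_group.short_elements (free_Abelian_group (topspace X)) frag_of X n =
    {c \<in> carrier (free_Abelian_group (topspace X)). frag_length c \<le> n}"
proof -
  interpret free_topological_group comm_group "free_Abelian_group (topspace X)" frag_of X "free_abelian_topology X"
    by (rule free_topological_group_free_Abelian_group[OF assms])
  show ?thesis
  proof (intro equalityI subsetI)
    fix c assume c: "c \<in> {c \<in> carrier (free_Abelian_group (topspace X)). frag_length c \<le> n}"
    obtain w where w: "letters w = Poly_Mapping.keys c" "length w = frag_length c" "word_frag w = c"
      using frag_word by blast
    then have "letters w \<subseteq> topspace X" "length w \<le> n" "val w = c"
      using c by (auto simp: letters_prod_free_Abelian_group)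
    then show "c \<in> short_elements n" using short_elementsI by metis
  next
    fix c assume c: "c \<in> short_elements n"
    then obtain w where w: "letters w \<subseteq> topspace X" "length w \<le> n" "c = val w"
      unfolding short_elements_def by blast
    then have "frag_length c \<le> n"
      using frag_length_word_frag[of w] by (simp add: letters_prod_free_Abelian_group)
    then show "c \<in> {c \<in> carrier (free_Abelian_group (topspace X)). frag_length c \<le> n}"
      using c short_elements_subset by blast
  qed
qed

lemma free_abelian_words_eq:
  "metrizable_space X \<Longrightarrow> free_abelian_words n X = subtopology (free_abelian_topology X)
    (free_topological_group.short_elements (free_Abelian_group (topspace X)) frag_of X n)"
  by (simp add: free_abelian_words_def short_elements_free_Abelian_group)

lemma frechet_urysohn_subtopology:
  assumes "frechet_urysohn_space (subtopology T B)" "A \<subseteq> B"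
  shows "frechet_urysohn_space (subtopology T A)"
  unfolding frechet_urysohn_space_def
proof (intro allI impI)
  fix S y assume S: "S \<subseteq> topspace (subtopology T A) \<and> y \<in> subtopology T A closure_of S"
  then have SA: "S \<subseteq> A" "y \<in> A" "S \<subseteq> topspace (subtopology T B)"
    using assms(2) by (auto simp: in_closure_of)
  moreover have "y \<in> subtopology T B closure_of S"
    using S SA assms(2) by (auto simp: closure_of_subtopology inf.absorb2)
  ultimately obtain s where s: "range s \<subseteq> S" "limitin (subtopology T B) s y sequentially"
    using assms(1) unfolding frechet_urysohn_space_def by blast
  then have "limitin (subtopology T A) s y sequentially"
    using SA by (auto simp: limitin_subtopology image_subset_iff intro: always_eventually)
  then show "\<exists>s. range s \<subseteq> S \<and> limitin (subtopology T A) s y sequentially" using s by blast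
qed

section \<open>The compact case, words without cancelled letters, and length two\<close>

context metric_free_topological_group
begin

lemma frechet_urysohn_short_elementsI:
  assumes "\<And>A g. A \<subseteq> short_elements n \<Longrightarrow> g \<in> short_elements n \<Longrightarrow> g \<in> T closure_of A \<Longrightarrow> sequential_limit A g"
  shows "frechet_urysohn_space (subtopology T (short_elements n))"
  using assms unfolding frechet_urysohn_subspace[OF short_elements_subset] by blast

lemma frechet_urysohn_short_elements_compact:
  assumes "compact_space X"
  shows "frechet_urysohn_space (subtopology T (short_elements n))"
proof (rule frechet_urysohn_short_elementsI)
  fix A g assume A: "A \<subseteq> short_elements n" and g: "g \<in> T closure_of A"
  have Ac: "h \<in> carrier G" "h \<in> short_elements n" if "h \<in> A" for h
    using A short_elements_subset that by auto
  have W: "letters (short_word h) \<subseteq> M" "length (short_word h) \<le> n" "val (short_word h) = h" if "h \<in> A" for h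
    using Ac[OF that] short_word by auto
  show "sequential_limit A g"
  proof (rule sequential_limit_of_tame[OF g W])
    fix h :: "nat \<Rightarrow> 'g" assume h: "\<And>k. h k \<in> A"
    show "\<exists>N. tame (\<lambda>k. short_word (h (k + N)))" by (intro exI tame_compact[OF assms] W(1) h)
  qed
qed

text \<open>When every letter of the chosen word has nonzero exponent sum,
  \<open>merged_letter\<close> accounts for all letters. In A(X) such words exist for all elements,
  by \<open>frag_word\<close>; in F(X) commutators of letters have none.\<close>

lemma frechet_urysohn_short_elements_balanced:
  assumes clustering
    and rep: "\<And>h. h \<in> short_elements n \<Longrightarrow> \<exists>w. letters w \<subseteq> M \<and> length w \<le> n \<and> val w = h \<and>
      letters w \<subseteq> Poly_Mapping.keys (word_frag w)"
  shows "frechet_urysohn_space (subtopology T (short_elements n))"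
proof (rule frechet_urysohn_short_elementsI)
  fix A g assume A: "A \<subseteq> short_elements n" "g \<in> short_elements n" and g: "g \<in> T closure_of A"
  have "\<forall>h\<in>short_elements n. \<exists>w. letters w \<subseteq> M \<and> length w \<le> n \<and> val w = h \<and>
      letters w \<subseteq> Poly_Mapping.keys (word_frag w)"
    by (intro ballI rep)
  from bchoice[OF this]
  obtain W where W: "\<forall>h\<in>short_elements n. letters (W h) \<subseteq> M \<and> length (W h) \<le> n \<and> val (W h) = h \<and>
      letters (W h) \<subseteq> Poly_Mapping.keys (word_frag (W h))" ..
  obtain u where u: "letters u \<subseteq> M" "g = val u" using A(2) unfolding short_elements_def by blast
  have WA: "letters (W h) \<subseteq> M" "length (W h) \<le> n" "val (W h) = h"
    "letters (W h) \<subseteq> Poly_Mapping.keys (word_frag (W h))" if "h \<in> A" for h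
    using bspec[OF W, of h] A(1) that by blast+
  show "sequential_limit A g"
  proof (rule sequential_limit_clustering[OF g \<open>clustering\<close> WA(1-3) u, of 1])
    fix h s x assume h: "h \<in> A" "s \<in> M \<rightarrow> M" "induced s h = induced s g" "x \<in> letters (W h)"
    have Wh: "letters (W h) \<subseteq> M" "val (W h) = h" "x \<in> Poly_Mapping.keys (word_frag (W h))"
      using WA[OF h(1)] h(4) by auto
    show "s x \<in> s ` letters u \<or> (\<exists>y\<in>letters (W h). y \<noteq> x \<and> s y = s x)"
      using h(3) by (intro merged_letter[OF h(2) Wh(1) u(1) _ Wh(3)]) (simp add: Wh(2) u(2))
  qed simp_all
qed

text \<open>Two letters cancel in exponent only as a letter next to its own inverse, so up to length
  two nothing is lost by passing to exponent sums, even in F(X).\<close>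

lemma word_frag_short:
  assumes "length v \<le> 2"
  shows "word_frag v \<noteq> 0 \<Longrightarrow> letters v \<subseteq> Poly_Mapping.keys (word_frag v)"
    and "word_frag v = 0 \<Longrightarrow> letters v \<subseteq> M \<Longrightarrow> v = [] \<or> (\<exists>a b. v = [(a, b), (a, \<not> b)]) \<and> val v = \<one>"
proof -
  consider "v = []" | a b where "v = [(a, b)]" | a b a' b' where "v = [(a, b), (a', b')]"
    using assms by (cases v rule: list.exhaust; cases "tl v"; cases "tl (tl v)") auto
  note cases = this
  have two: "Poly_Mapping.lookup (word_frag [(a, b), (a', b')]) a =
      (if b then 1 else -1) + (if a' = a then if b' then 1 else -1 else 0)" for a a' :: 'a and b b'
    by (auto simp: lookup_add lookup_minus)
  have two': "Poly_Mapping.lookup (word_frag [(a, b), (a', b')]) a' =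
      (if b' then 1 else -1) + (if a' = a then if b then 1 else -1 else 0)" for a a' :: 'a and b b'
    by (auto simp: lookup_add lookup_minus)
  have zero: "a' = a \<and> b' = (\<not> b)" if "word_frag [(a, b), (a', b')] = 0" for a a' :: 'a and b b'
    using two[of a b a' b'] unfolding that by (auto split: if_splits)
  show "letters v \<subseteq> Poly_Mapping.keys (word_frag v)" if "word_frag v \<noteq> 0"
    using cases
  proof cases
    case (3 a b a' b')
    have not: "\<not> (a' = a \<and> b' = (\<not> b))" using that unfolding 3 by (cases b; cases b') auto
    have "(if b then 1 else -1) + (if a' = a then if b' then 1 else -1 else 0) \<noteq> (0 :: int)"
      using not by (auto split: if_splits)
    then have 1: "a \<in> Poly_Mapping.keys (word_frag v)" unfolding in_keys_iff 3 two .
    have "(if b' then 1 else -1) + (if a' = a then if b then 1 else -1 else 0) \<noteq> (0 :: int)"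
      using not by (auto split: if_splits)
    then have "a' \<in> Poly_Mapping.keys (word_frag v)" unfolding in_keys_iff 3 two' .
    then show ?thesis using 1 3 by simp
  qed auto
  show "v = [] \<or> (\<exists>a b. v = [(a, b), (a, \<not> b)]) \<and> val v = \<one>" if v: "word_frag v = 0" "letters v \<subseteq> M"
    using cases
  proof cases
    case (3 a b a' b')
    then have "v = [(a, b), (a, \<not> b)]" using zero v by simp
    then show ?thesis using v e_closed[of a] by auto
  qed (use v in \<open>auto split: if_splits\<close>)
qed

text \<open>Nothing is assumed on the nonisolated points, so letters may be controlled only by
  closeness to a finite set. Near \<open>g \<noteq> \<one>\<close> these are the letters of
  \<open>g\<close>; near \<open>\<one>\<close> it is a point at which pairs of letters of words from
  \<open>A\<close> accumulate.\<close>

lemma frechet_urysohn_short_elements_2: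
  "frechet_urysohn_space (subtopology T (short_elements 2))"
proof (rule frechet_urysohn_short_elementsI)
  fix A g assume A: "A \<subseteq> short_elements 2" "g \<in> short_elements 2" and g: "g \<in> T closure_of A"
  have Ac: "h \<in> carrier G" "h \<in> short_elements 2" if "h \<in> A" for h
    using A short_elements_subset that by auto
  have gc: "g \<in> carrier G" using A short_elements_subset by auto
  let ?W = short_word
  have W: "letters (?W h) \<subseteq> M" "length (?W h) \<le> 2" "val (?W h) = h" if "h \<in> A" for h
    using Ac[OF that] short_word by auto
  show "sequential_limit A g"
  proof (cases "g = \<one>")
    case False
    define u where "u = ?W g"
    have u: "letters u \<subseteq> M" "length u \<le> 2" "val u = g" using gc A(2) short_word by (auto simp: u_def)
    \<comment> \<open>Below \<open>\<delta>\<close> the image of \<open>g\<close> stays nontrivial,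
      so its exponent sums do not all vanish. The image of \<open>h k\<close> has the same exponent
      sums, and at length two this forces each letter of \<open>h k\<close> to be merged with a
      letter of \<open>g\<close>.\<close>
    obtain \<delta> where \<delta>: "\<delta> > 0"
      "\<And>s. s \<in> M \<rightarrow> M \<Longrightarrow> (\<And>x. x \<in> M \<Longrightarrow> d x (s x) < \<delta>) \<Longrightarrow> induced s g = induced s \<one> \<Longrightarrow> g = \<one>"
      using induced_inj[OF gc one_closed] by blast
    obtain N where N: "1 / real (Suc N) < \<delta>" using \<delta>(1) reals_Archimedean by (auto simp: inverse_eq_divide)
    show ?thesis
    proof (rule sequential_limit_of_tame[OF g W])
      fix h s assume hA: "\<And>k. h k \<in> A" and s: "\<And>k. s k \<in> M \<rightarrow> M"
        "\<And>k x. x \<in> M \<Longrightarrow> d x (s k x) < 1 / real (Suc k)" "\<And>k. induced (s k) (h k) = induced (s k) g"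
      have "tame (\<lambda>k. ?W (h (k + N)))"
      proof (rule tameI[OF inverse_Suc_limit, of "letters u" _ 2 N])
        fix k x assume x: "x \<in> letters (?W (h (k + N)))"
        let ?w = "?W (h (k + N))" and ?s = "s (k + N)"
        have sd: "d y (?s y) < 1 / real (Suc (k + N))" if "y \<in> M" for y
          using s that by blast
        have sM: "?s \<in> M \<rightarrow> M" using s by blast
        have "1 / real (Suc (k + N)) \<le> 1 / real (Suc N)" by (simp add: frac_le)
        then have "d y (?s y) < \<delta>" if "y \<in> M" for y using sd[OF that] N by linarith
        then have "induced ?s g \<noteq> induced ?s \<one>" using \<delta>(2)[OF sM] False by blast
        moreover have "induced ?s \<one> = \<one>" using induced_val[OF sM, of "[]"] by simp
        ultimately have "val (map (apfst ?s) u) \<noteq> \<one>" using induced_val[OF sM u(1)] u(3) by simp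
        moreover have "letters (map (apfst ?s) u) \<subseteq> M"
          using u(1) sM by (auto simp: image_subset_iff Pi_iff)
        ultimately have "word_frag (map (apfst ?s) u) \<noteq> 0"
          using word_frag_short(2)[of "map (apfst ?s) u"] u(2) by auto
        moreover have frag: "word_frag (map (apfst ?s) ?w) = word_frag (map (apfst ?s) u)"
          using word_frag_eqI[OF sM W(1)[OF hA] u(1)] W(3)[OF hA] s(3) u(3) by simp
        ultimately have "letters (map (apfst ?s) ?w) \<subseteq> Poly_Mapping.keys (word_frag (map (apfst ?s) ?w))"
          using W(2)[OF hA] by (intro word_frag_short(1)) auto
        then have "letters (map (apfst ?s) ?w) \<subseteq> letters (map (apfst ?s) u)"
          using keys_word_frag[of "map (apfst ?s) u"] frag by auto
        moreover have "?s x \<in> letters (map (apfst ?s) ?w)" using x by force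
        ultimately obtain y where y: "y \<in> letters u" "?s x = ?s y" by force
        have "d x y < 2 * (1 / real (Suc (k + N)))"
          using x y u(1) W(1)[OF hA, of "k + N"] by (intro merged_dist[OF sM sd]) auto
        then show "(\<exists>y\<in>letters u. d x y < 2 / real (Suc (k + N))) \<or>
            clustering \<and> (\<exists>y\<in>M. y \<noteq> x \<and> d x y < 2 / real (Suc (k + N)))"
          using y(1) by auto
      qed (use u W(1)[OF hA] in auto)
      then show "\<exists>N. tame (\<lambda>k. ?W (h (k + N)))" by blast
    qed
  next
    case True
    \<comment> \<open>The pairs of distinct letters that have to be merged to make an element of
      \<open>A\<close> trivial. Whether both members of such pairs can accumulate at one point
      decides between the two cases that follow.\<close>
    define D where "D = {(a, b). a \<in> M \<and> b \<in> M \<and> a \<noteq> b \<and> (\<exists>c. val [(a, c), (b, \<not> c)] \<in> A)}"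
    show ?thesis
    proof (cases "\<one> \<in> A")
      case True
      then show ?thesis using sequential_limit_self \<open>g = \<one>\<close> by simp
    next
      case False
      show ?thesis
      proof (cases "\<exists>p\<in>M. \<forall>U. openin X U \<longrightarrow> p \<in> U \<longrightarrow> D \<inter> U \<times> U \<noteq> {}")
        case True
        then obtain p where p: "p \<in> M" "\<And>U. openin X U \<Longrightarrow> p \<in> U \<Longrightarrow> D \<inter> U \<times> U \<noteq> {}" by blast
        have "\<exists>a b. (a, b) \<in> D \<and> d p a < 1 / real (Suc k) \<and> d p b < 1 / real (Suc k)" for k
        proof -
          obtain U where "openin X U" "p \<in> U" "\<forall>y\<in>U. d p y < 1 / real (Suc k)"
            using ball_neighbourhood[OF p(1), of "1 / real (Suc k)"] by auto
          then show ?thesis using p(2) by blast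
        qed
        then obtain a b where ab: "\<And>k. (a k, b k) \<in> D" "\<And>k. d p (a k) < 1 / real (Suc k)"
          "\<And>k. d p (b k) < 1 / real (Suc k)" by metis
        have abM: "a k \<in> M" "b k \<in> M" for k using ab(1)[of k] by (auto simp: D_def)
        have "\<exists>c. val [(a k, c), (b k, \<not> c)] \<in> A" for k using ab(1)[of k] by (auto simp: D_def)
        then obtain c where c: "\<And>k. val [(a k, c k), (b k, \<not> c k)] \<in> A" by metis
        define w where "w k = [(a k, c k), (b k, \<not> c k)]" for k
        \<comment> \<open>Merging \<open>b k\<close> into \<open>a k\<close> makes the word trivial,
          and both letters tend to \<open>p\<close>.\<close>
        define s where "s k x = (if x = b k then a k else x)" for k x
        have sM: "s k \<in> M \<rightarrow> M" for k using abM by (auto simp: s_def)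
        have wM: "letters (w k) \<subseteq> M" for k using abM by (simp add: w_def)
        have one: "induced (s k) \<one> = \<one>" for k using induced_val[OF sM, of "[]"] by simp
        have "sequential_limit A \<one>"
        proof (rule convergent_subsequence[OF one_closed wM _ sM, where n = 2 and \<epsilon> = "\<lambda>k. 2 / real (Suc (k + 0))"])
          show "length (w k) \<le> 2" for k by (simp add: w_def)
          show "d x (s k x) < 2 / real (Suc (k + 0))" if "x \<in> M" for k x
            using that metric.triangle''[of "b k" p "a k"] ab(2)[of k] ab(3)[of k] abM[of k] p(1)
            by (auto simp: s_def)
          show "(\<lambda>k. 2 / real (Suc (k + 0))) \<longlonglongrightarrow> 0" by (rule inverse_Suc_limit)
          show "induced (s k) (val (w k)) = induced (s k) \<one>" for k
            unfolding one induced_val[OF sM wM] using e_closed abM[of k] by (simp add: w_def s_def)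
          have close: "d x p < 2 / real (Suc (k + 0))" if x: "x \<in> letters (w k)" for k x
          proof -
            have "d p x < 1 / real (Suc k)" using x ab(2,3) by (auto simp: w_def)
            also have "\<dots> \<le> 2 / real (Suc (k + 0))" by (simp add: divide_right_mono)
            finally show ?thesis by (simp add: metric.commute)
          qed
          show "tame w"
            by (rule tameI[OF inverse_Suc_limit, of "{p}" w 2 0]) (use close p wM in auto)
          fix r assume "limitin T (\<lambda>k. val (w (r k))) \<one> sequentially"
          then show "sequential_limit A \<one>"
            unfolding sequential_limit_def using c
            by (intro exI[of _ "\<lambda>k. val (w (r k))"]) (auto simp: w_def simp del: letters_prod.simps)
        qed
        then show ?thesis using \<open>g = \<one>\<close> by simp
      next
        case noP: False
        \<comment> \<open>Now a metric exists that keeps the members of each pair of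
          \<open>D\<close> at distance at least 1. Then no nontrivial word from \<open>A\<close>
          collapses under maps moving points by less than 1/2, which contradicts \<open>g\<close>
          being in the closure.\<close>
        have "metrizable_space X"
          using metric.metrizable_space_mtopology by (simp add: mtopology_d)
        moreover have "D \<subseteq> M \<times> M" by (auto simp: D_def)
        ultimately obtain \<rho> where \<rho>: "Metric_space M \<rho>" "Metric_space.mtopology M \<rho> = X"
          "\<And>a b. (a, b) \<in> D \<Longrightarrow> 1 \<le> \<rho> a b"
          by (rule metric_separating_pairs) (use noP in blast)+
        interpret rho: metric_free_topological_group P G e X T \<rho>
          by (rule metric_free_topological_groupI[OF free_topological_group_axioms \<rho>(1,2)])
        obtain U where U: "openin T U" "\<one> \<in> U"
          "\<forall>h\<in>U. \<exists>s\<in>M \<rightarrow> M. (\<forall>x\<in>M. \<rho> x (s x) < 1 / 2) \<and> induced s h = induced s \<one>"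
          using rho.induced_neighbourhood[OF one_closed, of "1/2"] by auto
        obtain h where h: "h \<in> A" "h \<in> U" using g U(1,2) \<open>g = \<one>\<close> unfolding in_closure_of by blast
        obtain s where s: "s \<in> M \<rightarrow> M" "\<And>x. x \<in> M \<Longrightarrow> \<rho> x (s x) < 1 / 2" "induced s h = induced s \<one>"
          using U(3) h(2) by blast
        have "word_frag (map (apfst s) (?W h)) = word_frag (map (apfst s) [])"
          using s(3) W[OF h(1)] by (intro word_frag_eqI[OF s(1)]) auto
        then have z: "word_frag (map (apfst s) (?W h)) = 0" by simp
        have "letters (map (apfst s) (?W h)) \<subseteq> M"
          using W(1)[OF h(1)] s(1) by (auto simp: image_subset_iff Pi_iff)
        then consider "map (apfst s) (?W h) = []" | c b where "map (apfst s) (?W h) = [(c, b), (c, \<not> b)]"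
          using word_frag_short(2)[OF _ z] W(2)[OF h(1)] by auto
        then show ?thesis
        proof cases
          case 1
          then have "h = \<one>" using W(3)[OF h(1)] by simp
          then show ?thesis using h(1) False by simp
        next
          case (2 c b)
          then obtain x y where xy: "?W h = [(x, b), (y, \<not> b)]" "s x = c" "s y = c"
            by (auto simp: map_eq_Cons_conv apfst_def map_prod_def split: prod.splits)
          then have M: "x \<in> M" "y \<in> M" using W(1)[OF h(1)] by auto
          have "x \<noteq> y"
          proof
            assume "x = y"
            then have "h = \<one>" using W(3)[OF h(1)] xy(1) e_closed[OF M(1)] by auto
            then show False using h(1) False by simp
          qed
          then have "(x, y) \<in> D" using M W(3)[OF h(1)] xy(1) h(1) by (auto simp: D_def simp del: letters_prod.simps)
          then have "1 \<le> \<rho> x y" by (rule \<rho>(3))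
          moreover have "\<rho> x y < 2 * (1 / 2)"
            using rho.merged_dist[OF s(1,2) M] xy by simp
          ultimately show ?thesis by simp
        qed
      qed
    qed
  qed
qed

end

context free_topological_group
begin

text \<open>For discrete \<open>X\<close> the constant sequence \<open>{\<one>}\<close> is an
  admissible system of neighbourhoods, so \<open>T\<close> is discrete.\<close>

lemma closure_of_discrete:
  assumes "X = discrete_topology M" "g \<in> T closure_of A"
  shows "g \<in> A"
proof -
  have g: "g \<in> carrier G" using assms(2) topspace_T by (auto simp: in_closure_of)
  have "\<exists>U. openin T U \<and> g \<in> U \<and> (\<forall>h\<in>U. \<exists>u\<in>{\<one>}. h = g \<otimes> u)"
  proof (rule neighbourhood[of "\<lambda>_. {\<one>}"])
    show "\<exists>U. openin X U \<and> x \<in> U \<and> (\<forall>y\<in>U. inv (e x) \<otimes> e y \<in> {\<one>})" if "x \<in> M" for x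
    proof (intro exI conjI)
      show "openin X {x}" using that by (subst assms(1)) simp
    qed (use that e_closed in auto)
  qed (use g in auto)
  then obtain U where "openin T U" "g \<in> U" "U \<subseteq> {g}" using g by auto
  then show ?thesis using assms(2) unfolding in_closure_of by blast
qed

end

section \<open>Words of length four\<close>

lemma foldr_push_trivial:
  "foldr push_letter u [] = [] \<Longrightarrow> reduced_word w \<Longrightarrow> foldr push_letter u w = w"
  using foldr_push_assoc[of w u "[]"] by simp

text \<open>The first letter of the reduced form is an actual occurrence in the word, and all that
  precedes it has cancelled out on its own.\<close>

lemma reduction_head:
  "foldr push_letter v [] = b # r \<Longrightarrow>
    \<exists>v1 v2. v = v1 @ b # v2 \<and> foldr push_letter v1 [] = [] \<and> foldr push_letter v2 [] = r"
proof (induction "length v" arbitrary: v b r rule: less_induct)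
  case less
  then obtain a v' where v: "v = a # v'" by (cases v) auto
  let ?r' = "foldr push_letter v' []"
  show ?case
  proof (cases "push_letter a ?r' = a # ?r'")
    case True
    then have "v = [] @ b # v'" "?r' = r" using less.prems v by auto
    then show ?thesis by fastforce
  next
    case False
    \<comment> \<open>Here \<open>a\<close> cancels against the head of the reduced rest. Peeling
      off \<open>inv_letter a\<close> and then \<open>b\<close> takes two uses of the induction
      hypothesis, the second for a proper suffix, hence the induction on length.\<close>
    then have r': "?r' = inv_letter a # b # r" using less.prems v by (cases ?r') (auto split: if_splits)
    obtain v1 v2 where v12: "v' = v1 @ inv_letter a # v2" "foldr push_letter v1 [] = []" "foldr push_letter v2 [] = b # r"
      using less.hyps[OF _ r'] v by auto
    obtain v3 v4 where v34: "v2 = v3 @ b # v4" "foldr push_letter v3 [] = []" "foldr push_letter v4 [] = r"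
      using less.hyps[OF _ v12(3)] v v12(1) by auto
    have "foldr push_letter (a # v1 @ inv_letter a # v3) [] = []"
      using foldr_push_trivial[OF v12(2), of "[inv_letter a]"] v34(2) by (simp add: reduced_word_Cons)
    moreover have "v = (a # v1 @ inv_letter a # v3) @ b # v4" using v v12(1) v34(1) by simp
    ultimately show ?thesis using v34(3) by blast
  qed
qed

text \<open>A letter vanishes only by meeting its inverse, and at that moment everything between the
  two has already cancelled.\<close>

lemma cancelled_letter:
  "x \<in> letters v \<Longrightarrow> x \<notin> letters (foldr push_letter v []) \<Longrightarrow>
    \<exists>v1 c v2 v3. v = v1 @ (x, c) # v2 @ (x, \<not> c) # v3 \<and> foldr push_letter v2 [] = []"
proof (induction v)
  case (Cons a v)
  let ?r = "foldr push_letter v []"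
  show ?case
  proof (cases "x \<in> letters v \<and> x \<notin> letters ?r")
    case True
    then obtain v1 c v2 v3 where "v = v1 @ (x, c) # v2 @ (x, \<not> c) # v3" "foldr push_letter v2 [] = []"
      using Cons.IH by blast
    then show ?thesis by (intro exI[of _ "a # v1"] exI[of _ c] exI[of _ v2] exI[of _ v3]) simp
  next
    case False
    then have "push_letter a ?r \<noteq> a # ?r" using Cons.prems by auto
    then obtain r where r: "?r = inv_letter a # r" by (cases ?r) (auto split: if_splits)
    then have "fst a = x" using Cons.prems False by auto
    then obtain c where a: "a = (x, c)" by (cases a) auto
    obtain v1 v2 where "v = v1 @ inv_letter a # v2" "foldr push_letter v1 [] = []"
      using reduction_head[OF r] by blast
    then show ?thesis
      by (intro exI[of _ "[]"] exI[of _ c] exI[of _ v1] exI[of _ v2]) (simp add: a inv_letter_def)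
  qed
qed simp

text \<open>The pair \<open>(a, b)\<close> is the affine map that sends a real function
  \<open>v\<close> to \<open>a v + b\<close>, and multiplication is composition.\<close>

definition affine_group :: "(real \<times> ('a \<Rightarrow> real)) monoid" where
  "affine_group = \<lparr>carrier = {p. 0 < fst p},
     monoid.mult = (\<lambda>p q. (fst p * fst q, \<lambda>z. snd p z + fst p * snd q z)), one = (1, \<lambda>z. 0)\<rparr>"

lemma affine_group_simps [simp]:
  "p \<in> carrier affine_group \<longleftrightarrow> 0 < fst p"
  "p \<otimes>\<^bsub>affine_group\<^esub> q = (fst p * fst q, \<lambda>z. snd p z + fst p * snd q z)"
  "\<one>\<^bsub>affine_group\<^esub> = (1, \<lambda>z. 0)"
  by (simp_all add: affine_group_def)

lemma group_affine_group: "group affine_group"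
proof (rule groupI)
  fix p :: "real \<times> ('a \<Rightarrow> real)" assume "p \<in> carrier affine_group"
  then show "\<exists>q\<in>carrier affine_group. q \<otimes>\<^bsub>affine_group\<^esub> p = \<one>\<^bsub>affine_group\<^esub>"
    by (intro bexI[of _ "(1 / fst p, \<lambda>z. - snd p z / fst p)"]) auto
qed (auto simp: algebra_simps)

lemma inv_affine_group:
  "0 < fst p \<Longrightarrow> inv\<^bsub>affine_group\<^esub> p = (1 / fst p, \<lambda>z. - snd p z / fst p)"
  by (rule group.inv_equality[OF group_affine_group]) auto

section \<open>Neighbourhoods that are not invariant under conjugation\<close>

context metric_free_topological_group
begin

definition near :: "real \<Rightarrow> 'a \<Rightarrow> bool" where
  "near \<eta> x \<longleftrightarrow> (\<exists>y\<in>M. y \<noteq> x \<and> d x y < \<eta>)"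

text \<open>The points that are not \<open>near \<eta>\<close> form a closed discrete set, on which the dilation factors
  \<open>\<mu>\<close> may be prescribed arbitrarily.\<close>

lemma affine_neighbourhood:
  assumes \<mu>: "\<And>x. x \<in> M \<Longrightarrow> 0 < \<mu> x" "\<And>x. x \<in> M \<Longrightarrow> near \<eta> x \<Longrightarrow> \<mu> x = 1" and \<eta>: "\<eta> > 0"
    and hom: "h \<in> hom G affine_group" and he: "\<And>x. x \<in> M \<Longrightarrow> h (e x) = (\<mu> x, \<lambda>z. d x z)"
    and g: "g \<in> carrier G" and c: "c > 0"
  shows "\<exists>U. openin T U \<and> g \<in> U \<and> (\<forall>f\<in>U. \<forall>z\<in>M. \<bar>snd (h (inv g \<otimes> f)) z\<bar> < c)"
proof -
  interpret h: group_hom G affine_group h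
    using hom group_affine_group by (simp add: group_hom_def group_hom_axioms_def)
  have pos: "0 < fst (h f)" if "f \<in> carrier G" for f using h.hom_closed[OF that] by simp
  \<comment> \<open>The dilation is exactly 1 and the translation uniformly small. Conjugation by
    \<open>f\<close> multiplies the translation by the dilation factor of \<open>f\<close>, so the
    \<open>k'\<close> found below depends on \<open>f\<close>.\<close>
  define V where "V k = {f \<in> carrier G. fst (h f) = 1 \<and> (\<forall>z\<in>M. \<bar>snd (h f) z\<bar> < (1/2)^k)}" for k :: nat
  obtain k where k: "(1/2::real)^k < c" using real_arch_pow_inv[OF c, of "1/2"] by auto
  have "\<exists>U. openin T U \<and> g \<in> U \<and> (\<forall>f\<in>U. \<exists>u\<in>V k. f = g \<otimes> u)"
  proof (rule neighbourhood[OF _ _ _ _ _ _ g])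
    show "V k \<subseteq> carrier G" for k by (auto simp: V_def)
    show "\<one> \<in> V k" for k using h.hom_one by (simp add: V_def)
    show "u \<otimes> v \<in> V k" if uv: "u \<in> V (Suc k)" "v \<in> V (Suc k)" for u v k
    proof -
      have "\<bar>snd (h u) z + snd (h v) z\<bar> < (1/2)^k" if "z \<in> M" for z
      proof -
        have "\<bar>snd (h u) z\<bar> < (1/2)^Suc k" "\<bar>snd (h v) z\<bar> < (1/2)^Suc k"
          using uv that by (auto simp only: V_def mem_Collect_eq)
        then show ?thesis by simp
      qed
      then show ?thesis using uv by (simp add: V_def)
    qed
    show "inv u \<in> V k" if "u \<in> V k" for u k
      using that by (simp add: V_def inv_affine_group)
    show "\<exists>k'. \<forall>u\<in>V k'. f \<otimes> u \<otimes> inv f \<in> V k" if f: "f \<in> carrier G" for f k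
    proof -
      obtain k' where k': "(1/2::real)^k' < (1/2)^k / fst (h f)"
        using real_arch_pow_inv[of "(1/2)^k / fst (h f)" "1/2"] pos[OF f] by auto
      have "f \<otimes> u \<otimes> inv f \<in> V k" if u: "u \<in> V k'" for u
      proof -
        have uc: "u \<in> carrier G" "fst (h u) = 1" using u by (auto simp: V_def)
        have "h (f \<otimes> u \<otimes> inv f) = (1, \<lambda>z. fst (h f) * snd (h u) z)"
          using f uc pos[OF f] by (auto simp: inv_affine_group)
        moreover have "\<bar>fst (h f) * snd (h u) z\<bar> < (1/2)^k" if "z \<in> M" for z
        proof -
          have "\<bar>snd (h u) z\<bar> < (1/2)^k / fst (h f)" using u that k' by (force simp: V_def)
          then show ?thesis using pos[OF f] by (simp add: abs_mult pos_less_divide_eq mult.commute)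
        qed
        ultimately show ?thesis using f uc by (simp add: V_def)
      qed
      then show ?thesis by blast
    qed
    show "\<exists>U. openin X U \<and> x \<in> U \<and> (\<forall>y\<in>U. inv (e x) \<otimes> e y \<in> V k)" if x: "x \<in> M" for x k
    proof -
      obtain U where U: "openin X U" "x \<in> U" "\<forall>y\<in>U. d x y < min \<eta> ((1/2)^k * \<mu> x)"
        using ball_neighbourhood[OF x, of "min \<eta> ((1/2)^k * \<mu> x)"] \<eta> \<mu>(1)[OF x] by auto
      have "inv (e x) \<otimes> e y \<in> V k" if "y \<in> U" for y
      proof -
        have y: "y \<in> M" using U(1) that openin_subset by blast
        have dxy: "d x y < \<eta>" "d x y < (1/2)^k * \<mu> x" using U(3) that by auto
        \<comment> \<open>Distinct points closer than \<open>\<eta>\<close> are both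
          \<open>near \<eta>\<close>, where the factor is 1.\<close>
        have \<mu>xy: "\<mu> x = \<mu> y"
        proof (cases "x = y")
          case False
          then have "near \<eta> x" "near \<eta> y" using dxy x y metric.commute unfolding near_def by metis+
          then show ?thesis using \<mu>(2) x y by simp
        qed simp
        have "h (inv (e x) \<otimes> e y) = (1, \<lambda>z. (d y z - d x z) / \<mu> x)"
          using x y e_closed he \<mu>(1)[OF x] \<mu>xy by (auto simp: inv_affine_group diff_divide_distrib)
        moreover have "\<bar>(d y z - d x z) / \<mu> x\<bar> < (1/2)^k" if "z \<in> M" for z
        proof -
          have "\<bar>d y z - d x z\<bar> \<le> d x y"
            using metric.mdist_reverse_triangle[OF y that x] by (simp add: metric.commute)
          then show ?thesis using dxy(2) \<mu>(1)[OF x] by (simp add: abs_divide pos_divide_less_eq)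
        qed
        ultimately show ?thesis using x y e_closed by (simp add: V_def)
      qed
      then show ?thesis using U by blast
    qed
  qed
  then obtain U where U: "openin T U" "g \<in> U" "\<forall>f\<in>U. \<exists>u\<in>V k. f = g \<otimes> u" by blast
  have "\<bar>snd (h (inv g \<otimes> f)) z\<bar> < c" if f: "f \<in> U" "z \<in> M" for f z
  proof -
    obtain u where u: "u \<in> V k" "f = g \<otimes> u" using U(3) f(1) by blast
    then have "inv g \<otimes> f = u" using g by (simp add: V_def m_assoc[symmetric])
    then show ?thesis using u(1) f(2) k by (force simp: V_def)
  qed
  then show ?thesis using U by blast
qed

end

section \<open>Words of length four in the free group\<close>

locale metric_free_group =
  metric_free_topological_group group "free_group (topspace X)" free_gen X "free_topology X" d
  for X :: "'a topology" and d
begin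

abbreviation F where "F \<equiv> free_group M"

text \<open>The translation parts are the distance functions, as in the Kuratowski embedding:
  \<open>d y\<close> and \<open>d x\<close> differ by at most \<open>d x y\<close>, so the factors
  \<open>\<mu>\<close> may vary while closeness of letters is still measured by
  \<open>d\<close>.\<close>

lemma affine_hom:
  assumes "\<And>x. x \<in> M \<Longrightarrow> 0 < \<mu> x"
  obtains h where "h \<in> hom F affine_group" "\<And>x. x \<in> M \<Longrightarrow> h (free_gen x) = (\<mu> x, \<lambda>z. d x z)"
  using free_group_hom_exists[OF group_affine_group, of M "\<lambda>x. (\<mu> x, \<lambda>z. d x z)"] assms by auto

lemma short_elements_eq: "short_elements n = {w \<in> carrier F. length w \<le> n}"
proof -
  have "metrizable_space X" using metric.metrizable_space_mtopology by (simp add: mtopology_d)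
  from short_elements_free_group[OF this] show ?thesis .
qed

lemma val_reduced: "w \<in> carrier F \<Longrightarrow> letters w \<subseteq> M \<and> val w = w"
  by (auto simp: carrier_free_group letters_prod_reduced)

lemma induced_word:
  assumes "s \<in> M \<rightarrow> M" "w \<in> carrier F"
  shows "induced s w = foldr push_letter (map (apfst s) w) []"
proof -
  have "letters (map (apfst s) w) \<subseteq> M"
    using val_reduced[OF assms(2)] assms(1) by (auto simp: image_subset_iff Pi_iff)
  then show ?thesis
    using induced_val[OF assms(1), of w] val_reduced[OF assms(2)] letters_prod_free_group by metis
qed

definition nested_word :: "bool \<Rightarrow> 'a \<Rightarrow> 'a \<Rightarrow> 'a \<Rightarrow> bool \<Rightarrow> 'a word" where
  "nested_word c x y z c' = [(x, c), (y, c'), (z, \<not> c'), (x, \<not> c)]"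

text \<open>Since nothing else is merged with \<open>x\<close>, its image can cancel only against
  another occurrence of \<open>x\<close> itself. What stands between the two is nonempty, because
  \<open>w\<close> is reduced, and yet collapses, so it has at least two letters; length four leaves
  no room for more.\<close>

lemma unmerged_letter:
  assumes w: "reduced_word w" "length w \<le> 4" "x \<in> letters w"
    and s: "\<And>y. y \<in> letters w \<Longrightarrow> s y = s x \<Longrightarrow> y = x"
    and gone: "s x \<notin> letters (foldr push_letter (map (apfst s) w) [])"
  shows "\<exists>c x y z c'. w = nested_word c x y z c' \<and> y \<noteq> z"
    and "foldr push_letter (map (apfst s) w) [] = []"
proof -
  have "s x \<in> letters (map (apfst s) w)" using w(3) by force
  then obtain v1 c v2 v3 where v: "map (apfst s) w = v1 @ (s x, c) # v2 @ (s x, \<not> c) # v3"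
    "foldr push_letter v2 [] = []"
    using cancelled_letter gone by metis
  have split: "\<exists>u1 p u2. u = u1 @ p # u2 \<and> map (apfst s) u1 = a1 \<and> apfst s p = b \<and> map (apfst s) u2 = a2"
    if u: "map (apfst s) u = a1 @ b # a2" for u a1 b a2
  proof -
    obtain u1 r where u1: "u = u1 @ r" "map (apfst s) u1 = a1" "map (apfst s) r = b # a2"
      using u by (auto simp: map_eq_append_conv)
    then obtain p u2 where "r = p # u2" by (cases r) auto
    then show ?thesis using u1 by (intro exI[of _ u1] exI[of _ p] exI[of _ u2]) simp
  qed
  obtain w1 p r where w1: "w = w1 @ p # r" "apfst s p = (s x, c)"
    "map (apfst s) r = v2 @ (s x, \<not> c) # v3"
    using split[OF v(1)] by blast
  obtain w2 q w3 where w2: "r = w2 @ q # w3" "map (apfst s) w2 = v2" "apfst s q = (s x, \<not> c)"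
    using split[OF w1(3)] by blast
  note w' = w1(1)[unfolded w2(1)] w2(2) w1(2) w2(3)
  have "fst p = x" "fst q = x" using w' s[of "fst p"] s[of "fst q"] by (cases p, cases q, auto)+
  then have pq: "p = (x, c)" "q = (x, \<not> c)" using w'(3,4) by (cases p, cases q, auto)+
  have red: "reduced_word (p # w2 @ q # w3)"
    using w(1) unfolding w'(1) reduced_word_def by (simp add: successively_append_iff)
  then have ne: "w2 \<noteq> []" by (auto simp: reduced_word_Cons pq inv_letter_def)
  have "length w1 + length w2 + length w3 \<le> 2" using w(2) w'(1) by simp
  moreover have "length w2 \<noteq> 1" using v(2) w'(2) by (auto simp: length_Suc_conv)
  moreover have "length w2 \<noteq> 0" using ne by simp
  ultimately have "length w2 = 2" "length w1 = 0" "length w3 = 0" by linarith+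
  then have nil: "w1 = []" "w3 = []" by simp_all
  from \<open>length w2 = 2\<close> obtain y b z b' where w2: "w2 = [(y, b), (z, b')]"
    by (auto simp: length_Suc_conv numeral_2_eq_2)
  have zb: "s z = s y" "b' = (\<not> b)"
    using v(2) w'(2) by (auto simp: w2 inv_letter_def split: if_splits)
  have "y \<noteq> z" using red by (auto simp: w2 reduced_word_Cons inv_letter_def zb)
  moreover have w_eq: "w = nested_word c x y z b"
    using w'(1) nil by (simp add: w2 pq zb nested_word_def)
  ultimately show "\<exists>c x y z c'. w = nested_word c x y z c' \<and> y \<noteq> z" by blast
  show "foldr push_letter (map (apfst s) w) [] = []"
    unfolding w_eq by (simp add: nested_word_def zb inv_letter_def)
qed

text \<open>The outer exponent \<open>c\<close> is fixed because it decides whether a large or a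
  small factor at \<open>x\<close> stretches the inner pair; with both signs present one factor
  could not serve all words with outer letter \<open>x\<close>.\<close>

lemma frechet_urysohn_nested:
  assumes clustering
    and B: "B \<subseteq> {nested_word c x y z c' | x y z c'. y \<noteq> z}" "B \<subseteq> carrier F" and cl: "[] \<in> free_topology X closure_of B"
  shows "sequential_limit B []"
proof (rule ccontr)
  assume nolim: "\<not> sequential_limit B []"
  have nil: "val [] = []" "[] \<in> carrier F" by (simp_all add: one_free_group carrier_free_group)
  have BM: "x \<in> M" "y \<in> M" "z \<in> M" if "nested_word c x y z c' \<in> B" for x y z c'
    using that B(2) by (auto simp: carrier_free_group nested_word_def)
  have Bne: "y \<noteq> z" if "nested_word c x y z c' \<in> B" for x y z c'
    using that B(1) by (auto simp: nested_word_def)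
  \<comment> \<open>If this failed, there would be words with outer letters that equal
    \<open>x0\<close> or are ever closer to other points, and with \<open>d y z\<close> tending to
    0. Such words are tame and collapse when \<open>z\<close> is merged into \<open>y\<close>, so a
    subsequence would converge to the empty word.\<close>
  have gap: "\<exists>\<eta>>0. \<forall>x y z c'. nested_word c x y z c' \<in> B \<longrightarrow> x = x0 \<or> near \<eta> x \<longrightarrow> \<eta> \<le> d y z" if x0: "x0 \<in> M" for x0
  proof (rule ccontr)
    assume *: "\<not> ?thesis"
    have "\<exists>x y z c'. nested_word c x y z c' \<in> B \<and> (x = x0 \<or> near (1 / real (Suc k)) x) \<and> d y z < 1 / real (Suc k)" for k
    proof -
      have "0 < 1 / real (Suc k)" by simp
      with * show ?thesis by (meson not_le)
    qed
    then obtain x y z c' where xyz: "\<And>k. nested_word c (x k) (y k) (z k) (c' k) \<in> B"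
      "\<And>k. x k = x0 \<or> near (1 / real (Suc k)) (x k)" "\<And>k. d (y k) (z k) < 1 / real (Suc k)"
      by metis
    define w where "w k = nested_word c (x k) (y k) (z k) (c' k)" for k
    define s where "s k p = (if p = z k then y k else p)" for k p
    have xM: "x k \<in> M" "y k \<in> M" "z k \<in> M" for k using BM[OF xyz(1)] by auto
    have wB: "w k \<in> B" "w k \<in> carrier F" for k using xyz(1) B(2) by (auto simp: w_def)
    have wM: "letters (w k) \<subseteq> M" and wval: "val (w k) = w k" for k using val_reduced[OF wB(2)] by auto
    have sM: "s k \<in> M \<rightarrow> M" for k using xM by (auto simp: s_def)
    have ls: "1 / real (Suc k) < 2 / real (Suc (k + 0))" for k by (simp add: divide_strict_right_mono)
    show False
    proof (rule convergent_subsequence[OF nil(2) wM _ sM, where n = 4 and \<epsilon> = "\<lambda>k. 2 / real (Suc (k + 0))"])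
      show "length (w k) \<le> 4" for k by (simp add: w_def nested_word_def)
      show "d p (s k p) < 2 / real (Suc (k + 0))" if "p \<in> M" for k p
        using that xyz(3)[of k] ls[of k] by (auto simp: s_def metric.commute)
      show "(\<lambda>k. 2 / real (Suc (k + 0))) \<longlonglongrightarrow> 0" by (rule inverse_Suc_limit)
      show "induced (s k) (val (w k)) = induced (s k) []" for k
        unfolding wval induced_word[OF sM wB(2)] induced_word[OF sM nil(2)]
        by (simp add: w_def nested_word_def s_def inv_letter_def)
      show "tame w"
      proof (rule tameI[OF inverse_Suc_limit, of "{x0}" w 2 0])
        fix k p assume p: "p \<in> letters (w k)"
        have yz: "y k \<noteq> z k" using Bne[OF xyz(1)] .
        have "near (2 / real (Suc (k + 0))) p" if "p = y k \<or> p = z k"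
          using that yz xM[of k] xyz(3)[of k] ls[of k] metric.commute[of "y k" "z k"] unfolding near_def by force
        moreover have "near (2 / real (Suc (k + 0))) p" if "near (1 / real (Suc k)) p"
          using that ls[of k] unfolding near_def by (meson less_trans)
        ultimately have "p = x0 \<or> near (2 / real (Suc (k + 0))) p"
          using p xyz(2)[of k] by (auto simp: w_def nested_word_def)
        then show "(\<exists>y\<in>{x0}. d p y < 2 / real (Suc (k + 0))) \<or>
            clustering \<and> (\<exists>y\<in>M. y \<noteq> p \<and> d p y < 2 / real (Suc (k + 0)))"
          using x0 \<open>clustering\<close> by (auto simp: near_def)
      qed (use x0 wM in auto)
      fix r assume "limitin (free_topology X) (\<lambda>k. val (w (r k))) [] sequentially"
      then have "sequential_limit B []"
        unfolding sequential_limit_def using wB(1) wval by (intro exI[of _ "\<lambda>k. w (r k)"]) auto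
      then show False using nolim by simp
    qed
  qed
  obtain w0 where "w0 \<in> B" using cl unfolding in_closure_of by (metis openin_topspace)
  \<comment> \<open>Any point will do: \<open>\<eta> x0\<close> serves as one threshold for all
    outer letters that are \<open>near (\<eta> x0)\<close>.\<close>
  then obtain x0 where x0: "x0 \<in> M" using B BM by blast
  have "\<forall>x0\<in>M. \<exists>\<eta>. \<eta> > 0 \<and> (\<forall>x y z c'. nested_word c x y z c' \<in> B \<longrightarrow> x = x0 \<or> near \<eta> x \<longrightarrow> \<eta> \<le> d y z)"
    using gap by blast
  from bchoice[OF this] obtain \<eta> where
    \<eta>': "\<forall>x0\<in>M. \<eta> x0 > 0 \<and> (\<forall>x y z c'. nested_word c x y z c' \<in> B \<longrightarrow> x = x0 \<or> near (\<eta> x0) x \<longrightarrow> \<eta> x0 \<le> d y z)" ..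
  have \<eta>: "\<eta> x > 0" if "x \<in> M" for x using \<eta>' that by blast
  have \<eta>_same: "\<eta> x \<le> d y z" if "nested_word c x y z c' \<in> B" for x y z c'
    using \<eta>' that BM(1)[OF that] by blast
  have \<eta>_near: "\<eta> x0 \<le> d y z" if "nested_word c x y z c' \<in> B" "near (\<eta> x0) x" for x y z c'
    using \<eta>' x0 that by blast
  txt \<open>Dilating by \<open>1 / \<eta> x\<close> makes the translation part of each word of \<open>B\<close> with outer letter
    \<open>x\<close> too long for a neighbourhood of the identity.\<close>
  define \<mu> where "\<mu> x = (if near (\<eta> x0) x then 1 else if c then 1 / \<eta> x else \<eta> x)" for x
  have \<mu>: "0 < \<mu> x" if "x \<in> M" for x using \<eta>[OF that] by (simp add: \<mu>_def)
  obtain h where h: "h \<in> hom F affine_group" "\<And>x. x \<in> M \<Longrightarrow> h (free_gen x) = (\<mu> x, \<lambda>z. d x z)"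
    using affine_hom[of \<mu>] \<mu> by blast
  obtain U where U: "openin (free_topology X) U" "[] \<in> U"
    "\<And>f z. f \<in> U \<Longrightarrow> z \<in> M \<Longrightarrow> \<bar>snd (h (inv\<^bsub>F\<^esub> [] \<otimes>\<^bsub>F\<^esub> f)) z\<bar> < 1"
    using affine_neighbourhood[OF \<mu> _ \<eta>[OF x0] h nil(2), of 1] by (auto simp: \<mu>_def)
  \<comment> \<open>Graev's neighbourhood forces \<open>d y z < \<eta> x0\<close>. Hence
    \<open>y\<close> and \<open>z\<close> are \<open>near (\<eta> x0)\<close> and have factor 1,
    whereas by \<open>gap\<close> the outer letter \<open>x\<close> is not, so its factor is the
    prescribed one.\<close>
  obtain U' where U': "openin (free_topology X) U'" "[] \<in> U'"
    "\<And>f. f \<in> U' \<Longrightarrow> \<exists>s\<in>M \<rightarrow> M. (\<forall>x\<in>M. d x (s x) < \<eta> x0 / 2) \<and> induced s f = induced s []"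
    using induced_neighbourhood[OF nil(2), of "\<eta> x0 / 2"] \<eta>[OF x0] by auto
  have "openin (free_topology X) (U \<inter> U')" "[] \<in> U \<inter> U'" using U U' by auto
  then obtain w where w: "w \<in> B" "w \<in> U" "w \<in> U'" using cl unfolding in_closure_of by blast
  obtain x y z c' where xyz: "w = nested_word c x y z c'" "y \<noteq> z" using w(1) B(1) by blast
  have M: "x \<in> M" "y \<in> M" "z \<in> M" using BM w(1) xyz(1) by auto
  have wF: "w \<in> carrier F" using w(1) B(2) by blast
  obtain s where s: "s \<in> M \<rightarrow> M" "\<And>x. x \<in> M \<Longrightarrow> d x (s x) < \<eta> x0 / 2" "induced s w = induced s []"
    using U'(3)[OF w(3)] by blast
  have "word_frag (map (apfst s) w) = word_frag (map (apfst s) [])"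
    using val_reduced[OF wF] s(3) nil(1) by (intro word_frag_eqI[OF s(1)]) auto
  then have "s y = s z" by (auto simp: xyz nested_word_def frag_of_eq split: if_splits)
  then have dyz: "d y z < \<eta> x0" using merged_dist[OF s(1,2) M(2,3)] by simp
  then have near_yz: "near (\<eta> x0) y" "near (\<eta> x0) z"
    using xyz(2) M metric.commute[of y z] unfolding near_def by auto
  have far_x: "\<not> near (\<eta> x0) x" using \<eta>_near w(1) xyz(1) dyz by force
  have "inv\<^bsub>F\<^esub> [] \<otimes>\<^bsub>F\<^esub> w = w"
    using wF inv_one l_one by (simp add: one_free_group)
  then have "\<bar>snd (h w) z\<bar> < 1" using U(3)[OF w(2) M(3)] by simp
  moreover have "h w = letters_prod affine_group (h \<circ> free_gen) w"
    using hom_letters_prod[OF is_group group_affine_group h(1), of free_gen w] val_reduced[OF wF] e_closed by auto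
  \<comment> \<open>The inner pair acts as translation by \<open>d y - d z\<close> or its negative,
    conjugation by \<open>x\<close> or its inverse rescales it, and evaluation at \<open>z\<close>
    leaves \<open>d y z\<close>. For either value of \<open>c\<close> the choice of
    \<open>\<mu>\<close> turns this into \<open>d y z / \<eta> x\<close>, which is at least
    1.\<close>
  then have "snd (h w) z = (if c' then 1 else -1) * (if c then \<mu> x else 1 / \<mu> x) * d y z"
    using M h(2) near_yz \<mu>[OF M(1)]
    by (auto simp: xyz nested_word_def inv_affine_group \<mu>_def[of y] \<mu>_def[of z] field_simps)
  then have "snd (h w) z = (if c' then 1 else -1) * (d y z / \<eta> x)"
    using far_x by (simp add: \<mu>_def)
  ultimately have "d y z / \<eta> x < 1" using \<eta>[OF M(1)] by (auto split: if_splits)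
  then show False using \<eta>_same w(1) xyz(1) \<eta>[OF M(1)] by (force simp: pos_divide_less_eq)
qed

text \<open>A letter escapes merging only in a nested word with trivial image. For \<open>g\<close>
  other than the empty word, small displacements keep the image of \<open>g\<close> nontrivial, so
  no such letter arises; for the empty word the nested elements of \<open>A\<close> are treated
  separately.\<close>

lemma frechet_urysohn_short_elements_4:
  assumes clustering
  shows "frechet_urysohn_space (subtopology (free_topology X) (short_elements 4))"
proof (rule frechet_urysohn_short_elementsI)
  fix A g assume A: "A \<subseteq> short_elements 4" "g \<in> short_elements 4" and g: "g \<in> free_topology X closure_of A"
  have Ac: "w \<in> carrier F" "length w \<le> 4" "reduced_word w" "letters w \<subseteq> M" "val w = w" if "w \<in> A" for w
    using that A(1) val_reduced[of w] by (auto simp: short_elements_eq carrier_free_group)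
  have gc: "g \<in> carrier F" using A(2) short_elements_subset by auto
  have u: "letters g \<subseteq> M" "g = val g" using val_reduced[OF gc] by auto
  have star_g: "letters (induced s g) \<subseteq> s ` letters g" if "s \<in> M \<rightarrow> M" for s
    using set_foldr[of "map (apfst s) g" "[]"] unfolding induced_word[OF that gc] by (auto simp: image_image)
  define nested where "nested w \<longleftrightarrow> (\<exists>c x y z c'. w = nested_word c x y z c' \<and> y \<noteq> z)" for w :: "'a word"
  have unmerged: "nested w \<and> induced s w = []" if "w \<in> A" "s \<in> M \<rightarrow> M" "induced s w = induced s g" "x \<in> letters w"
    "\<not> (s x \<in> s ` letters g \<or> (\<exists>y\<in>letters w. y \<noteq> x \<and> s y = s x))" for w s x
  proof -
    have iw: "induced s w = foldr push_letter (map (apfst s) w) []"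
      by (rule induced_word[OF that(2) Ac(1)[OF that(1)]])
    have "s x \<notin> letters (induced s g)" using that(5) star_g[OF that(2)] by blast
    then have gone: "s x \<notin> letters (foldr push_letter (map (apfst s) w) [])"
      by (simp add: iw[symmetric] that(3))
    have same: "y = x" if "y \<in> letters w" "s y = s x" for y
      using \<open>\<not> (s x \<in> s ` letters g \<or> (\<exists>y\<in>letters w. y \<noteq> x \<and> s y = s x))\<close> that by blast
    show ?thesis
      using unmerged_letter[OF Ac(3,2)[OF that(1)] that(4) same gone] unfolding nested_def iw by blast
  qed
  show "sequential_limit A g"
  proof (cases "g = []")
    case False
    have nil: "[] \<in> carrier F" by (simp add: carrier_free_group)
    obtain \<delta> where \<delta>: "\<delta> > 0" "\<And>s. s \<in> M \<rightarrow> M \<Longrightarrow> (\<And>x. x \<in> M \<Longrightarrow> d x (s x) < \<delta>) \<Longrightarrow> induced s g = induced s [] \<Longrightarrow> g = []"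
      using induced_inj[OF gc nil] by blast
    show ?thesis
    proof (rule sequential_limit_clustering[OF g \<open>clustering\<close>, of "\<lambda>w. w", OF Ac(4,2,5) u \<delta>(1)])
      fix w s x assume *: "w \<in> A" "s \<in> M \<rightarrow> M" "\<And>y. y \<in> M \<Longrightarrow> d y (s y) < \<delta>" "induced s w = induced s g" "x \<in> letters w"
      have "induced s [] = []" using induced_word[OF *(2) nil] by simp
      then have "induced s w \<noteq> []" using \<delta>(2)[OF *(2,3)] False *(4) by auto
      then show "s x \<in> s ` letters g \<or> (\<exists>y\<in>letters w. y \<noteq> x \<and> s y = s x)"
        using unmerged[OF *(1,2,4,5)] by blast
    qed
  next
    case True
    \<comment> \<open>Closure commutes with finite unions, so \<open>g\<close> is in the closure of
      one of three parts of \<open>A\<close>: not nested, or nested with one of the two outer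
      exponents.\<close>
    define B where "B c = {w \<in> A. \<exists>x y z c'. w = nested_word c x y z c' \<and> y \<noteq> z}" for c
    have "w \<in> B True \<union> B False" if w: "w \<in> A" "nested w" for w
    proof -
      obtain c where "w \<in> B c" using w unfolding nested_def B_def by blast
      then show ?thesis by (cases c) auto
    qed
    then have "A \<subseteq> {w \<in> A. \<not> nested w} \<union> (B True \<union> B False)" by blast
    from closure_of_mono[OF this, of "free_topology X"] g
    have "g \<in> free_topology X closure_of {w \<in> A. \<not> nested w} \<or> (\<exists>c. g \<in> free_topology X closure_of (B c))"
      unfolding closure_of_Un by blast
    then show ?thesis
    proof
      assume "\<exists>c. g \<in> free_topology X closure_of (B c)"
      then obtain c where "[] \<in> free_topology X closure_of (B c)" using True by auto
      moreover have "B c \<subseteq> carrier F" using Ac(1) by (auto simp: B_def)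
      ultimately have "sequential_limit (B c) []"
        using assms by (intro frechet_urysohn_nested[of _ c]) (auto simp: B_def)
      then show ?thesis using True sequential_limit_mono[of "B c" g A] by (auto simp: B_def)
    next
      assume "g \<in> free_topology X closure_of {w \<in> A. \<not> nested w}"
      then have "sequential_limit {w \<in> A. \<not> nested w} g"
      proof (rule sequential_limit_clustering[OF _ \<open>clustering\<close>, where W = "\<lambda>w. w" and n = 4 and u = g and \<delta> = 1])
        fix w s x assume *: "w \<in> {w \<in> A. \<not> nested w}" "s \<in> M \<rightarrow> M" "induced s w = induced s g" "x \<in> letters w"
        then show "s x \<in> s ` letters g \<or> (\<exists>y\<in>letters w. y \<noteq> x \<and> s y = s x)"
          using unmerged[OF _ *(2-4)] by blast
      qed (use Ac u in auto)
      then show ?thesis by (rule sequential_limit_mono) auto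
    qed
  qed
qed

end

section \<open>Failure of the Frechet-Urysohn property\<close>

lemma diagonal_subsequence:
  assumes "\<And>k. infinite {n. Q k n}"
  obtains q where "strict_mono (q :: nat \<Rightarrow> nat)" "\<And>k. Q k (q k)"
proof -
  have "\<exists>q. \<forall>k. Q k (q k) \<and> q k < q (Suc k)"
  proof (rule dependent_nat_choice)
    show "\<exists>n. Q 0 n" using assms[of 0] not_finite_existsD by auto
    show "\<exists>n'. Q (Suc k) n' \<and> n < n'" for n k
      using assms[of "Suc k"] unfolding infinite_nat_iff_unbounded by auto
  qed
  then show thesis using that by (auto simp: strict_mono_Suc_iff)
qed

section \<open>Double sequences and failure at length three\<close>

context metric_free_topological_group
begin

text \<open>The pattern of Arens' space: iterated limits put \<open>g\<close> into the closure of
  all \<open>t n k\<close>. A sequence of such points converging to \<open>g\<close> meets each row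
  finitely often, by \<open>row\<close>, so a subsequence runs through strictly increasing rows, and
  this is excluded by \<open>diagonal\<close>.\<close>

lemma not_frechet_urysohn_double_sequence:
  assumes Y: "Y \<subseteq> carrier G" and t: "\<And>n k. t n k \<in> Y" and g: "g \<in> Y"
    and tp: "\<And>n. limitin T (t n) (p n) sequentially" and pg: "limitin T p g sequentially"
    and row: "\<And>n. \<exists>U. openin T U \<and> g \<in> U \<and> (\<forall>k. t n k \<notin> U)"
    and diagonal: "\<And>\<nu> \<kappa> :: nat \<Rightarrow> nat. strict_mono \<nu> \<Longrightarrow> \<exists>U. openin T U \<and> g \<in> U \<and> (\<forall>i. t (\<nu> i) (\<kappa> i) \<notin> U)"
  shows "\<not> frechet_urysohn_space (subtopology T Y)"
proof
  assume fu: "frechet_urysohn_space (subtopology T Y)"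
  define E where "E = {t n k | n k. True}"
  have limit_closure: "l \<in> T closure_of C" if "limitin T f l sequentially" "\<And>k. f k \<in> C" for f l C
    using that unfolding limitin_sequentially in_closure_of by (meson order_refl)
  have "p n \<in> T closure_of E" for n by (rule limit_closure[OF tp]) (auto simp: E_def)
  then have "g \<in> T closure_of (T closure_of E)" by (intro limit_closure[OF pg])
  then have "g \<in> T closure_of E" by simp
  moreover have "E \<subseteq> Y" using t by (auto simp: E_def)
  ultimately have "sequential_limit E g" using fu g unfolding frechet_urysohn_subspace[OF Y] by blast
  then obtain \<sigma> where \<sigma>: "range \<sigma> \<subseteq> E" "limitin T \<sigma> g sequentially" unfolding sequential_limit_def by blast
  have "\<forall>i. \<exists>n k. \<sigma> i = t n k" using \<sigma>(1) by (auto simp: E_def image_subset_iff)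
  then obtain n k where nk: "\<And>i. \<sigma> i = t (n i) (k i)" by metis
  have fin: "finite {i. n i = m}" for m
  proof -
    obtain U where U: "openin T U" "g \<in> U" "\<forall>k. t m k \<notin> U" using row by blast
    then obtain N where "\<forall>i\<ge>N. \<sigma> i \<in> U" using \<sigma>(2) unfolding limitin_sequentially by blast
    then have "{i. n i = m} \<subseteq> {..<N}" using nk U(3) by (auto simp: not_le[symmetric])
    then show ?thesis using finite_subset by blast
  qed
  have big: "infinite {i. m < n i}" for m
  proof
    assume "finite {i. m < n i}"
    moreover have "finite (\<Union>j\<le>m. {i. n i = j})" using fin by auto
    ultimately have "finite ({i. m < n i} \<union> (\<Union>j\<le>m. {i. n i = j}))" by blast
    moreover have "{i. m < n i} \<union> (\<Union>j\<le>m. {i. n i = j}) = UNIV" by auto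
    ultimately show False by simp
  qed
  have "\<exists>q. \<forall>j. True \<and> (q j < q (Suc j) \<and> n (q j) < n (q (Suc j)))"
  proof (rule dependent_nat_choice)
    fix i :: nat
    show "\<exists>i'. True \<and> (i < i' \<and> n i < n i')"
      using big[of "n i"] unfolding infinite_nat_iff_unbounded by auto
  qed simp
  then obtain q where q': "\<forall>j. q j < q (Suc j) \<and> n (q j) < n (q (Suc j))" by blast
  have q: "strict_mono q" "strict_mono (n \<circ> q)" using q' by (auto simp: strict_mono_Suc_iff)
  obtain U where U: "openin T U" "g \<in> U" "\<forall>i. t ((n \<circ> q) i) ((k \<circ> q) i) \<notin> U"
    using diagonal[OF q(2)] by blast
  have "limitin T (\<sigma> \<circ> q) g sequentially" by (rule limitin_subsequence[OF q(1) \<sigma>(2)])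
  then obtain N where "(\<sigma> \<circ> q) N \<in> U" using U(1,2) unfolding limitin_sequentially by blast
  then show False using U(3) nk by simp
qed

lemma nonisolated_near:
  assumes "x \<in> nonisolated_points X" "r > 0"
  obtains y where "y \<in> M" "y \<noteq> x" "d x y < r"
proof -
  have x: "x \<in> M" "\<not> openin X {x}" using assms(1) by (auto simp: nonisolated_points_def)
  obtain U where U: "openin X U" "x \<in> U" "\<forall>y\<in>U. d x y < r" using ball_neighbourhood[OF x(1) assms(2)] by blast
  then have "U \<noteq> {x}" using x(2) by blast
  then show thesis using that U openin_subset[OF U(1)] by blast
qed

lemma nonisolated_sequence:
  assumes x: "x \<in> nonisolated_points X" and r: "r > 0"
  obtains y where "\<And>k :: nat. y k \<in> M" "\<And>k. y k \<noteq> x" "\<And>k. d x (y k) < r"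
    "\<And>k. d x (y k) < 1 / real (Suc k)" "limitin X y x sequentially"
proof -
  have "\<exists>y. y \<in> M \<and> y \<noteq> x \<and> d x y < min r (1 / real (Suc k))" for k
    using nonisolated_near[OF x, of "min r (1 / real (Suc k))"] r by auto
  then obtain y where y: "\<And>k. y k \<in> M" "\<And>k. y k \<noteq> x" "\<And>k. d x (y k) < min r (1 / real (Suc k))"
    by metis
  have "x \<in> M" using x by (simp add: nonisolated_points_def)
  then have "limitin X y x sequentially"
  proof (rule limitin_dist_zero[where \<epsilon> = "\<lambda>k. 1 / real (Suc (k + 0))"])
    show "d (y k) x < 1 / real (Suc (k + 0))" for k using y(3)[of k] by (simp add: metric.commute)
    show "(\<lambda>k. 1 / real (Suc (k + 0))) \<longlonglongrightarrow> 0" by (rule inverse_Suc_limit)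
  qed (rule y)
  then show thesis using that[of y] y by (metis min_less_iff_conj)
qed

lemma closedin_nonisolated: "closedin X (nonisolated_points X)"
proof -
  have "M - nonisolated_points X = \<Union>{{x} | x. openin X {x}}"
    using openin_subset[of X "{x}" for x] by (auto simp: nonisolated_points_def)
  moreover have "openin X (\<Union>{{x} | x. openin X {x}})" by (rule openin_Union) auto
  ultimately show ?thesis by (simp add: closedin_def nonisolated_points_def subset_iff)
qed

lemma finite_near:
  assumes \<sigma>: "\<And>n. \<sigma> n \<in> M" and none: "\<And>r l. strict_mono (r :: nat \<Rightarrow> nat) \<Longrightarrow> \<not> limitin X (\<sigma> \<circ> r) l sequentially"
    and p: "p \<in> M"
  obtains \<epsilon> where "\<epsilon> > 0" "finite {n. d (\<sigma> n) p < \<epsilon>}"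
proof (rule ccontr)
  assume "\<not> thesis"
  then have "infinite {n. d (\<sigma> n) p < 1 / real (Suc k)}" for k using that[of "1 / real (Suc k)"] by auto
  from diagonal_subsequence[of "\<lambda>k n. d (\<sigma> n) p < 1 / real (Suc k)", OF this]
  obtain q where q: "strict_mono (q :: nat \<Rightarrow> nat)" "\<And>k. d (\<sigma> (q k)) p < 1 / real (Suc k)" by blast
  have "limitin X (\<sigma> \<circ> q) p sequentially"
    by (rule limitin_dist_zero[OF p _ _ inverse_Suc_limit[of 1 0]]) (use \<sigma> q in auto)
  then show False using none q(1) by blast
qed

text \<open>The equation says that \<open>a, b\<close> and \<open>c, x\<close> are the same
  multiset.\<close>

lemma triple_frag:
  assumes "frag_of a + frag_of b - frag_of c = frag_of x"
  shows "b = c \<or> b = x" "a = x \<or> b = x"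
proof -
  have lookups: "(if a = z then 1 else 0) + (if b = z then 1 else 0) - (if c = z then 1 else 0) = (if x = z then 1 else (0::int))" for z
    using arg_cong[OF assms, of "\<lambda>f. Poly_Mapping.lookup f z"] by (auto simp: lookup_add lookup_minus split: if_splits)
  show "b = c \<or> b = x" using lookups[of b] by (auto split: if_splits)
  show "a = x \<or> b = x" using lookups[of x] by (auto split: if_splits)
qed

text \<open>Only exponent sums of images are compared, which is why F(X) and A(X) are settled
  together.\<close>

lemma not_frechet_urysohn_short_elements_3:
  assumes K: "\<not> compactin X (nonisolated_points X)"
  shows "\<not> frechet_urysohn_space (subtopology T (short_elements 3))"
proof -
  let ?K = "nonisolated_points X"
  have KM: "?K \<subseteq> M" by (auto simp: nonisolated_points_def)
  have "\<not> (\<forall>\<sigma> :: nat \<Rightarrow> 'a. range \<sigma> \<subseteq> ?K \<longrightarrow> (\<exists>l r. l \<in> ?K \<and> strict_mono r \<and> limitin X (\<sigma> \<circ> r) l sequentially))"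
    using K KM metric.compactin_sequentially[of ?K] by (simp add: mtopology_d)
  then obtain \<sigma> :: "nat \<Rightarrow> 'a" where \<sigma>: "range \<sigma> \<subseteq> ?K"
    "\<And>l r. l \<in> ?K \<Longrightarrow> strict_mono r \<Longrightarrow> \<not> limitin X (\<sigma> \<circ> r) l sequentially" by blast
  have \<sigma>K: "\<sigma> n \<in> ?K" for n using \<sigma>(1) by blast
  have \<sigma>M: "\<sigma> n \<in> M" for n using \<sigma>K KM by blast
  have none: "\<not> limitin X (\<sigma> \<circ> r) l sequentially" if "strict_mono r" for r l
  proof
    assume lim: "limitin X (\<sigma> \<circ> r) l sequentially"
    then have "l \<in> ?K" using limitin_closedin[OF lim closedin_nonisolated] \<sigma>K by simp
    then show False using \<sigma>(2) that lim by blast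
  qed
  define x0 where "x0 = \<sigma> 0"
  have x0: "x0 \<in> ?K" "x0 \<in> M" using \<sigma>K \<sigma>M by (auto simp: x0_def)
  obtain \<epsilon>0 where \<epsilon>0: "\<epsilon>0 > 0" "finite {n. d (\<sigma> n) x0 < \<epsilon>0}" using finite_near[OF \<sigma>M none x0(2)] by blast
  have "{n. \<sigma> n = x0} \<subseteq> {n. d (\<sigma> n) x0 < \<epsilon>0}" using \<epsilon>0(1) x0 by auto
  then have "finite {n. \<sigma> n = x0}" using \<epsilon>0(2) finite_subset by blast
  then obtain N where N: "\<forall>n\<in>{n. \<sigma> n = x0}. n < N" using finite_nat_set_iff_bounded by metis
  \<comment> \<open>The limit point \<open>x0\<close> is itself a term of \<open>\<sigma>\<close>;
    only finitely many terms equal it, and the shift removes them.\<close>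
  define \<tau> where "\<tau> n = \<sigma> (n + N)" for n
  have \<tau>: "\<tau> n \<in> ?K" "\<tau> n \<in> M" "\<tau> n \<noteq> x0" for n using \<sigma>K \<sigma>M N[rule_format, of "n + N"] by (auto simp: \<tau>_def)
  have \<tau>x0: "0 < d (\<tau> n) x0" for n using \<tau> x0 by simp
  \<comment> \<open>Half the distance from \<open>\<tau> n\<close> to \<open>x0\<close> keeps row
    \<open>n\<close> away from \<open>x0\<close>; the bound \<open>1 / real (Suc n)\<close> lets the
    rows inherit from \<open>\<tau>\<close> that they accumulate nowhere as \<open>n\<close>
    grows.\<close>
  have "\<exists>x. \<forall>k. x k \<in> M \<and> x k \<noteq> \<tau> n \<and> d (\<tau> n) (x k) < d (\<tau> n) x0 / 2 \<and> d (\<tau> n) (x k) < 1 / real (Suc n) \<and>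
      limitin X x (\<tau> n) sequentially" for n
  proof -
    have "min (d (\<tau> n) x0 / 2) (1 / real (Suc n)) > 0" using \<tau>x0[of n] by simp
    from nonisolated_sequence[OF \<tau>(1) this] show ?thesis by (metis min_less_iff_conj)
  qed
  then obtain x where x: "\<And>n k. x n k \<in> M" "\<And>n k. x n k \<noteq> \<tau> n" "\<And>n k. d (\<tau> n) (x n k) < d (\<tau> n) x0 / 2"
    "\<And>n k. d (\<tau> n) (x n k) < 1 / real (Suc n)" "\<And>n. limitin X (x n) (\<tau> n) sequentially"
    by metis
  have xx0: "d (\<tau> n) x0 / 2 \<le> d (x n k) x0" for n k
    using metric.triangle[of "\<tau> n" "x n k" x0] x(1)[of n k] x(3)[of n k] \<tau>(2)[of n] x0 by auto
  have x_neq: "x n k \<noteq> x0" for n k using xx0[of n k] \<tau>x0[of n] x0 by auto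
  obtain y where y: "\<And>n. y n \<in> M" "\<And>n. y n \<noteq> x0" "limitin X y x0 sequentially"
    by (rule nonisolated_sequence[OF x0(1), of 1]) (simp, blast)
  define w where "w n k = [(y n, True), (x n k, True), (\<tau> n, False)]" for n k
  have wM: "letters (w n k) \<subseteq> M" for n k using y x \<tau> by (auto simp: w_def)
  have frag: "frag_of (s (y n)) + frag_of (s (x n k)) - frag_of (s (\<tau> n)) = frag_of (s x0)"
    if "s \<in> M \<rightarrow> M" "induced s (val (w n k)) = induced s (val [(x0, True)])" for s n k
  proof -
    have "word_frag (map (apfst s) (w n k)) = word_frag (map (apfst s) [(x0, True)])"
      using that x0 wM by (intro word_frag_eqI) auto
    then show ?thesis by (simp add: w_def add_diff_eq)
  qed
  have x0c: "val [(x0, True)] \<in> carrier G" using x0 by (intro val_closed) simp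
  show ?thesis
  proof (rule not_frechet_urysohn_double_sequence[OF short_elements_subset, where t = "\<lambda>n k. val (w n k)" and
        g = "val [(x0, True)]" and p = "\<lambda>n. val [(y n, True)]"])
    show "val (w n k) \<in> short_elements 3" for n k
      by (rule short_elementsI[OF wM]) (simp add: w_def)
    show "val [(x0, True)] \<in> short_elements 3"
      using x0 by (intro short_elementsI) auto
    show "limitin T (\<lambda>k. val (w n k)) (val [(y n, True)]) sequentially" for n
    proof -
      have "limitin T (\<lambda>k. val (w n k)) (val [(y n, True), (\<tau> n, True), (\<tau> n, False)]) sequentially"
        by (rule limitin_val) (use x(5) y(1) \<tau> in \<open>auto simp: w_def less_Suc_eq\<close>)
      moreover have "val [(y n, True), (\<tau> n, True), (\<tau> n, False)] = val [(y n, True)]"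
        using y \<tau> e_closed by simp
      ultimately show ?thesis by simp
    qed
    show "limitin T (\<lambda>n. val [(y n, True)]) (val [(x0, True)]) sequentially"
      by (rule limitin_val) (use y(3) in auto)
    show "\<exists>U. openin T U \<and> val [(x0, True)] \<in> U \<and> (\<forall>k. val (w n k) \<notin> U)" for n
    proof -
      \<comment> \<open>Merged points are less than \<open>2 * \<epsilon>\<close> apart, so neither
        \<open>y n\<close> nor any \<open>x n k\<close> can be merged with \<open>x0\<close>,
        although by \<open>triple_frag\<close> one of them would have to be.\<close>
      define \<epsilon> where "\<epsilon> = min (d (y n) x0) (d (\<tau> n) x0 / 2) / 2"
      have \<epsilon>: "\<epsilon> > 0" using y(1,2)[of n] \<tau>x0[of n] x0 by (simp add: \<epsilon>_def)
      obtain U where U: "openin T U" "val [(x0, True)] \<in> U"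
        "\<forall>h\<in>U. \<exists>s\<in>M \<rightarrow> M. (\<forall>x\<in>M. d x (s x) < \<epsilon>) \<and> induced s h = induced s (val [(x0, True)])"
        using induced_neighbourhood[OF x0c \<epsilon>] by blast
      have "val (w n k) \<notin> U" for k
      proof
        assume "val (w n k) \<in> U"
        then obtain s where s: "s \<in> M \<rightarrow> M" "\<And>x. x \<in> M \<Longrightarrow> d x (s x) < \<epsilon>"
          "induced s (val (w n k)) = induced s (val [(x0, True)])" using U(3) by blast
        have "s (y n) = s x0 \<or> s (x n k) = s x0" by (rule triple_frag(2)[OF frag[OF s(1,3)]])
        then have "d (y n) x0 < 2 * \<epsilon> \<or> d (x n k) x0 < 2 * \<epsilon>"
          using merged_dist[OF s(1,2)] y(1) x(1) x0(2) by blast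
        then show False using xx0[of n k] by (auto simp: \<epsilon>_def)
      qed
      then show ?thesis using U by blast
    qed
    fix \<nu> \<kappa> :: "nat \<Rightarrow> nat" assume \<nu>: "strict_mono \<nu>"
    define z where "z i = x (\<nu> i) (\<kappa> i)" for i
    \<comment> \<open>By \<open>triple_frag\<close> a word of the diagonal becomes equal to
      \<open>x0\<close> only if \<open>z i\<close> is merged with \<open>\<tau> (\<nu> i)\<close> or
      with \<open>x0\<close>.\<close>
    define D where "D = (\<Union>i. {(z i, \<tau> (\<nu> i)), (z i, x0)})"
    have zM: "z i \<in> M" for i using x(1) by (simp add: z_def)
    have DM: "D \<subseteq> M \<times> M" using zM \<tau> x0 by (auto simp: D_def)
    have sep: "\<exists>U. openin X U \<and> p \<in> U \<and> D \<inter> U \<times> U = {}" if p: "p \<in> M" for p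
    proof -
      obtain \<epsilon> where \<epsilon>: "\<epsilon> > 0" "finite {n. d (\<sigma> n) p < \<epsilon>}" using finite_near[OF \<sigma>M none p] by blast
      then obtain n1 where n1: "\<forall>n\<in>{n. d (\<sigma> n) p < \<epsilon>}. n < n1" using finite_nat_set_iff_bounded by metis
      obtain n2 where n2: "1 / real (Suc n2) < \<epsilon> / 2" using reals_Archimedean[of "\<epsilon> / 2"] \<epsilon>(1) by (auto simp: inverse_eq_divide)
      define m where "m = max n1 n2"
      have far: "\<epsilon> / 2 \<le> d p (z i)" if "m \<le> i" for i
      proof -
        have i: "m \<le> \<nu> i" using that strict_mono_imp_increasing[OF \<nu>, of i] by linarith
        have "\<epsilon> \<le> d (\<tau> (\<nu> i)) p" using n1[rule_format, of "\<nu> i + N"] i by (auto simp: \<tau>_def m_def not_le[symmetric])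
        moreover have "1 / real (Suc (\<nu> i)) \<le> 1 / real (Suc n2)" using i by (intro divide_left_mono) (auto simp: m_def)
        then have "d (\<tau> (\<nu> i)) (z i) < \<epsilon> / 2" using x(4)[of "\<nu> i" "\<kappa> i"] n2 by (simp add: z_def)
        ultimately show ?thesis
          using metric.triangle[of "\<tau> (\<nu> i)" "z i" p] \<tau>(2) zM p by (simp add: metric.commute[of p])
      qed
      \<comment> \<open>From \<open>m\<close> on the points \<open>z i\<close> avoid a ball around
        \<open>p\<close>. The finitely many earlier pairs consist of distinct points, so they do not
        both lie within \<open>\<delta>\<close> of \<open>p\<close>.\<close>
      define L where "L = insert p (insert x0 (z ` {..<m} \<union> (\<lambda>i. \<tau> (\<nu> i)) ` {..<m}))"
      have "finite L" "L \<subseteq> M" using p x0 zM \<tau> by (auto simp: L_def)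
      then obtain \<delta> where \<delta>: "\<delta> > 0" "\<And>a b. a \<in> L \<Longrightarrow> b \<in> L \<Longrightarrow> d a b < \<delta> \<Longrightarrow> a = b"
        by (rule metric.finite_separated) blast
      obtain U where U: "openin X U" "p \<in> U" "\<forall>q\<in>U. d p q < min \<delta> (\<epsilon> / 2)"
        using ball_neighbourhood[OF p, of "min \<delta> (\<epsilon> / 2)"] \<delta>(1) \<epsilon>(1) by auto
      have "\<not> (z i \<in> U \<and> b \<in> U)" if b: "b = \<tau> (\<nu> i) \<or> b = x0" for i b
      proof
        assume *: "z i \<in> U \<and> b \<in> U"
        then have dd: "d p (z i) < \<delta>" "d p (z i) < \<epsilon> / 2" "d p b < \<delta>" using U(3) by auto
        then have "i < m" using far[of i] by linarith
        then have "p = z i" "p = b" using \<delta>(2)[of p] dd b by (auto simp: L_def)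
        then show False using b x(2) x_neq by (auto simp: z_def)
      qed
      then have "D \<inter> U \<times> U = {}" by (auto simp: D_def)
      then show ?thesis using U by blast
    qed
    have "metrizable_space X" using metric.metrizable_space_mtopology by (simp add: mtopology_d)
    from metric_separating_pairs[OF this DM sep]
    obtain \<rho> where \<rho>: "Metric_space M \<rho>" "Metric_space.mtopology M \<rho> = X" "\<And>a b. (a, b) \<in> D \<Longrightarrow> 1 \<le> \<rho> a b"
      by metis
    interpret rho: metric_free_topological_group P G e X T \<rho>
      by (rule metric_free_topological_groupI[OF free_topological_group_axioms \<rho>(1,2)])
    obtain U where U: "openin T U" "val [(x0, True)] \<in> U"
      "\<forall>h\<in>U. \<exists>s\<in>M \<rightarrow> M. (\<forall>x\<in>M. \<rho> x (s x) < 1 / 2) \<and> induced s h = induced s (val [(x0, True)])"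
      using rho.induced_neighbourhood[OF x0c, of "1 / 2"] by auto
    have "val (w (\<nu> i) (\<kappa> i)) \<notin> U" for i
    proof
      assume "val (w (\<nu> i) (\<kappa> i)) \<in> U"
      then obtain s where s: "s \<in> M \<rightarrow> M" "\<And>x. x \<in> M \<Longrightarrow> \<rho> x (s x) < 1 / 2"
        "induced s (val (w (\<nu> i) (\<kappa> i))) = induced s (val [(x0, True)])" using U(3) by blast
      have "s (z i) = s (\<tau> (\<nu> i)) \<or> s (z i) = s x0"
        unfolding z_def by (rule triple_frag(1)[OF frag[OF s(1,3)]])
      then have "\<rho> (z i) (\<tau> (\<nu> i)) < 2 * (1 / 2) \<or> \<rho> (z i) x0 < 2 * (1 / 2)"
        using rho.merged_dist[OF s(1,2) zM \<tau>(2)] rho.merged_dist[OF s(1,2) zM x0(2)] by blast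
      moreover have "1 \<le> \<rho> (z i) (\<tau> (\<nu> i))" "1 \<le> \<rho> (z i) x0" by (auto intro!: \<rho>(3) simp: D_def)
      ultimately show False by linarith
    qed
    then show "\<exists>U. openin T U \<and> val [(x0, True)] \<in> U \<and> (\<forall>i. val (w (\<nu> i) (\<kappa> i)) \<notin> U)" using U by blast
  qed
qed

end

section \<open>Failure at length five\<close>

context metric_free_group
begin

text \<open>Otherwise any sequence has a subsequence of finite range, or one whose terms are ever
  closer to other points, which subconverges by \<open>clustering\<close>; so \<open>X\<close> would
  be compact.\<close>

lemma infinite_isolated_of_clustering:
  assumes clustering "\<not> compact_space X"
  obtains \<eta> where "\<eta> > 0" "infinite {x \<in> M. \<not> near \<eta> x}"
proof (rule ccontr)
  assume "\<not> thesis"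
  then have fin: "finite {x \<in> M. \<not> near (1 / real (Suc k)) x}" for k using that[of "1 / real (Suc k)"] by auto
  have "\<exists>l r. l \<in> M \<and> strict_mono (r :: nat \<Rightarrow> nat) \<and> limitin X (\<sigma> \<circ> r) l sequentially"
    if "range \<sigma> \<subseteq> M" for \<sigma> :: "nat \<Rightarrow> 'a"
  proof -
    have \<sigma>: "\<sigma> i \<in> M" for i using that by blast
    have ex: "\<exists>r l. strict_mono (r :: nat \<Rightarrow> nat) \<and> limitin X (\<sigma> \<circ> r) l sequentially"
    proof (cases "\<exists>k. infinite {i. \<not> near (1 / real (Suc k)) (\<sigma> i)}")
      case True
      then obtain k where "infinite {i. \<not> near (1 / real (Suc k)) (\<sigma> i)}" by blast
      from infinite_enumerate[OF this] obtain r where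
        r: "strict_mono (r :: nat \<Rightarrow> nat)" "\<forall>i. r i \<in> {i. \<not> near (1 / real (Suc k)) (\<sigma> i)}" by blast
      have "finite (range (\<sigma> \<circ> r))" using r(2) \<sigma> by (intro finite_subset[OF _ fin[of k]]) auto
      from constant_subsequence[OF this] obtain q c where
        q: "strict_mono (q :: nat \<Rightarrow> nat)" "\<And>i. (\<sigma> \<circ> r) (q i) = c" by blast
      have "c \<in> M" using q(2)[of 0] \<sigma> by auto
      moreover have "\<sigma> \<circ> (r \<circ> q) = (\<lambda>_. c)" using q(2) by (simp add: fun_eq_iff)
      ultimately have "limitin X (\<sigma> \<circ> (r \<circ> q)) c sequentially" by simp
      then show ?thesis using strict_mono_o[OF r(1) q(1)] by blast
    next
      case False
      have "infinite {i. near (1 / real (Suc k)) (\<sigma> i)}" for k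
      proof
        assume "finite {i. near (1 / real (Suc k)) (\<sigma> i)}"
        then have "finite ({i. near (1 / real (Suc k)) (\<sigma> i)} \<union> {i. \<not> near (1 / real (Suc k)) (\<sigma> i)})"
          using False by blast
        moreover have "{i. near (1 / real (Suc k)) (\<sigma> i)} \<union> {i. \<not> near (1 / real (Suc k)) (\<sigma> i)} = UNIV" by blast
        ultimately show False using infinite_UNIV_nat by metis
      qed
      from diagonal_subsequence[of "\<lambda>k i. near (1 / real (Suc k)) (\<sigma> i)", OF this]
      obtain q where q: "strict_mono (q :: nat \<Rightarrow> nat)" "\<And>k. near (1 / real (Suc k)) (\<sigma> (q k))" by blast
      have "\<forall>k. \<exists>y. y \<in> M \<and> y \<noteq> \<sigma> (q k) \<and> d (\<sigma> (q k)) y < 1 / real (Suc k)"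
      proof
        fix k show "\<exists>y. y \<in> M \<and> y \<noteq> \<sigma> (q k) \<and> d (\<sigma> (q k)) y < 1 / real (Suc k)"
          using q(2)[of k] unfolding near_def by blast
      qed
      from choice[OF this] obtain y where
        y': "\<forall>k. y k \<in> M \<and> y k \<noteq> \<sigma> (q k) \<and> d (\<sigma> (q k)) (y k) < 1 / real (Suc k)" ..
      then have y: "y k \<in> M" "\<sigma> (q k) \<noteq> y k" "d (\<sigma> (q k)) (y k) < 1 / real (Suc k)" for k
        using spec[OF y', of k] by metis+
      have "norm (d (\<sigma> (q k)) (y k)) \<le> 1 / real (Suc (k + 0))" for k using y(3)[of k] by simp
      then have lim: "(\<lambda>k. d (\<sigma> (q k)) (y k)) \<longlonglongrightarrow> 0"
        by (rule Lim_null_comparison[OF always_eventually[OF allI] inverse_Suc_limit[of 1 0]])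
      from \<open>clustering\<close>[unfolded clustering_def, rule_format, OF \<sigma> y(1,2) lim]
      obtain r p where "strict_mono (r :: nat \<Rightarrow> nat)" "limitin X ((\<lambda>k. \<sigma> (q k)) \<circ> r) p sequentially" by blast
      then show ?thesis using strict_mono_o[OF q(1)] by (intro exI[of _ "q \<circ> r"] exI[of _ p]) (auto simp: o_def)
    qed
    then obtain r l where "strict_mono (r :: nat \<Rightarrow> nat)" "limitin X (\<sigma> \<circ> r) l sequentially" by blast
    then show ?thesis using limitin_topspace[of X "\<sigma> \<circ> r" l] by blast
  qed
  then have "compact_space X"
    using metric.compact_space_sequentially unfolding mtopology_d by blast
  then show False using assms(2) by simp
qed

lemma not_frechet_urysohn_short_elements_5:
  assumes clustering and compact: "\<not> compact_space X" and discrete: "X \<noteq> discrete_topology M"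
  shows "\<not> frechet_urysohn_space (subtopology (free_topology X) (short_elements 5))"
proof -
  obtain \<eta> where \<eta>: "\<eta> > 0" "infinite {x \<in> M. \<not> near \<eta> x}"
    using infinite_isolated_of_clustering[OF assms(1,2)] by blast
  obtain D :: "nat \<Rightarrow> 'a" where D: "inj D" "range D \<subseteq> {x \<in> M. \<not> near \<eta> x}"
    using infinite_countable_subset[OF \<eta>(2)] by blast
  have DM: "D n \<in> M" and D_far: "\<not> near \<eta> (D n)" for n using D(2) by auto
  obtain p where p: "p \<in> nonisolated_points X"
    using discrete discrete_topology_unique[of M X] by (auto simp: nonisolated_points_def)
  have pM: "p \<in> M" using p by (simp add: nonisolated_points_def)
  \<comment> \<open>Staying within \<open>\<eta>\<close> of \<open>p\<close> makes \<open>p\<close>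
    and all \<open>x k\<close> \<open>near \<eta>\<close>, so that their factors are 1; only the
    letters \<open>D n\<close> may be dilated.\<close>
  obtain x where x: "\<And>k :: nat. x k \<in> M" "\<And>k. x k \<noteq> p" "\<And>k. d p (x k) < \<eta>" "limitin X x p sequentially"
    by (rule nonisolated_sequence[OF p \<eta>(1)]) blast
  have near_x: "near \<eta> (x k)" for k
    unfolding near_def using x(2,3)[of k] pM by (intro bexI[of _ p]) (auto simp: metric.commute[of "x k"])
  have near_p: "near \<eta> p" unfolding near_def using x(1-3)[of 0] by blast
  define w where "w n k = [(x n, True), (D n, True), (x k, True), (p, False), (D n, False)]" for n k
  have wM: "letters (w n k) \<subseteq> M" for n k using x DM pM by (simp add: w_def)
  let ?g = "val [(p, True)]"
  have gc: "?g \<in> carrier F" using pM by (intro val_closed) simp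
  have affine: "\<exists>U. openin (free_topology X) U \<and> ?g \<in> U \<and>
      (\<forall>n k. val (w n k) \<in> U \<longrightarrow> d (x n) p + \<mu> (D n) * d (x k) p < c)"
    if \<mu>: "\<And>y. y \<in> M \<Longrightarrow> 0 < \<mu> y" "\<And>y. y \<in> M \<Longrightarrow> near \<eta> y \<Longrightarrow> \<mu> y = 1" and c: "c > 0" for \<mu> c
  proof -
    obtain h where h: "h \<in> hom F affine_group" "\<And>y. y \<in> M \<Longrightarrow> h (free_gen y) = (\<mu> y, \<lambda>z. d y z)"
      using affine_hom[of \<mu>] \<mu>(1) by blast
    obtain U where U: "openin (free_topology X) U" "?g \<in> U"
      "\<And>f. f \<in> U \<Longrightarrow> \<bar>snd (h (inv\<^bsub>F\<^esub> ?g \<otimes>\<^bsub>F\<^esub> f)) p\<bar> < c"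
      using affine_neighbourhood[OF \<mu> \<eta>(1) h gc c] pM by blast
    \<comment> \<open>Evaluated at \<open>p\<close>, the factor \<open>p^-1 x_n\<close> contributes
      \<open>d (x n) p\<close>, and the conjugate of \<open>x_k p^-1\<close> by \<open>D n\<close>
      contributes \<open>d (x k) p\<close> stretched by \<open>\<mu> (D n)\<close>. Both terms are
      nonnegative and cannot compensate each other.\<close>
    have snd_eq: "snd (h (inv\<^bsub>F\<^esub> ?g \<otimes>\<^bsub>F\<^esub> val (w n k))) p = d (x n) p + \<mu> (D n) * d (x k) p" for n k
    proof -
      have "inv\<^bsub>F\<^esub> ?g \<otimes>\<^bsub>F\<^esub> val (w n k) = val ((p, False) # w n k)"
        using pM e_closed by simp
      moreover have "h (val ((p, False) # w n k)) = letters_prod affine_group (h \<circ> free_gen) ((p, False) # w n k)"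
        using wM[of n k] pM e_closed by (intro hom_letters_prod[OF is_group group_affine_group h(1)]) auto
      moreover have "\<mu> p = 1" "\<mu> (x i) = 1" for i using \<mu>(2) near_x near_p pM x(1) by auto
      ultimately show ?thesis
        using h(2) pM x(1) DM \<mu>(1)[OF DM[of n]] by (simp add: w_def inv_affine_group field_simps)
    qed
    have "d (x n) p + \<mu> (D n) * d (x k) p < c" if "val (w n k) \<in> U" for n k
      using U(3)[OF that] unfolding snd_eq by linarith
    then show ?thesis using U(1,2) by blast
  qed
  show ?thesis
  proof (rule not_frechet_urysohn_double_sequence[OF short_elements_subset, where t = "\<lambda>n k. val (w n k)" and
        g = ?g and p = "\<lambda>n. val [(x n, True)]"])
    show "val (w n k) \<in> short_elements 5" for n k
      by (rule short_elementsI[OF wM]) (simp add: w_def)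
    show "?g \<in> short_elements 5"
      using pM by (intro short_elementsI) auto
    show "limitin (free_topology X) (\<lambda>k. val (w n k)) (val [(x n, True)]) sequentially" for n
    proof -
      have "limitin (free_topology X) (\<lambda>k. val (w n k))
          (val [(x n, True), (D n, True), (p, True), (p, False), (D n, False)]) sequentially"
        by (rule limitin_val) (use x(1,4) DM pM in \<open>auto simp: w_def less_Suc_eq numeral_eq_Suc\<close>)
      moreover have "val [(x n, True), (D n, True), (p, True), (p, False), (D n, False)] = val [(x n, True)]"
        using x(1)[of n] DM[of n] pM by (simp add: letters_prod_free_group inv_letter_def del: letters_prod.simps)
      ultimately show ?thesis by simp
    qed
    show "limitin (free_topology X) (\<lambda>n. val [(x n, True)]) ?g sequentially"
      by (rule limitin_val) (use x(4) in auto)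
    show "\<exists>U. openin (free_topology X) U \<and> ?g \<in> U \<and> (\<forall>k. val (w n k) \<notin> U)" for n
    proof -
      \<comment> \<open>Without dilation the sum is at least \<open>d (x n) p\<close>, which already
        excludes row \<open>n\<close>.\<close>
      obtain U where U: "openin (free_topology X) U" "?g \<in> U"
        "\<forall>m k. val (w m k) \<in> U \<longrightarrow> d (x m) p + 1 * d (x k) p < d (x n) p"
        using affine[of "\<lambda>_. 1" "d (x n) p"] x(1,2)[of n] pM by auto
      have "val (w n k) \<notin> U" for k
        using U(3)[rule_format, of n k] metric.nonneg[of "x k" p] by linarith
      then show ?thesis using U(1,2) by blast
    qed
    fix \<nu> \<kappa> :: "nat \<Rightarrow> nat" assume \<nu>: "strict_mono \<nu>"
    have inj: "inj (D \<circ> \<nu>)" using D(1) strict_mono_imp_inj_on[OF \<nu>] by (rule inj_compose)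
    \<comment> \<open>The factor at \<open>D (\<nu> i)\<close> makes up for the smallness of
      \<open>d (x (\<kappa> i)) p\<close>, however fast \<open>\<kappa>\<close> grows; it is well
      defined because \<open>D\<close> and \<open>\<nu>\<close> are injective.\<close>
    define \<mu> where "\<mu> y = (if y \<in> range (D \<circ> \<nu>) then 1 / d (x (\<kappa> (inv_into UNIV (D \<circ> \<nu>) y))) p else 1)" for y
    have \<mu>D: "\<mu> (D (\<nu> i)) = 1 / d (x (\<kappa> i)) p" for i
      using inv_f_f[OF inj, of i] by (auto simp: \<mu>_def)
    have xp: "0 < d (x k) p" for k using x(1,2) pM by simp
    have \<mu>0: "0 < \<mu> y" for y using xp by (simp add: \<mu>_def)
    have \<mu>1: "\<mu> y = 1" if "near \<eta> y" for y using that D_far by (auto simp: \<mu>_def)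
    have "\<exists>U. openin (free_topology X) U \<and> ?g \<in> U \<and>
        (\<forall>n k. val (w n k) \<in> U \<longrightarrow> d (x n) p + \<mu> (D n) * d (x k) p < 1)"
      by (rule affine[OF \<mu>0 \<mu>1 zero_less_one])
    then obtain U where U: "openin (free_topology X) U" "?g \<in> U"
      "\<forall>n k. val (w n k) \<in> U \<longrightarrow> d (x n) p + \<mu> (D n) * d (x k) p < 1"
      by (elim exE conjE)
    have "\<mu> (D (\<nu> i)) * d (x (\<kappa> i)) p = 1" for i using \<mu>D[of i] xp[of "\<kappa> i"] by simp
    then have "val (w (\<nu> i) (\<kappa> i)) \<notin> U" for i
      using U(3)[rule_format, of "\<nu> i" "\<kappa> i"] xp[of "\<nu> i"] by force
    then show "\<exists>U. openin (free_topology X) U \<and> ?g \<in> U \<and> (\<forall>i. val (w (\<nu> i) (\<kappa> i)) \<notin> U)" using U by blast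
  qed
qed

end

section \<open>Combining the positive and negative results\<close>

theorem corollary3p4:
  fixes X :: "'a topology"
  assumes "metrizable_space X"
  shows
    "(((\<forall>n\<ge>1. frechet_urysohn_space (free_words n X)) \<longleftrightarrow>
         frechet_urysohn_space (free_words 5 X)) \<and>
      (frechet_urysohn_space (free_words 5 X) \<longleftrightarrow>
         compact_space X \<or> X = discrete_topology (topspace X)))
     \<and>
     (((\<forall>n\<ge>1. frechet_urysohn_space (free_abelian_words n X)) \<longleftrightarrow>
         frechet_urysohn_space (free_abelian_words 3 X)) \<and>
      (frechet_urysohn_space (free_abelian_words 3 X) \<longleftrightarrow>
         frechet_urysohn_space (free_words 4 X)) \<and>
      (frechet_urysohn_space (free_words 4 X) \<longleftrightarrow>
         frechet_urysohn_space (free_words 3 X)) \<and>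
      (frechet_urysohn_space (free_words 3 X) \<longleftrightarrow>
         compactin X (nonisolated_points X)))
     \<and>
     (frechet_urysohn_space (free_abelian_words 2 X) \<and>
      frechet_urysohn_space (free_words 2 X))"
proof -
  let ?FU = "\<lambda>n. frechet_urysohn_space (free_words n X)"
  let ?AU = "\<lambda>n. frechet_urysohn_space (free_abelian_words n X)"
  let ?K = "compactin X (nonisolated_points X)"
  let ?M = "topspace X"
  note locF = free_topological_group_free_group[OF assms]
  note locA = free_topological_group_free_Abelian_group[OF assms]
  interpret F: free_topological_group group "free_group ?M" free_gen X "free_topology X" by (rule locF)
  interpret A: free_topological_group comm_group "free_Abelian_group ?M" frag_of X "free_abelian_topology X" by (rule locA)
  note eqF = free_words_eq[OF assms] and eqA = free_abelian_words_eq[OF assms]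
  obtain d where Fd: "metric_free_topological_group group (free_group ?M) free_gen X (free_topology X) d"
    using F.metric_locale[OF assms] by blast
  obtain d' where Ad: "metric_free_topological_group comm_group (free_Abelian_group ?M) frag_of X (free_abelian_topology X) d'"
    using A.metric_locale[OF assms] by blast
  have mono: "?FU m \<Longrightarrow> n \<le> m \<Longrightarrow> ?FU n" for m n
    unfolding free_words_def by (erule frechet_urysohn_subtopology) auto
  have compact: "?FU n" if "compact_space X" for n
    unfolding eqF by (rule metric_free_topological_group.frechet_urysohn_short_elements_compact[OF Fd that])
  have discrete: "?FU n" if "X = discrete_topology ?M" for n
    unfolding eqF metric_free_topological_group.frechet_urysohn_subspace[OF Fd F.short_elements_subset]
    using F.closure_of_discrete[OF that] F.short_elements_subset
      metric_free_topological_group.sequential_limit_self[OF Fd] by blast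
  have F2: "?FU 2" unfolding eqF by (rule metric_free_topological_group.frechet_urysohn_short_elements_2[OF Fd])
  have A2: "?AU 2" unfolding eqA by (rule metric_free_topological_group.frechet_urysohn_short_elements_2[OF Ad])
  have F3: "?K" if "?FU 3"
    using metric_free_topological_group.not_frechet_urysohn_short_elements_3[OF Fd] that unfolding eqF by blast
  have A3: "?K" if "?AU 3"
    using metric_free_topological_group.not_frechet_urysohn_short_elements_3[OF Ad] that unfolding eqA by blast
  \<comment> \<open>These claims are bundled because all of them use the metric that compactness of
    the set of nonisolated points provides.\<close>
  have K: "?AU n \<and> ?FU 4 \<and> (?FU 5 \<longrightarrow> compact_space X \<or> X = discrete_topology ?M)" if K: ?K for n
  proof -
    obtain \<rho> where \<rho>: "Metric_space ?M \<rho>" "Metric_space.mtopology ?M \<rho> = X"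
      and cl: "\<And>f g. (\<And>k. f k \<in> ?M) \<Longrightarrow> (\<And>k. g k \<in> ?M) \<Longrightarrow> (\<And>k. f k \<noteq> g k) \<Longrightarrow>
         (\<lambda>k. \<rho> (f k) (g k)) \<longlonglongrightarrow> 0 \<Longrightarrow>
         \<exists>r p. strict_mono (r :: nat \<Rightarrow> nat) \<and> limitin X (f \<circ> r) p sequentially"
      using metric_compact_nonisolated[OF assms K] by blast
    interpret F\<rho>: metric_free_group X \<rho>
      unfolding metric_free_group_def by (rule metric_free_topological_groupI[OF locF \<rho>])
    interpret A\<rho>: metric_free_topological_group comm_group "free_Abelian_group ?M" frag_of X "free_abelian_topology X" \<rho>
      by (rule metric_free_topological_groupI[OF locA \<rho>])
    have clF: F\<rho>.clustering unfolding F\<rho>.clustering_def using cl by blast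
    have clA: A\<rho>.clustering unfolding A\<rho>.clustering_def using cl by blast
    have "?AU n" unfolding eqA
    proof (rule A\<rho>.frechet_urysohn_short_elements_balanced[OF clA])
      fix c assume c: "c \<in> A.short_elements n"
      then have c': "Poly_Mapping.keys c \<subseteq> ?M" "frag_length c \<le> n"
        using A.short_elements_subset short_elements_free_Abelian_group[OF assms] by auto
      obtain w where "letters w = Poly_Mapping.keys c" "length w = frag_length c" "word_frag w = c"
        using frag_word by blast
      then show "\<exists>w. letters w \<subseteq> ?M \<and> length w \<le> n \<and> A.val w = c \<and> letters w \<subseteq> Poly_Mapping.keys (word_frag w)"
        using c' by (intro exI[of _ w]) (simp add: letters_prod_free_Abelian_group)
    qed
    moreover have "?FU 4" unfolding eqF by (rule F\<rho>.frechet_urysohn_short_elements_4[OF clF])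
    moreover have "compact_space X \<or> X = discrete_topology ?M" if "?FU 5"
      using F\<rho>.not_frechet_urysohn_short_elements_5[OF clF] that unfolding eqF by blast
    ultimately show ?thesis by blast
  qed
  have FK: "?FU n \<Longrightarrow> 3 \<le> n \<Longrightarrow> ?K" for n using mono[of n 3] F3 by blast
  \<comment> \<open>Failure at length five is known only under \<open>clustering\<close>; therefore
    \<open>?FU 5\<close> is first reduced to \<open>?FU 3\<close>, which gives \<open>?K\<close> and
    with it the metric.\<close>
  have 1: "?FU 5 \<longleftrightarrow> compact_space X \<or> X = discrete_topology ?M"
    using FK[of 5] K compact discrete by auto
  then have 2: "(\<forall>n\<ge>1. ?FU n) \<longleftrightarrow> ?FU 5" using compact discrete by auto
  have 3: "?FU 3 \<longleftrightarrow> ?K" "?FU 4 \<longleftrightarrow> ?K" using FK[of 3] FK[of 4] K mono[of 4 3] by auto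
  have 4: "?AU 3 \<longleftrightarrow> ?K" "(\<forall>n\<ge>1. ?AU n) \<longleftrightarrow> ?K" using A3 K by auto
  show ?thesis using 1 2 3 4 F2 A2 by blast
qed

end
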